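(* Let $d\in\mathbb{N}$, $m\in\mathbb{N}_0$. Let $\rho,\pi$ be probability measures on $[-1,1]^d$ with $\mu$-densities $f_\rho,f_\pi$ satisfying Assumption (A) for some constants $0<M\le L<\infty$, $\boldsymbol\delta\in(0,\infty)^d$ and with $C_6=C_6(M,L)$, where $C_6(M,L),C_7(M,L)$ are the regularity constants described in the context. For $j\in\{1,\dots,d\}$ set $\varrho_j:=1+C_7\delta_j$. For $k\in\{1,\dots,d\}$ and $\varepsilon>0$ let $$\Lambda_{k,\varepsilon}:=\Big\{\boldsymbol\nu\in\mathbb{N}_0^k:\ \varrho_k^{-\max\{1,\nu_k\}}\prod_{j=1}^{k-1}\varrho_j^{-\nu_j}\ge\varepsilon\Big\},$$ and define $$\beta:=\Big((d-1)!\prod_{j=1}^d\log(\varrho_j)\Big)^{1/d}.$$ Let $T=(T_k)_{k=1}^d$ be the Knothe--Rosenblatt transport from $\rho$ to $\pi$. Then for every $\tilde\beta<\beta$ there exists $C>0$ (depending on $\boldsymbol\varrho,m,d,\tilde\beta,f_\rho,f_\pi$) such that for every $\varepsilon\in(0,1)$, with $$\tilde T_k:=\sum_{\boldsymbol\nu\in\Lambda_{k,\varepsilon}}l_{k,\boldsymbol\nu}L_{\boldsymbol\nu},\qquad l_{k,\boldsymbol\nu}:=\int_{[-1,1]^k}T_k(\boldsymbol y)L_{\boldsymbol\nu}(\boldsymbol y)\,d\mu(\boldsymbol y),$$ $\tilde T:=(\tilde T_k)_{k=1}^d$ and $N_\varepsilon:=\sum_{k=1}^d|\Lambda_{k,\varepsilon}|$,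 it holds $$\|T-\tilde T\|_{W^{m,\infty}([-1,1]^d)}\le C\exp(-\tilde\beta N_\varepsilon^{1/d}).$$
   Context: $\mu$ is the product measure $\bigotimes_j\lambda/2$ on $[-1,1]^k$ ($\lambda$ Lebesgue measure on $[-1,1]$). A probability density on $[-1,1]^d$ is a measurable positive function $f$ with $\int f\,d\mu=1$. $\boldsymbol x_{[k]}=(x_1,\dots,x_k)$. For $\delta>0$, $S\subseteq\mathbb{C}$: $\mathcal{B}_\delta(S)=\{z\in\mathbb{C}:\exists y\in S,|z-y|<\delta\}$; for $\boldsymbol\delta\in(0,\infty)^d$: $\mathcal{B}_{\boldsymbol\delta}(S)=\prod_i\mathcal{B}_{\delta_i}(S)$, $\mathcal{B}_{\boldsymbol\delta}=\prod_i\mathcal{B}_{\delta_i}(0)$. $C^1(O;B)$ for open $O\subseteq\mathbb{C}^n$ means holomorphic functions on $O$ with values in $B$; for a function given on $[-1,1]^n$ it means that a holomorphic extension (denoted by the same symbol) exists. Assumption (A) with constants $M,L,\boldsymbol\delta,C_6$: for $*\in\{\rho,\pi\}$: (a) $f_*:[-1,1]^d\to(0,\infty)$ is a probability density and $f_*\in C^1(\mathcal{B}_{\boldsymbol\delta}([-1,1]);\mathbb{C})$; (b) $M\le|f_*(\boldsymbol x)|\le L$ for $\boldsymbol x\in\mathcal{B}_{\boldsymbol\delta}([-1,1])$; (c) $\sup_{\boldsymbol y\in\mathcal{B}_{\boldsymbol\delta}}|f_*(\boldsymbol x+\boldsymbol y)-f_*(\boldsymbol x)|\le C_6$ for $\boldsymbol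 x\in[-1,1]^d$; (d) $\sup_{\boldsymbol y\in\mathcal{B}_{\boldsymbol\delta_{[k]}}\times\{0\}^{d-k}}|f_*(\boldsymbol x+\boldsymbol y)-f_*(\boldsymbol x)|\le C_6\delta_{k+1}$ for $\boldsymbol x\in[-1,1]^d$, $k\in\{1,\dots,d-1\}$. Knothe--Rosenblatt transport: for a density $f$ put $\hat f_0:=1$, $\hat f_k(\boldsymbol x_{[k]}):=\int_{[-1,1]^{d-k}}f(\boldsymbol x_{[k]},\boldsymbol t)\,d\mu(\boldsymbol t)$, $f_k(\boldsymbol x_{[k]}):=\hat f_k(\boldsymbol x_{[k]})/\hat f_{k-1}(\boldsymbol x_{[k-1]})$; with $f=f_*$ put $F_{*;k}(\boldsymbol x_{[k]}):=\int_{-1}^{x_k}f_{*;k}(\boldsymbol x_{[k-1]},t)\,dt$. Then $T_1:=(F_{\pi;1})^{-1}\circ F_{\rho;1}$ and $T_k(\boldsymbol x_{[k-1]},\cdot):=F_{\pi;k}(T_1(x_1),\dots,T_{k-1}(\boldsymbol x_{[k-1]}),\cdot)^{-1}\circ F_{\rho;k}(\boldsymbol x_{[k-1]},\cdot)$ (inverse in the last variable). Regularity constants: for $0<M\le L<\infty$, $C_6,C_7,C_8>0$ are constants depending only on $M,L$ such that, for all $d$ and $\boldsymbol\delta$, whenever $f_\rho,f_\pi$ satisfy Assumption (A) with $M,L,\boldsymbol\delta,C_6$, then with $\zeta_j=C_7\delta_j$ and $R_k=\partial_{x_k}T_k$, for all $k\in\{1,\dots,d\}$: $R_k\in C^1(\mathcal{B}_{\boldsymbol\zeta_{[k]}}([-1,1]);\mathcal{B}_{C_8}(1))$,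 $\Re R_k\ge1/C_8$ on $\mathcal{B}_{\boldsymbol\zeta_{[k]}}([-1,1])$, and if $k\ge2$, $R_k$ maps $\mathcal{B}_{\boldsymbol\zeta_{[k-1]}}([-1,1])\times[-1,1]$ to $\mathcal{B}_{C_8/\max\{1,\delta_k\}}(1)$. (Such constants exist; fix one choice.) $L_n$ is the $n$th Legendre polynomial normalized in $L^2([-1,1],\mu)$, and $L_{\boldsymbol\nu}(\boldsymbol y)=\prod_jL_{\nu_j}(y_j)$. Empty sums are $0$. $\|f\|_{W^{m,\infty}([-1,1]^d)}=\sum_{j=0}^m\operatorname{ess\,sup}_{\boldsymbol x}\|d^jf(\boldsymbol x)\|$ ($d^jf$ the weak $j$th derivative, Euclidean norm), and for vector-valued maps the norm is the sum of the norms of the components. $T_k,\tilde T_k$ depend only on $\boldsymbol x_{[k]}$ and are viewed as functions on $[-1,1]^d$. *)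

theory Defs
  imports
    "HOL-Analysis.Analysis"
    "HOL-Probability.Essential_Supremum"
    "HOL-Computational_Algebra.Polynomial"
begin

text \<open>
  Points of $\mathbb{R}^k$, $\mathbb{C}^k$ and $\mathbb{N}_0^k$ are extensional functions on the
  index set \<open>{1..k}\<close>, as in \<^const>\<open>PiE\<close> and \<^const>\<open>PiM\<close>. In this way the dimension can vary
  within a statement, and the topology and measure are those of the library.
\<close>

section \<open>The cube and its measure\<close>

definition cube :: "nat \<Rightarrow> (nat \<Rightarrow> real) set" where
  "cube k = PiE {1..k} (\<lambda>_. {-1..1})"

definition mu1 :: "real measure" where
  "mu1 = scale_measure (1/2) (restrict_space lborel {-1..1})"

definition mu :: "nat set \<Rightarrow> (nat \<Rightarrow> real) measure" where
  "mu I = PiM I (\<lambda>_. mu1)"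

definition prob_density :: "nat \<Rightarrow> ((nat \<Rightarrow> real) \<Rightarrow> real) \<Rightarrow> bool" where
  "prob_density d f \<longleftrightarrow>
     f \<in> borel_measurable (mu {1..d}) \<and> (\<forall>x\<in>cube d. 0 < f x) \<and> (\<integral>x. f x \<partial>mu {1..d}) = 1"

section \<open>Holomorphic functions of several variables\<close>

definition nbhd :: "real \<Rightarrow> complex set \<Rightarrow> complex set" where
  "nbhd r S = {z. \<exists>y\<in>S. dist z y < r}"

abbreviation cinterval :: "complex set" where
  "cinterval \<equiv> complex_of_real ` {-1..1}"

definition poly_nbhd :: "nat \<Rightarrow> (nat \<Rightarrow> real) \<Rightarrow> (nat \<Rightarrow> complex) set" where
  "poly_nbhd k \<delta> = PiE {1..k} (\<lambda>i. nbhd (\<delta> i) cinterval)"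

definition cemb :: "nat \<Rightarrow> (nat \<Rightarrow> real) \<Rightarrow> nat \<Rightarrow> complex" where
  "cemb k x = (\<lambda>i\<in>{1..k}. complex_of_real (x i))"

text \<open>Complex differentiability with respect to the $\ell^1$-norm on $\mathbb{C}^k$, for open $U$;
  \<open>a\<close> is the complex gradient.\<close>

definition holomorphic_n :: "nat \<Rightarrow> (nat \<Rightarrow> complex) set \<Rightarrow> ((nat \<Rightarrow> complex) \<Rightarrow> complex) \<Rightarrow> bool" where
  "holomorphic_n k U g \<longleftrightarrow>
     (\<forall>z\<in>U. \<exists>a :: nat \<Rightarrow> complex. \<forall>e>0. \<exists>r>0. \<forall>w\<in>U. (\<forall>i\<in>{1..k}. norm (w i - z i) < r) \<longrightarrow>
        norm (g w - g z - (\<Sum>i=1..k. a i * (w i - z i))) \<le> e * (\<Sum>i=1..k. norm (w i - z i)))"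

section \<open>Assumption (A)\<close>

text \<open>\<open>g\<close> is the holomorphic extension of \<open>f\<close>; it is unique, since the polyneighbourhood is
  connected and contains the cube.\<close>

definition assumption_A ::
  "nat \<Rightarrow> real \<Rightarrow> real \<Rightarrow> (nat \<Rightarrow> real) \<Rightarrow> real \<Rightarrow> ((nat \<Rightarrow> real) \<Rightarrow> real) \<Rightarrow> bool" where
  "assumption_A d M L \<delta> C\<^sub>6 f \<longleftrightarrow>
     prob_density d f \<and>
     (\<exists>g. holomorphic_n d (poly_nbhd d \<delta>) g \<and>
        (\<forall>x\<in>cube d. g (cemb d x) = complex_of_real (f x)) \<and>
        (\<forall>z\<in>poly_nbhd d \<delta>. M \<le> norm (g z) \<and> norm (g z) \<le> L) \<and>
        (\<forall>x\<in>cube d. \<forall>y\<in>PiE {1..d} (\<lambda>i. nbhd (\<delta> i) {0}).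
           norm (g (\<lambda>i\<in>{1..d}. cemb d x i + y i) - g (cemb d x)) \<le> C\<^sub>6) \<and>
        (\<forall>x\<in>cube d. \<forall>k\<in>{1..<d}.
           \<forall>y\<in>PiE {1..d} (\<lambda>i. if i \<le> k then nbhd (\<delta> i) {0} else {0}).
           norm (g (\<lambda>i\<in>{1..d}. cemb d x i + y i) - g (cemb d x)) \<le> C\<^sub>6 * \<delta> (k + 1)))"

section \<open>Knothe--Rosenblatt transport\<close>

text \<open>The functions with index \<open>k\<close> depend only on the coordinates \<open>x 1, \<dots>, x k\<close> of their argument,
  so they can be evaluated on the \<open>k\<close>-dimensional cube and on every higher-dimensional one.\<close>

definition marginal :: "nat \<Rightarrow> ((nat \<Rightarrow> real) \<Rightarrow> real) \<Rightarrow> nat \<Rightarrow> (nat \<Rightarrow> real) \<Rightarrow> real" where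
  "marginal d f k x =
     (if k = 0 then 1 else (\<integral>t. f (merge {1..k} {k+1..d} (x, t)) \<partial>mu {k+1..d}))"

definition cond_density :: "nat \<Rightarrow> ((nat \<Rightarrow> real) \<Rightarrow> real) \<Rightarrow> nat \<Rightarrow> (nat \<Rightarrow> real) \<Rightarrow> real" where
  "cond_density d f k x = marginal d f k x / marginal d f (k - 1) x"

definition cond_cdf :: "nat \<Rightarrow> ((nat \<Rightarrow> real) \<Rightarrow> real) \<Rightarrow> nat \<Rightarrow> (nat \<Rightarrow> real) \<Rightarrow> real" where
  "cond_cdf d f k x = (LINT t:{-1..x k}|lborel. cond_density d f k (x(k := t)))"

text \<open>\<open>KR_vec d f g k x\<close> is the point $(T_1(x),\dots,T_k(x))$ for the transport from the density \<open>f\<close>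
  to the density \<open>g\<close>.\<close>

primrec KR_vec ::
  "nat \<Rightarrow> ((nat \<Rightarrow> real) \<Rightarrow> real) \<Rightarrow> ((nat \<Rightarrow> real) \<Rightarrow> real) \<Rightarrow> nat \<Rightarrow> (nat \<Rightarrow> real) \<Rightarrow> nat \<Rightarrow> real" where
  "KR_vec d f g 0 x = (\<lambda>_. undefined)"
| "KR_vec d f g (Suc k) x =
     (KR_vec d f g k x)(Suc k :=
        inv_into {-1..1} (\<lambda>y. cond_cdf d g (Suc k) ((KR_vec d f g k x)(Suc k := y)))
          (cond_cdf d f (Suc k) x))"

definition KR ::
  "nat \<Rightarrow> ((nat \<Rightarrow> real) \<Rightarrow> real) \<Rightarrow> ((nat \<Rightarrow> real) \<Rightarrow> real) \<Rightarrow> nat \<Rightarrow> (nat \<Rightarrow> real) \<Rightarrow> real" where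
  "KR d f g k x = KR_vec d f g k x k"

section \<open>Regularity constants\<close>

text \<open>\<open>R\<close> is the holomorphic extension of $\partial_{x_k}T_k$, a one-sided derivative at
  \<open>x k = 1\<close> and \<open>x k = -1\<close>.\<close>

definition regularity_constants :: "real \<Rightarrow> real \<Rightarrow> real \<Rightarrow> real \<Rightarrow> real \<Rightarrow> bool" where
  "regularity_constants M L C\<^sub>6 C\<^sub>7 C\<^sub>8 \<longleftrightarrow>
     0 < C\<^sub>6 \<and> 0 < C\<^sub>7 \<and> 0 < C\<^sub>8 \<and>
     (\<forall>d\<ge>1. \<forall>\<delta> f g.
        (\<forall>j\<in>{1..d}. 0 < \<delta> j) \<longrightarrow> assumption_A d M L \<delta> C\<^sub>6 f \<longrightarrow> assumption_A d M L \<delta> C\<^sub>6 g \<longrightarrow>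
        (\<forall>k\<in>{1..d}. let \<zeta> = (\<lambda>j. C\<^sub>7 * \<delta> j) in
           \<exists>R. holomorphic_n k (poly_nbhd k \<zeta>) R \<and>
             (\<forall>x\<in>cube k.
                ((\<lambda>t. complex_of_real (KR d f g k (x(k := t)))) has_vector_derivative R (cemb k x))
                  (at (x k) within {-1..1})) \<and>
             (\<forall>z\<in>poly_nbhd k \<zeta>. R z \<in> ball 1 C\<^sub>8 \<and> 1 / C\<^sub>8 \<le> Re (R z)) \<and>
             (2 \<le> k \<longrightarrow>
                (\<forall>z\<in>PiE {1..k} (\<lambda>i. if i < k then nbhd (\<zeta> i) cinterval else cinterval).
                   R z \<in> ball 1 (C\<^sub>8 / max 1 (\<delta> k))))))"

section \<open>Legendre expansions\<close>

text \<open>Rodrigues' formula; $\int P_n^2\,d\mu = 1/(2n+1)$.\<close>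

definition legendre_poly :: "nat \<Rightarrow> real poly" where
  "legendre_poly n = smult (1 / (2 ^ n * fact n)) ((pderiv ^^ n) ([:-1, 0, 1:] ^ n))"

definition legendre :: "nat \<Rightarrow> real \<Rightarrow> real" where
  "legendre n x = sqrt (2 * real n + 1) * poly (legendre_poly n) x"

definition legendre_prod :: "nat \<Rightarrow> (nat \<Rightarrow> nat) \<Rightarrow> (nat \<Rightarrow> real) \<Rightarrow> real" where
  "legendre_prod k \<nu> y = (\<Prod>j=1..k. legendre (\<nu> j) (y j))"

text \<open>\<open>r j\<close> is the radius $\varrho_j$.\<close>

definition Lambda :: "(nat \<Rightarrow> real) \<Rightarrow> nat \<Rightarrow> real \<Rightarrow> (nat \<Rightarrow> nat) set" where
  "Lambda r k \<epsilon> =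
     {\<nu> \<in> PiE {1..k} (\<lambda>_. UNIV).
        r k powi (- int (max 1 (\<nu> k))) * (\<Prod>j=1..<k. r j powi (- int (\<nu> j))) \<ge> \<epsilon>}"

definition legendre_coeff :: "nat \<Rightarrow> ((nat \<Rightarrow> real) \<Rightarrow> real) \<Rightarrow> (nat \<Rightarrow> nat) \<Rightarrow> real" where
  "legendre_coeff k S \<nu> = (\<integral>y. S y * legendre_prod k \<nu> y \<partial>mu {1..k})"

definition legendre_trunc ::
  "(nat \<Rightarrow> real) \<Rightarrow> nat \<Rightarrow> real \<Rightarrow> ((nat \<Rightarrow> real) \<Rightarrow> real) \<Rightarrow> (nat \<Rightarrow> real) \<Rightarrow> real" where
  "legendre_trunc r k \<epsilon> S x = (\<Sum>\<nu>\<in>Lambda r k \<epsilon>. legendre_coeff k S \<nu> * legendre_prod k \<nu> x)"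

section \<open>Sobolev norm\<close>

definition partial_deriv :: "nat \<Rightarrow> ((nat \<Rightarrow> real) \<Rightarrow> real) \<Rightarrow> (nat \<Rightarrow> real) \<Rightarrow> real" where
  "partial_deriv i \<phi> x = deriv (\<lambda>t. \<phi> (x(i := t))) (x i)"

definition partials :: "nat list \<Rightarrow> ((nat \<Rightarrow> real) \<Rightarrow> real) \<Rightarrow> (nat \<Rightarrow> real) \<Rightarrow> real" where
  "partials is \<phi> = foldr partial_deriv is \<phi>"

text \<open>Smooth functions on $\mathbb{R}^d$ with compact support in the open cube $(-1,1)^d$.\<close>

definition test_functions :: "nat \<Rightarrow> ((nat \<Rightarrow> real) \<Rightarrow> real) set" where
  "test_functions d =
     {\<phi>. (\<forall>is. set is \<subseteq> {1..d} \<longrightarrow>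
            continuous_on (PiE {1..d} (\<lambda>_. UNIV)) (partials is \<phi>) \<and>
            (\<forall>i\<in>{1..d}. \<forall>x\<in>PiE {1..d} (\<lambda>_. UNIV).
               (\<lambda>t. partials is \<phi> (x(i := t))) field_differentiable at (x i))) \<and>
         (\<exists>r<1. \<forall>x\<in>PiE {1..d} (\<lambda>_. UNIV). (\<exists>i\<in>{1..d}. r < \<bar>x i\<bar>) \<longrightarrow> \<phi> x = 0)}"

definition locally_integrable :: "nat \<Rightarrow> ((nat \<Rightarrow> real) \<Rightarrow> real) \<Rightarrow> bool" where
  "locally_integrable d u \<longleftrightarrow>
     u \<in> borel_measurable (mu {1..d}) \<and>
     (\<forall>r<1. set_integrable (mu {1..d}) (PiE {1..d} (\<lambda>_. {-r..r})) u)"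

text \<open>\<open>v\<close> is the weak derivative $\partial_{i_1}\cdots\partial_{i_j}u$ on $(-1,1)^d$, where
  \<open>is\<close> is the list of the $i_l$. Integrating against \<open>mu\<close> instead of Lebesgue measure divides both
  sides by $2^d$.\<close>

definition weak_deriv ::
  "nat \<Rightarrow> nat list \<Rightarrow> ((nat \<Rightarrow> real) \<Rightarrow> real) \<Rightarrow> ((nat \<Rightarrow> real) \<Rightarrow> real) \<Rightarrow> bool" where
  "weak_deriv d is u v \<longleftrightarrow>
     locally_integrable d u \<and> locally_integrable d v \<and>
     (\<forall>\<phi>\<in>test_functions d.
        (\<integral>x. u x * partials is \<phi> x \<partial>mu {1..d}) =
        (-1) ^ length is * (\<integral>x. v x * \<phi> x \<partial>mu {1..d}))"

text \<open>Weak derivatives are unique almost everywhere, so all \<open>D\<close> in the infimum give the same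
  value; the norm is \<open>\<infinity>\<close> if some weak derivative of order at most \<open>m\<close> does not exist.\<close>

definition sobolev_norm :: "nat \<Rightarrow> nat \<Rightarrow> ((nat \<Rightarrow> real) \<Rightarrow> real) \<Rightarrow> ennreal" where
  "sobolev_norm d m u =
     (INF D \<in> {D :: nat list \<Rightarrow> (nat \<Rightarrow> real) \<Rightarrow> real.
               \<forall>is. set is \<subseteq> {1..d} \<and> length is \<le> m \<longrightarrow> weak_deriv d is u (D is)}.
        \<Sum>j\<le>m. esssup (mu {1..d})
          (\<lambda>x. ennreal (sqrt (\<Sum>is\<in>{is. set is \<subseteq> {1..d} \<and> length is = j}. (D is x)\<^sup>2))))"

end

theory Submission
  imports
    Defs
    "HOL-Probability.Probability"
    "HOL-Complex_Analysis.Complex_Analysis"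
    "HOL-Real_Asymp.Real_Asymp"
begin

text \<open>
  The derivative $R_k=\partial_{x_k}T_k$ is bounded and holomorphic on a polyneighbourhood that contains
  the product of the Bernstein ellipses with parameters $\varrho_j$. Interpolating in one variable after
  the other at the Chebyshev nodes, and using that $L_n$ is orthogonal to all polynomials of lower degree,
  one gets $|l_{k,\nu}|\le C\prod_j(\nu_j+1)^a\varrho_j^{-\tau\nu_j}$ for every $\tau<1$; the passage from
  $R_k$ to $T_k$ is an integration by parts in $x_k$ and uses $T_k=-1$ on $x_k=-1$. Interpolation only
  evaluates the function at finitely many points, so it preserves holomorphy in the remaining variables.
  The derivatives of $L_\nu$ grow polynomially in $\nu$, hence the part of the series outside
  $\Lambda_{k,\varepsilon}$ is $O(\varepsilon^\theta)$ in $W^{m,\infty}$ for every $\theta<1$. Finally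
  $|\Lambda_{k,\varepsilon}|\le(\log(1/\varepsilon)+\sum_j\log\varrho_j)^d/(d!\prod_j\log\varrho_j)$ by counting the
  lattice points of a simplex, and summing over $k$ gives
  $N_\varepsilon\le((\log(1/\varepsilon)+\sum_j\log\varrho_j)/\beta)^d$.
\<close>

section \<open>The product measure on the cube\<close>

text \<open>Holomorphy enters through R_k alone; the extension of T_k, an implicitly defined
  inverse, is not analysed. The integration by parts costs one degree in x_k, hence a factor
  \<rho>_k, comparable to the gap between max{1,\<nu>_k} and \<nu>_k in the index sets. Two losses
  in the exponent explain the strict inequality for the rate: the ellipse fits into the
  neighbourhood of radius \<zeta> when \<rho> < 1 + \<zeta>, which forces \<tau> < 1, and the
  polynomial factors are summed with a part of the decay, which forces \<theta> < \<tau>. Chebyshev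
  nodes are used because their nodal polynomial is explicit in the variable w of z = (w + 1/w)/2, on
  the ellipse as well as on the interval. Decay of the coefficients does not yet show that the
  series represents T_k. Completeness, from Stone-Weierstrass, gives equality almost everywhere,
  which is enough: the weak derivatives are read off from the termwise differentiated series. The
  factorial (d-1)! in \<beta> is d!/d: each of the d index sets is counted inside the same
  d-dimensional simplex.\<close>

lemma space_mu1 [simp]: "space mu1 = {-1..1}"
  by (simp add: mu1_def space_scale_measure space_restrict_space)

lemma sets_mu1: "sets mu1 = sets (restrict_space borel {-1..1})"
  by (simp add: mu1_def sets_restrict_space)

lemma measurable_mu1: "measurable mu1 N = measurable (restrict_space borel {-1..1}) N"
  by (rule measurable_cong_sets) (simp_all add: sets_mu1)

lemma prob_space_mu1: "prob_space mu1"
proof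
  have "emeasure (restrict_space lborel {-1..1::real}) {-1..1} = 2"
    by (subst emeasure_restrict_space) auto
  moreover have "(1/2) * (2::ennreal) = 1"
    using ennreal_divide_self[of 2] by (simp add: divide_ennreal_def mult.commute)
  ultimately show "emeasure mu1 (space mu1) = 1"
    unfolding space_mu1 by (simp add: mu1_def)
qed

interpretation mu1: prob_space mu1 by (rule prob_space_mu1)

lemma integral_mu1:
  fixes g :: "real \<Rightarrow> real"
  assumes "set_borel_measurable lborel {-1..1} g"
  shows "(\<integral>x. g x \<partial>mu1) = (LINT x:{-1..1}|lborel. g x) / 2"
proof -
  \<comment> \<open>Scaling by a constant amounts to a constant density, and for densities the
    change of measure in the Bochner integral is available.\<close>
  have "mu1 = density (restrict_space lborel {-1..1}) (\<lambda>_. ennreal (1/2))"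
  proof (rule measure_eqI)
    fix A assume "A \<in> sets mu1"
    then have A: "A \<in> sets (restrict_space lborel {-1..1::real})" by (simp add: mu1_def)
    have "ennreal (1/2) = 1/2"
      using divide_ennreal[of 1 2] by simp
    with A show "emeasure mu1 A = emeasure (density (restrict_space lborel {-1..1}) (\<lambda>_. ennreal (1/2))) A"
      by (simp add: mu1_def emeasure_density nn_integral_cmult_indicator)
  qed (simp add: mu1_def)
  moreover have "g \<in> borel_measurable (restrict_space lborel {-1..1})"
    using assms by (subst borel_measurable_restrict_space_iff) (auto simp: set_borel_measurable_def)
  ultimately have "(\<integral>x. g x \<partial>mu1) = (\<integral>x. (1/2) *\<^sub>R g x \<partial>restrict_space lborel {-1..1})"
    by (subst integral_density[symmetric]) auto
  also have "\<dots> = (LINT x:{-1..1}|lborel. g x) / 2"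
    by (subst integral_restrict_space) (auto simp: set_lebesgue_integral_def)
  finally show ?thesis .
qed

lemma integral_mu1_FTC:
  fixes F f :: "real \<Rightarrow> real"
  assumes "\<And>x. x \<in> {-1..1} \<Longrightarrow> (F has_vector_derivative f x) (at x within {-1..1})"
    and "continuous_on {-1..1} f"
  shows "(\<integral>x. f x \<partial>mu1) = (F 1 - F (-1)) / 2"
proof -
  have "set_integrable lborel {-1..1} f"
    unfolding set_integrable_def by (intro borel_integrable_compact assms) auto
  then have "set_borel_measurable lborel {-1..1} f"
    by (auto simp: set_integrable_def set_borel_measurable_def)
  moreover have "(LINT x:{-1..1}|lborel. f x) = F 1 - F (-1)"
    unfolding set_lebesgue_integral_def by (rule integral_FTC_atLeastAtMost) (use assms in auto)
  ultimately show ?thesis by (simp add: integral_mu1)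
qed

interpretation mu: product_prob_space "\<lambda>_::nat. mu1" I for I
  by unfold_locales

lemma space_mu: "space (mu I) = PiE I (\<lambda>_. {-1..1})"
  by (simp add: mu_def space_PiM)

lemma space_mu_cube: "space (mu {1..k}) = cube k"
  by (simp add: space_mu cube_def)

lemma prob_space_mu: "prob_space (mu I)"
  unfolding mu_def by (rule prob_space_PiM) (rule prob_space_mu1)

lemma mu1_measurable_ident: "(\<lambda>x. x) \<in> borel_measurable mu1"
  unfolding measurable_mu1 by (rule measurable_restrict_space1) simp

text \<open>Outside \<open>I\<close> every point of the space takes the value
  \<open>undefined\<close>, so the coordinate is constant there. Having all coordinates measurable
  lets \<open>measurable_mu_borel\<close> treat the points as elements of the full function
  space.\<close>

lemma measurable_mu_component: "(\<lambda>x. x j) \<in> borel_measurable (mu I)"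
proof (cases "j \<in> I")
  case True
  then have "(\<lambda>x. x j) \<in> measurable (mu I) mu1"
    unfolding mu_def by (rule measurable_component_singleton)
  from measurable_comp[OF this mu1_measurable_ident] show ?thesis by (simp add: o_def)
next
  case False
  then have "x j = undefined" if "x \<in> space (mu I)" for x :: "nat \<Rightarrow> real"
    using that unfolding space_mu by (rule PiE_arb[rotated])
  then show ?thesis
    by (subst measurable_cong[where g = "\<lambda>_. undefined"]) (assumption, rule measurable_const, simp)
qed

lemma measurable_mu_borel: "(\<lambda>x. x) \<in> measurable (mu I) borel"
  by (rule measurable_coordinatewise_then_product) (rule measurable_mu_component)

text \<open>The extension of \<open>f\<close> by zero off the closed set \<open>S\<close> is Borel
  on the full function space; \<open>measurable_mu_borel\<close> pulls it back to the product
  \<sigma>-algebra, and on the space of \<open>mu I\<close> it agrees with \<open>f\<close>.\<close>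

lemma continuous_on_mu_measurable:
  fixes f :: "(nat \<Rightarrow> real) \<Rightarrow> 'b::{real_normed_vector, second_countable_topology}"
  assumes "continuous_on S f" "closed S" "PiE I (\<lambda>_. {-1..1}) \<subseteq> S"
  shows "f \<in> borel_measurable (mu I)"
proof -
  have "(\<lambda>x. indicator S x *\<^sub>R f x) \<in> borel_measurable borel"
    by (rule borel_measurable_continuous_on_indicator[OF borel_closed[OF assms(2)] assms(1)])
  then have "(\<lambda>x. indicator S x *\<^sub>R f x) \<in> borel_measurable (mu I)"
    by (rule measurable_compose[OF measurable_mu_borel])
  moreover have "(\<lambda>x. indicator S x *\<^sub>R f x) \<in> borel_measurable (mu I) \<longleftrightarrow> f \<in> borel_measurable (mu I)"
    using assms(3) by (intro measurable_cong) (auto simp: space_mu indicator_def)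
  ultimately show ?thesis by simp
qed

lemma measurable_mu_upd:
  assumes "j \<in> I" "t \<in> {-1..1}"
  shows "(\<lambda>x. x(j := t)) \<in> measurable (mu I) (mu I)"
  unfolding mu_def
proof (rule measurable_PiM_single')
  fix i assume i: "i \<in> I"
  show "(\<lambda>x. (x(j := t)) i) \<in> measurable (PiM I (\<lambda>_. mu1)) mu1"
  proof (cases "i = j")
    case True then show ?thesis using assms by simp
  next
    case False then show ?thesis using i by simp
  qed
next
  show "(\<lambda>x. x(j := t)) \<in> space (PiM I (\<lambda>_. mu1)) \<rightarrow> (\<Pi>\<^sub>E i\<in>I. space mu1)"
    using assms by (auto simp: space_PiM PiE_def extensional_def Pi_def)
qed

lemma integrable_mu_bounded:
  fixes F :: "_ \<Rightarrow> 'b::{banach, second_countable_topology}"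
  assumes "F \<in> borel_measurable (mu I)" "\<And>x. x \<in> PiE I (\<lambda>_. {-1..1}) \<Longrightarrow> norm (F x) \<le> B"
  shows "integrable (mu I) F"
proof -
  interpret prob_space "mu I" by (rule prob_space_mu)
  show ?thesis using assms by (intro integrable_const_bound[of _ B]) (auto simp: space_mu)
qed

lemma integral_mu_insert:
  fixes F :: "(nat \<Rightarrow> real) \<Rightarrow> 'b::{banach, second_countable_topology}"
  assumes "finite I" "j \<notin> I" "integrable (mu (insert j I)) F"
  shows "integral\<^sup>L (mu (insert j I)) F = (\<integral>x. (\<integral>t. F (x(j := t)) \<partial>mu1) \<partial>mu I)"
proof -

  show ?thesis using assms unfolding mu_def by (intro mu.product_integral_insert)
qed

text \<open>Fubini in the form in which it is used throughout: orthogonality and integration by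
  parts act in a single variable, and the other coordinates are mere parameters.\<close>

lemma integral_mu_eq_coord:
  fixes F G :: "(nat \<Rightarrow> real) \<Rightarrow> 'b::{banach, second_countable_topology}"
  assumes "finite I" "j \<in> I" "integrable (mu I) F" "integrable (mu I) G"
    and "\<And>x. x \<in> PiE I (\<lambda>_. {-1..1}) \<Longrightarrow> (\<integral>t. F (x(j := t)) \<partial>mu1) = (\<integral>t. G (x(j := t)) \<partial>mu1)"
  shows "integral\<^sup>L (mu I) F = integral\<^sup>L (mu I) G"
proof -
  have I: "I = insert j (I - {j})" using assms by auto
  have *: "(\<integral>t. F (x(j := t)) \<partial>mu1) = (\<integral>t. G (x(j := t)) \<partial>mu1)"
    if "x \<in> space (mu (I - {j}))" for x
  proof -
    \<comment> \<open>A point over \<open>I - {j}\<close> has no coordinate \<open>j\<close>. The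
      value 0 makes it a point of the cube and is overwritten by \<open>t\<close>
      afterwards.\<close>
    have "x(j := 0) \<in> PiE I (\<lambda>_. {-1..1})"
      using that assms(2) by (auto simp: space_mu PiE_def extensional_def Pi_def)
    from assms(5)[OF this] show ?thesis by simp
  qed
  have "integral\<^sup>L (mu I) F = (\<integral>x. (\<integral>t. F (x(j := t)) \<partial>mu1) \<partial>mu (I - {j}))"
    by (subst I, rule integral_mu_insert) (use assms(1-3) in \<open>auto simp: insert_absorb\<close>)
  also have "\<dots> = (\<integral>x. (\<integral>t. G (x(j := t)) \<partial>mu1) \<partial>mu (I - {j}))"
    by (rule Bochner_Integration.integral_cong) (use * in auto)
  also have "\<dots> = integral\<^sup>L (mu I) G"
    by (subst (2) I, rule integral_mu_insert[symmetric]) (use assms(1-4) in \<open>auto simp: insert_absorb\<close>)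
  finally show ?thesis .
qed

lemma integral_mu_prod:
  fixes g :: "nat \<Rightarrow> real \<Rightarrow> real"
  assumes "finite I" "\<And>i. i \<in> I \<Longrightarrow> integrable mu1 (g i)"
  shows "(\<integral>x. (\<Prod>i\<in>I. g i (x i)) \<partial>mu I) = (\<Prod>i\<in>I. \<integral>t. g i t \<partial>mu1)"
proof -

  show ?thesis using assms unfolding mu_def by (intro mu.product_integral_prod)
qed

lemma mu_restrict_measurable:
  "J \<subseteq> I \<Longrightarrow> (\<lambda>x. restrict x J) \<in> measurable (mu I) (mu J)"
  unfolding mu_def by (rule measurable_restrict_subset)

text \<open>The image of \<open>mu I\<close> under restriction is \<open>mu J\<close>, so null sets
  pull back to null sets. This later lifts the Legendre expansion of T_k from [-1,1]^k to
  [-1,1]^d.\<close>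

lemma AE_mu_restrict:
  assumes "J \<subseteq> I" "finite I" "AE x in mu J. P x"
  shows "AE x in mu I. P (restrict x J)"
proof -
  have "mu J = distr (mu I) (mu J) (\<lambda>x. restrict x J)"
    unfolding mu_def by (rule mu.distr_restrict) (use assms in auto)
  then have "AE x in distr (mu I) (mu J) (\<lambda>x. restrict x J). P x"
    by (rule subst[where P = "\<lambda>M. almost_everywhere M P"]) (rule assms(3))
  then show ?thesis by (rule AE_distrD[OF mu_restrict_measurable[OF assms(1)]])
qed

section \<open>Legendre polynomials\<close>

lemma integrable_mu1_continuous:
  fixes g :: "real \<Rightarrow> real"
  assumes "continuous_on {-1..1} g"
  shows "integrable mu1 g"
proof -
  have "compact (g ` {-1..1})"
    by (rule compact_continuous_image[OF assms]) simp
  then obtain B where B: "\<And>x. x \<in> {-1..1} \<Longrightarrow> norm (g x) \<le> B"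
    by (meson bounded_iff compact_imp_bounded image_eqI)
  have "g \<in> borel_measurable mu1"
    unfolding measurable_mu1 by (rule borel_measurable_continuous_on_restrict[OF assms])
  with B show ?thesis by (intro mu1.integrable_const_bound[of _ B]) auto
qed

lemma integrable_mu1_poly [simp]: "integrable mu1 (poly p)" for p :: "real poly"
  by (intro integrable_mu1_continuous continuous_intros)

lemma integral_mu1_pderiv:
  fixes Q :: "real poly"
  shows "(\<integral>x. poly (pderiv Q) x \<partial>mu1) = (poly Q 1 - poly Q (-1)) / 2"
proof (rule integral_mu1_FTC)
  fix x show "(poly Q has_vector_derivative poly (pderiv Q) x) (at x within {-1..1})"
    by (metis DERIV_subset poly_DERIV has_real_derivative_iff_has_vector_derivative subset_UNIV)
qed (intro continuous_intros)

lemma integral_mu1_poly_parts: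
  fixes A B :: "real poly"
  shows "(\<integral>x. poly (pderiv A * B) x \<partial>mu1) =
    (poly (A * B) 1 - poly (A * B) (-1)) / 2 - (\<integral>x. poly (A * pderiv B) x \<partial>mu1)"
proof -
  have "(\<integral>x. poly (pderiv (A * B)) x \<partial>mu1) =
     (\<integral>x. poly (pderiv A * B) x + poly (A * pderiv B) x \<partial>mu1)"
    by (rule Bochner_Integration.integral_cong) (auto simp: pderiv_mult algebra_simps)
  also have "\<dots> = (\<integral>x. poly (pderiv A * B) x \<partial>mu1) + (\<integral>x. poly (A * pderiv B) x \<partial>mu1)"
    by (intro Bochner_Integration.integral_add integrable_mu1_poly)
  finally show ?thesis by (simp add: integral_mu1_pderiv field_simps)
qed

section \<open>Rodrigues' formula: values at the endpoints and orthogonality\<close>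

lemma higher_pderiv_eq_0:
  fixes q :: "real poly"
  shows "degree q < n \<Longrightarrow> (pderiv ^^ n) q = 0"
proof (induction n arbitrary: q)
  case (Suc n)
  show ?case
  proof (cases "degree q = 0")
    case True
    then have "pderiv q = 0" by (simp add: pderiv_eq_0_iff)
    then show ?thesis by (simp add: funpow_Suc_right del: funpow.simps)
  next
    case False
    then have "degree (pderiv q) < n" using Suc.prems by (simp add: degree_pderiv)
    then show ?thesis using Suc.IH by (simp add: funpow_Suc_right del: funpow.simps)
  qed
qed simp

text \<open>Each derivative removes one factor X - a and leaves a polynomial cofactor; with
  \<open>g\<close> arbitrary this drives the two inductions that follow.\<close>

lemma pderiv_linear_power_mult:
  fixes g :: "real poly"
  shows "pderiv ([:-a, 1:] ^ Suc n * g) =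
    [:-a, 1:] ^ n * (smult (real (Suc n)) g + [:-a, 1:] * pderiv g)"
proof -
  have "pderiv ([:-a, 1:] ^ Suc n) = smult (real (Suc n)) ([:-a, 1:] ^ n)"
    by (subst pderiv_power_Suc) (simp add: pderiv_pCons)
  then show ?thesis by (subst pderiv_mult) (simp add: algebra_simps smult_add_right)
qed

lemma poly_higher_pderiv_linear_power:
  fixes g :: "real poly"
  shows "poly ((pderiv ^^ n) ([:-a, 1:] ^ n * g)) a = fact n * poly g a"
proof (induction n arbitrary: g)
  case (Suc n)
  show ?case
    unfolding funpow_Suc_right o_apply pderiv_linear_power_mult Suc.IH
    by (simp add: algebra_simps)
qed simp

lemma poly_higher_pderiv_linear_power_0:
  fixes g :: "real poly"
  shows "j < n \<Longrightarrow> poly ((pderiv ^^ j) ([:-a, 1:] ^ n * g)) a = 0"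
proof (induction j arbitrary: n g)
  case 0
  then show ?case by (simp add: zero_power)
next
  case (Suc j)
  then obtain n' where n: "n = Suc n'" "j < n'" by (cases n) auto
  show ?case
    unfolding funpow_Suc_right o_apply n(1) pderiv_linear_power_mult by (rule Suc.IH[OF n(2)])
qed

abbreviation rodrigues :: "nat \<Rightarrow> real poly" where
  "rodrigues n \<equiv> [:-1, 0, 1:] ^ n"

lemma rodrigues_factor1: "rodrigues n = [:-1, 1:] ^ n * [:1, 1:] ^ n"
  by (simp add: power_mult_distrib[symmetric])

lemma rodrigues_factor2: "rodrigues n = [:-(-1), 1:] ^ n * [:-1, 1:] ^ n"
  by (simp add: power_mult_distrib[symmetric])

lemma legendre_poly_at_1: "poly (legendre_poly n) 1 = 1"
proof -
  have "poly ((pderiv ^^ n) (rodrigues n)) 1 = fact n * 2 ^ n"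
    unfolding rodrigues_factor1 poly_higher_pderiv_linear_power by simp
  then show ?thesis by (simp add: legendre_poly_def)
qed

lemma legendre_poly_at_m1: "poly (legendre_poly n) (-1) = (-1) ^ n"
proof -
  have "poly ((pderiv ^^ n) (rodrigues n)) (-1) = fact n * (-2) ^ n"
    unfolding rodrigues_factor2 poly_higher_pderiv_linear_power by simp
  then show ?thesis
    by (simp add: legendre_poly_def power_minus[of 2] field_simps)
qed

text \<open>Integration by parts j times. The boundary terms vanish because all derivatives of (X^2
  - 1)^n of order less than n are zero at 1 and at -1.\<close>

lemma rodrigues_parts:
  fixes q :: "real poly"
  assumes "j \<le> n"
  shows "(\<integral>x. poly ((pderiv ^^ n) (rodrigues n) * q) x \<partial>mu1) =
    (-1) ^ j * (\<integral>x. poly ((pderiv ^^ (n - j)) (rodrigues n) * (pderiv ^^ j) q) x \<partial>mu1)"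
  using assms
proof (induction j)
  case (Suc j)
  let ?A = "(pderiv ^^ (n - Suc j)) (rodrigues n)"
  have 1: "poly ?A 1 = 0"
    unfolding rodrigues_factor1 by (rule poly_higher_pderiv_linear_power_0) (use Suc.prems in auto)
  have 2: "poly ?A (-1) = 0"
    unfolding rodrigues_factor2 by (rule poly_higher_pderiv_linear_power_0) (use Suc.prems in auto)
  have "n - j = Suc (n - Suc j)" using Suc.prems by simp
  then have "(pderiv ^^ (n - j)) (rodrigues n) = pderiv ?A" by simp
  then have "(\<integral>x. poly ((pderiv ^^ n) (rodrigues n) * q) x \<partial>mu1) =
      (-1) ^ j * (\<integral>x. poly (pderiv ?A * (pderiv ^^ j) q) x \<partial>mu1)"
    using Suc by (simp del: poly_mult)
  also have "(\<integral>x. poly (pderiv ?A * (pderiv ^^ j) q) x \<partial>mu1) =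
      - (\<integral>x. poly (?A * (pderiv ^^ Suc j) q) x \<partial>mu1)"
    unfolding integral_mu1_poly_parts by (simp add: 1 2 del: poly_mult) (simp add: 1 2)
  finally show ?case by (simp del: poly_mult)
qed simp

lemma legendre_poly_orthogonal:
  fixes q :: "real poly"
  assumes "degree q < n"
  shows "(\<integral>x. poly (legendre_poly n * q) x \<partial>mu1) = 0"
proof -
  have "poly (0 :: real poly) = (\<lambda>_. 0)" by auto
  then have "(\<integral>x. poly ((pderiv ^^ n) (rodrigues n) * q) x \<partial>mu1) = 0"
    by (subst rodrigues_parts[OF order.refl]) (simp add: higher_pderiv_eq_0[OF assms])
  then show ?thesis by (simp add: legendre_poly_def mult.assoc)
qed

lemma degree_legendre_poly: "degree (legendre_poly n) = n"
  by (simp add: legendre_poly_def degree_higher_pderiv degree_power_eq)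

text \<open>The second derivative of (X^2 - 1)^(n+2) is a combination of (X^2 - 1)^(n+1) and (X^2 -
  1)^n; differentiating n + 1 more times gives the recurrence. Both the norm and all growth bounds
  are derived from it.\<close>

lemma legendre_poly_rec:
  "pderiv (legendre_poly (Suc (Suc n))) =
     smult (2 * real n + 3) (legendre_poly (Suc n)) + pderiv (legendre_poly n)"
proof -
  \<comment> \<open>Introduced by \<open>obtain\<close> so that both stay opaque and the simplifier
    does not expand the coefficient lists.\<close>
  obtain X R where XR: "X = [:0, 1 :: real:]" "R = (\<lambda>m. rodrigues m)" by blast
  have d: "pderiv (R (Suc m)) = smult (2 * (real m + 1)) (X * R m)" for m
    unfolding XR by (subst pderiv_power_Suc) (simp add: pderiv_pCons algebra_simps)
  \<comment> \<open>From X^2 = (X^2 - 1) + 1.\<close>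
  have x2: "X * (X * R n) = R (Suc n) + R n"
    unfolding XR by (simp add: algebra_simps)
  have dX: "pderiv X = 1" unfolding XR by (simp add: pderiv_pCons one_pCons)
  have "pderiv (pderiv (R (Suc (Suc n)))) =
      smult (2 * (real n + 2)) (pderiv (X * R (Suc n)))"
    unfolding d by (simp add: pderiv_smult algebra_simps)
  also have "pderiv (X * R (Suc n)) = R (Suc n) + smult (2 * (real n + 1)) (X * (X * R n))"
    unfolding pderiv_mult d dX by (simp add: add.commute)
  also have "\<dots> = smult (2 * real n + 3) (R (Suc n)) + smult (2 * (real n + 1)) (R n)"
    unfolding x2 smult_add_right add.assoc[symmetric]
    by (rule poly_eqI) (simp add: algebra_simps)
  finally have dd: "pderiv (pderiv (rodrigues (Suc (Suc n)))) =
      smult (2 * (real n + 2)) (smult (2 * real n + 3) (rodrigues (Suc n)) + smult (2 * (real n + 1)) (rodrigues n))"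
    unfolding XR .
  have "pderiv (legendre_poly (Suc (Suc n))) =
      smult (1 / (2 ^ Suc (Suc n) * fact (Suc (Suc n)))) ((pderiv ^^ Suc n) (pderiv (pderiv (rodrigues (Suc (Suc n))))))"
    unfolding legendre_poly_def pderiv_smult
    by (simp add: funpow_swap1 del: power_Suc)
  also have "\<dots> = smult (1 / (2 ^ Suc (Suc n) * fact (Suc (Suc n))) * (2 * (real n + 2)) * (2 * real n + 3)) ((pderiv ^^ Suc n) (rodrigues (Suc n)))
     + smult (1 / (2 ^ Suc (Suc n) * fact (Suc (Suc n))) * (2 * (real n + 2)) * (2 * (real n + 1))) ((pderiv ^^ Suc n) (rodrigues n))"
    unfolding dd by (simp only: higher_pderiv_smult higher_pderiv_add smult_add_right smult_smult mult.assoc)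
  also have "1 / (2 ^ Suc (Suc n) * fact (Suc (Suc n))) * (2 * (real n + 2)) * (2 * real n + 3) = (2 * real n + 3) * (1 / (2 ^ Suc n * fact (Suc n)))"
    by (simp add: divide_simps) (simp add: algebra_simps)
  also have "1 / (2 ^ Suc (Suc n) * fact (Suc (Suc n))) * (2 * (real n + 2)) * (2 * (real n + 1)) = 1 / (2 ^ n * fact n)"
    by (simp add: divide_simps) (simp add: algebra_simps)
  finally show ?thesis by (simp add: legendre_poly_def pderiv_smult)
qed

lemma legendre_poly_0: "legendre_poly 0 = 1"
  by (simp add: legendre_poly_def)

lemma legendre_poly_1: "legendre_poly 1 = [:0, 1:]"
  by (simp add: legendre_poly_def pderiv_pCons)

text \<open>Pair the recurrence for P'_(n+1) with P_n: the term P'_(n-1) has too low a degree to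
  contribute, so the left side is the integral of P'_(n+1) P_n. By parts only the boundary term (1 -
  (-1)^(2n+1))/2 = 1 remains.\<close>

lemma legendre_poly_norm: "(2 * real n + 1) * (\<integral>x. poly (legendre_poly n * legendre_poly n) x \<partial>mu1) = 1"
proof (cases n)
  case 0
  then show ?thesis by (simp add: legendre_poly_0 mu1.prob_space[unfolded space_mu1])
next
  case (Suc m)
  let ?P = legendre_poly
  have "(\<integral>x. poly (pderiv (?P (Suc (Suc m))) * ?P n) x \<partial>mu1) =
     (\<integral>x. (2 * real m + 3) * poly (?P n * ?P n) x + poly (?P n * pderiv (?P m)) x \<partial>mu1)"
    by (rule Bochner_Integration.integral_cong) (simp_all add: legendre_poly_rec Suc algebra_simps)
  also have "\<dots> = (2 * real m + 3) * (\<integral>x. poly (?P n * ?P n) x \<partial>mu1) + (\<integral>x. poly (?P n * pderiv (?P m)) x \<partial>mu1)"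
    by (subst Bochner_Integration.integral_add) (auto simp del: poly_mult)
  also have "(\<integral>x. poly (?P n * pderiv (?P m)) x \<partial>mu1) = 0"
    by (rule legendre_poly_orthogonal) (simp add: degree_pderiv degree_legendre_poly Suc)
  finally have "(2 * real n + 1) * (\<integral>x. poly (?P n * ?P n) x \<partial>mu1) =
      (\<integral>x. poly (pderiv (?P (Suc (Suc m))) * ?P n) x \<partial>mu1)"
    by (simp add: Suc)
  also have "\<dots> = 1 - (\<integral>x. poly (?P (Suc (Suc m)) * pderiv (?P n)) x \<partial>mu1)"
    by (subst integral_mu1_poly_parts) (simp add: legendre_poly_at_1 legendre_poly_at_m1 Suc power_add[symmetric])
  also have "(\<integral>x. poly (?P (Suc (Suc m)) * pderiv (?P n)) x \<partial>mu1) = 0"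
    by (rule legendre_poly_orthogonal) (simp add: degree_pderiv degree_legendre_poly Suc)
  finally show ?thesis by simp
qed

text \<open>Based at the endpoint 1 because all Legendre polynomials agree there. The factor 2
  undoes the normalization of \<open>mu1\<close>.\<close>

lemma poly_diff_le_integral:
  fixes F :: "real poly"
  assumes "x \<in> {-1..1}"
  shows "\<bar>poly F 1 - poly F x\<bar> \<le> 2 * (\<integral>t. \<bar>poly (pderiv F) t\<bar> \<partial>mu1)"
proof -
  let ?g = "poly (pderiv F)"
  have int: "set_integrable lborel {a..b} (\<lambda>t. \<bar>?g t\<bar>)" "set_integrable lborel {a..b} ?g" for a b
    unfolding set_integrable_def by (intro borel_integrable_compact continuous_intros; simp)+
  have "(LINT t:{x..1}|lborel. ?g t) = poly F 1 - poly F x"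
    unfolding set_lebesgue_integral_def
  proof (rule integral_FTC_atLeastAtMost)
    fix t show "(poly F has_vector_derivative ?g t) (at t within {x..1})"
      by (metis DERIV_subset poly_DERIV has_real_derivative_iff_has_vector_derivative subset_UNIV)
  qed (use assms in \<open>auto intro!: continuous_intros\<close>)
  then have "\<bar>poly F 1 - poly F x\<bar> \<le> (LINT t:{x..1}|lborel. \<bar>?g t\<bar>)"
    using set_integral_norm_bound[OF int(2), of x 1] by simp
  also have "\<dots> \<le> (LINT t:{-1..1}|lborel. \<bar>?g t\<bar>)"
    unfolding set_lebesgue_integral_def
    by (rule integral_mono) (use int(1) assms in \<open>auto simp: set_integrable_def indicator_def\<close>)
  also have "\<dots> = 2 * (\<integral>t. \<bar>poly (pderiv F) t\<bar> \<partial>mu1)"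
    using int(1)[of "-1" 1]
    by (subst integral_mu1) (auto simp: set_integrable_def set_borel_measurable_def)
  finally show ?thesis .
qed

lemma legendre_poly_abs_integral: "(\<integral>t. \<bar>poly (legendre_poly n) t\<bar> \<partial>mu1) \<le> 1"
proof -
  let ?P = "legendre_poly n"
  have 1: "(2 * real n + 1) * (\<integral>x. poly (?P * ?P) x \<partial>mu1) = 1" by (rule legendre_poly_norm)
  have 2: "0 \<le> (\<integral>x. poly (?P * ?P) x \<partial>mu1)" by (rule Bochner_Integration.integral_nonneg) simp
  then have le1: "(\<integral>x. poly (?P * ?P) x \<partial>mu1) \<le> 1"
    using 1 mult_right_mono[of 1 "2 * real n + 1", OF _ 2] by simp
  \<comment> \<open>Pointwise |p| \<le> (1 + p^2)/2, which reduces the L^1 norm to the known L^2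
    norm.\<close>
  have "(\<integral>t. \<bar>poly ?P t\<bar> \<partial>mu1) \<le> (\<integral>t. 1/2 + 1/2 * poly (?P * ?P) t \<partial>mu1)"
  proof (rule integral_mono)
    fix t
    have "0 \<le> (\<bar>poly ?P t\<bar> - 1)\<^sup>2" by simp
    then show "\<bar>poly ?P t\<bar> \<le> 1/2 + 1/2 * poly (?P * ?P) t"
      by (simp add: power2_diff power2_eq_square[of "poly ?P t"])
  qed (auto intro!: integrable_mu1_continuous continuous_intros)
  also have "\<dots> = 1/2 + 1/2 * (\<integral>x. poly (?P * ?P) x \<partial>mu1)"
    by (subst Bochner_Integration.integral_add)
       (auto simp del: poly_mult simp: mu1.prob_space[unfolded space_mu1])
  finally show ?thesis using le1 by simp
qed

text \<open>Crude, but a polynomial bound suffices: $P_{n+2}-P_n$ vanishes at $1$ and has derivative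
  $(2n+3)P_{n+1}$, whose integral is controlled by the $L^2$-norm.\<close>

lemma legendre_poly_bound:
  "x \<in> {-1..1} \<Longrightarrow> \<bar>poly (legendre_poly n) x\<bar> \<le> 4 * (real n + 1)\<^sup>2"
proof (induction n rule: nat_less_induct)
  case (1 n)
  consider "n = 0" | "n = 1" | m where "n = Suc (Suc m)" by (metis One_nat_def not0_implies_Suc)
  then show ?case
  proof cases
    case 3
    let ?F = "legendre_poly (Suc (Suc m)) - legendre_poly m"
    have d: "pderiv ?F = smult (2 * real m + 3) (legendre_poly (Suc m))"
      by (simp add: pderiv_diff legendre_poly_rec)
    have "\<bar>poly ?F 1 - poly ?F x\<bar> \<le> 2 * (\<integral>t. \<bar>poly (pderiv ?F) t\<bar> \<partial>mu1)"
      by (rule poly_diff_le_integral) fact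
    also have "\<dots> = 2 * ((2 * real m + 3) * (\<integral>t. \<bar>poly (legendre_poly (Suc m)) t\<bar> \<partial>mu1))"
      unfolding d by (simp add: abs_mult)
    also have "\<dots> \<le> 2 * ((2 * real m + 3) * 1)"
      by (intro mult_left_mono legendre_poly_abs_integral) auto
    finally have "\<bar>poly (legendre_poly n) x - poly (legendre_poly m) x\<bar> \<le> 2 * (2 * real m + 3)"
      by (simp add: legendre_poly_at_1 3 abs_minus_commute)
    moreover have "\<bar>poly (legendre_poly m) x\<bar> \<le> 4 * (real m + 1)\<^sup>2" using 1 3 by simp
    moreover have "2 * (2 * real m + 3) + 4 * (real m + 1)\<^sup>2 \<le> 4 * (real n + 1)\<^sup>2"
      by (simp add: 3 power2_eq_square algebra_simps)
    ultimately show ?thesis by linarith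
  qed (use 1 in \<open>auto simp: legendre_poly_0 legendre_poly_1[unfolded One_nat_def]\<close>)
qed

text \<open>By \<open>legendre_poly_rec\<close>, the derivatives of order i + 1 of P_(n+2) and P_n
  differ by 2n + 3 times the derivative of order i of P_(n+1). About n/2 such differences, each of
  order n^(a+1), are added up, so every derivative costs two powers of n.\<close>

lemma legendre_poly_higher_bound:
  "\<exists>C>0. \<exists>a. \<forall>n. \<forall>x\<in>{-1..1}. \<bar>poly ((pderiv ^^ i) (legendre_poly n)) x\<bar> \<le> C * (real n + 1) ^ a"
proof (induction i)
  case 0
  show ?case by (intro exI[of _ 4] conjI exI[of _ 2]) (auto intro: legendre_poly_bound)
next
  case (Suc i)
  then obtain C a where C: "C > 0"
    "\<And>n x. x \<in> {-1..1} \<Longrightarrow> \<bar>poly ((pderiv ^^ i) (legendre_poly n)) x\<bar> \<le> C * (real n + 1) ^ a" by blast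
  have *: "\<bar>poly ((pderiv ^^ Suc i) (legendre_poly n)) x\<bar> \<le> 2 * C * (real n + 1) ^ (a + 2)"
    if x: "x \<in> {-1..1}" for n x
  proof (induction n rule: nat_less_induct)
    case (1 n)
    consider "n = 0" | "n = 1" | m where "n = Suc (Suc m)" by (metis One_nat_def not0_implies_Suc)
    then show ?case
    proof cases
      case 1
      then have "(pderiv ^^ Suc i) (legendre_poly n) = 0"
        by (intro higher_pderiv_eq_0) (simp add: degree_legendre_poly)
      then show ?thesis using C(1) by simp
    next
      case 2
      have "pderiv (legendre_poly n) = legendre_poly 0"
        by (simp add: 2 legendre_poly_0 legendre_poly_1[unfolded One_nat_def] pderiv_pCons one_pCons)
      then have "\<bar>poly ((pderiv ^^ Suc i) (legendre_poly n)) x\<bar> \<le> C"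
        using C(2)[OF x, of 0] by (simp add: funpow_Suc_right del: funpow.simps)
      also have "\<dots> \<le> 2 * C * (real n + 1) ^ (a + 2)"
      proof -
        have "1 \<le> (real n + 1) ^ (a + 2)" by (intro one_le_power) simp
        then have "C * 1 \<le> 2 * C * (real n + 1) ^ (a + 2)" using C(1) by (intro mult_mono) auto
        then show ?thesis by simp
      qed
      finally show ?thesis .
    next
      case 3
      have eq: "(pderiv ^^ Suc i) (legendre_poly n) =
          smult (2 * real m + 3) ((pderiv ^^ i) (legendre_poly (Suc m))) + (pderiv ^^ Suc i) (legendre_poly m)"
        unfolding funpow_Suc_right o_apply 3 legendre_poly_rec by (simp add: higher_pderiv_smult higher_pderiv_add)
      have "\<bar>poly ((pderiv ^^ Suc i) (legendre_poly n)) x\<bar> \<le>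
         (2 * real m + 3) * \<bar>poly ((pderiv ^^ i) (legendre_poly (Suc m))) x\<bar> + \<bar>poly ((pderiv ^^ Suc i) (legendre_poly m)) x\<bar>"
        unfolding eq poly_add poly_smult by (rule order_trans[OF abs_triangle_ineq]) (simp add: abs_mult)
      also have "\<dots> \<le> (2 * real m + 3) * (C * (real m + 3) ^ a) + 2 * C * (real m + 3) ^ (a + 1) * (real m + 1)"
      proof (intro add_mono mult_left_mono)
        have "\<bar>poly ((pderiv ^^ i) (legendre_poly (Suc m))) x\<bar> \<le> C * (real (Suc m) + 1) ^ a" by (rule C(2)[OF x])
        also have "\<dots> \<le> C * (real m + 3) ^ a" using C(1) by (intro mult_left_mono power_mono) auto
        finally show "\<bar>poly ((pderiv ^^ i) (legendre_poly (Suc m))) x\<bar> \<le> C * (real m + 3) ^ a" .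
        have "\<bar>poly ((pderiv ^^ Suc i) (legendre_poly m)) x\<bar> \<le> 2 * C * ((real m + 1) ^ (a + 1) * (real m + 1))"
          using 1 3 by (simp add: mult_ac)
        also have "\<dots> \<le> 2 * C * ((real m + 3) ^ (a + 1) * (real m + 1))"
          using C(1) by (intro mult_left_mono mult_right_mono power_mono) auto
        finally show "\<bar>poly ((pderiv ^^ Suc i) (legendre_poly m)) x\<bar> \<le> 2 * C * (real m + 3) ^ (a + 1) * (real m + 1)"
          by (simp add: mult.assoc)
      qed simp
      also have "\<dots> = C * (real m + 3) ^ a * ((2 * real m + 3) + 2 * (real m + 3) * (real m + 1))"
        by (simp add: algebra_simps)
      also have "\<dots> \<le> C * (real m + 3) ^ a * (2 * (real m + 3)\<^sup>2)"
        using C(1) by (intro mult_left_mono) (auto simp: power2_eq_square algebra_simps)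
      also have "\<dots> = 2 * C * (real n + 1) ^ (a + 2)"
        by (simp add: 3 power_add power2_eq_square add.commute mult_ac)
      finally show ?thesis .
    qed
  qed
  show ?case using * C(1) by (intro exI[of _ "2 * C"] conjI exI[of _ "a + 2"]) auto
qed

section \<open>The orthonormal family as a basis of the polynomials\<close>

definition legendre_normed :: "nat \<Rightarrow> real poly" where
  "legendre_normed n = smult (sqrt (2 * real n + 1)) (legendre_poly n)"

lemma legendre_eq_poly: "legendre n = poly (legendre_normed n)"
  by (auto simp: legendre_def legendre_normed_def)

lemma legendre_normed_0: "legendre_normed 0 = 1"
  by (simp add: legendre_normed_def legendre_poly_0)

lemma degree_legendre_normed: "degree (legendre_normed n) = n"
  by (simp add: legendre_normed_def degree_legendre_poly)

lemma legendre_normed_orthogonal: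
  "degree q < n \<Longrightarrow> (\<integral>x. poly (legendre_normed n * q) x \<partial>mu1) = 0"
  using legendre_poly_orthogonal[of q n] by (simp add: legendre_normed_def mult.assoc)

lemma legendre_orthonormal:
  "(\<integral>x. legendre m x * legendre n x \<partial>mu1) = (if m = n then 1 else 0)"
proof (cases m n rule: linorder_cases)
  case less
  then show ?thesis using legendre_normed_orthogonal[of "legendre_normed m" n]
    by (simp add: legendre_eq_poly degree_legendre_normed mult.commute)
next
  case greater
  then show ?thesis using legendre_normed_orthogonal[of "legendre_normed n" m]
    by (simp add: legendre_eq_poly degree_legendre_normed)
next
  case equal
  have "(\<integral>x. legendre n x * legendre n x \<partial>mu1) = (\<integral>x. (2 * real n + 1) * poly (legendre_poly n * legendre_poly n) x \<partial>mu1)"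
  proof (rule Bochner_Integration.integral_cong)
    fix x
    have "legendre n x * legendre n x =
        (sqrt (2 * real n + 1) * sqrt (2 * real n + 1)) * poly (legendre_poly n * legendre_poly n) x"
      unfolding legendre_def poly_mult by (simp only: mult_ac)
    also have "sqrt (2 * real n + 1) * sqrt (2 * real n + 1) = 2 * real n + 1" by simp
    finally show "legendre n x * legendre n x = (2 * real n + 1) * poly (legendre_poly n * legendre_poly n) x" .
  qed simp
  then show ?thesis using equal legendre_poly_norm[of n] by (simp del: poly_mult)
qed

lemma legendre_higher_bound:
  "\<exists>C>0. \<exists>a. \<forall>n. \<forall>x\<in>{-1..1}. \<bar>poly ((pderiv ^^ i) (legendre_normed n)) x\<bar> \<le> C * (real n + 1) ^ a"
proof -
  obtain C a where C: "C > 0"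
    "\<And>n x. x \<in> {-1..1} \<Longrightarrow> \<bar>poly ((pderiv ^^ i) (legendre_poly n)) x\<bar> \<le> C * (real n + 1) ^ a"
    using legendre_poly_higher_bound by blast
  have "\<bar>poly ((pderiv ^^ i) (legendre_normed n)) x\<bar> \<le> (2 * C) * (real n + 1) ^ (a + 1)" if "x \<in> {-1..1}" for n x
  proof -
    have "\<bar>poly ((pderiv ^^ i) (legendre_normed n)) x\<bar> = sqrt (2 * real n + 1) * \<bar>poly ((pderiv ^^ i) (legendre_poly n)) x\<bar>"
      by (simp add: legendre_normed_def higher_pderiv_smult abs_mult)
    also have "\<dots> \<le> (2 * (real n + 1)) * (C * (real n + 1) ^ a)"
    proof (intro mult_mono C(2) that)
      have "2 * real n + 1 \<le> (2 * (real n + 1))\<^sup>2" by (simp add: power2_eq_square algebra_simps)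
      then show "sqrt (2 * real n + 1) \<le> 2 * (real n + 1)" by (intro real_le_lsqrt) auto
    qed auto
    finally show ?thesis by (simp add: algebra_simps)
  qed
  then show ?thesis using C(1) by (intro exI[of _ "2 * C"] conjI exI[of _ "a + 1"]) auto
qed

text \<open>\<open>legendre_normed n\<close> has exact degree n, so the top coefficient of
  \<open>p\<close> can be removed one degree at a time.\<close>

lemma legendre_basis:
  assumes "degree p \<le> N"
  shows "\<exists>c. p = (\<Sum>n\<le>N. smult (c n) (legendre_normed n))"
  using assms
proof (induction N arbitrary: p)
  case 0
  then obtain a where "p = [:a:]" by (auto elim: degree_eq_zeroE)
  then show ?case by (intro exI[of _ "\<lambda>_. a"]) (simp add: legendre_normed_0 one_pCons)
next
  case (Suc N)
  let ?L = "legendre_normed (Suc N)"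
  define b where "b = coeff p (Suc N) / coeff ?L (Suc N)"
  have nz: "coeff ?L (Suc N) \<noteq> 0"
    using degree_legendre_normed[of "Suc N"] leading_coeff_0_iff[of ?L] by (metis degree_0 nat.distinct(1))
  have "degree (p - smult b ?L) \<le> N"
  proof (rule degree_le, intro allI impI)
    fix i assume "N < i"
    show "coeff (p - smult b ?L) i = 0"
    proof (cases "i = Suc N")
      case True then show ?thesis using nz by (simp add: b_def)
    next
      case False
      with \<open>N < i\<close> have "Suc N < i" by simp
      then show ?thesis using Suc.prems by (simp add: coeff_eq_0 degree_legendre_normed)
    qed
  qed
  from Suc.IH[OF this] obtain c where c: "p - smult b ?L = (\<Sum>n\<le>N. smult (c n) (legendre_normed n))" by blast
  show ?case
  proof (intro exI[of _ "c(Suc N := b)"])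
    have "p = (\<Sum>n\<le>N. smult (c n) (legendre_normed n)) + smult b ?L" using c by (simp add: algebra_simps)
    then show "p = (\<Sum>n\<le>Suc N. smult ((c(Suc N := b)) n) (legendre_normed n))" by simp
  qed
qed

lemma poly_antiderivative:
  fixes p :: "real poly"
  shows "\<exists>Q. pderiv Q = p \<and> poly Q a = 0 \<and> degree Q \<le> Suc (degree p)"
proof -
  define Q0 where "Q0 = (\<Sum>i\<le>degree p. monom (coeff p i / real (Suc i)) (Suc i))"
  have "pderiv Q0 = (\<Sum>i\<le>degree p. monom (coeff p i) i)"
    unfolding Q0_def higher_pderiv_sum[of "Suc 0", simplified] by (simp add: pderiv_monom)
  also have "\<dots> = p" by (rule poly_as_sum_of_monoms)
  finally have "pderiv Q0 = p" .
  moreover have "degree Q0 \<le> Suc (degree p)"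
    unfolding Q0_def by (intro degree_sum_le) (auto intro: order_trans[OF degree_monom_le])
  ultimately show ?thesis
    by (intro exI[of _ "Q0 - [:poly Q0 a:]"])
       (auto simp: pderiv_diff pderiv_pCons intro!: degree_diff_le)
qed

section \<open>Polynomial interpolation of holomorphic functions\<close>

lemma poly_eq_0_if_many_roots:
  fixes p :: "'a::idom poly"
  assumes "finite A" "degree p < card A" "\<And>a. a \<in> A \<Longrightarrow> poly p a = 0"
  shows "p = 0"
proof (rule ccontr)
  assume p: "p \<noteq> 0"
  have "card A \<le> card {x. poly p x = 0}"
    by (rule card_mono) (use p assms in \<open>auto simp: poly_roots_finite\<close>)
  also have "\<dots> \<le> degree p" by (rule card_poly_roots_bound[OF p])
  finally show False using assms(2) by simp
qed

definition lagrange_poly :: "'a::field set \<Rightarrow> 'a \<Rightarrow> 'a poly" where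
  "lagrange_poly A a = smult (\<Prod>b\<in>A - {a}. 1 / (a - b)) (\<Prod>b\<in>A - {a}. [:-b, 1:])"

lemma degree_lagrange_poly:
  assumes "finite A" "a \<in> A"
  shows "degree (lagrange_poly A a) < card A"
proof -
  have "degree (lagrange_poly A a) \<le> degree (\<Prod>b\<in>A - {a}. [:-b, 1:])"
    unfolding lagrange_poly_def by (rule degree_smult_le)
  also have "\<dots> \<le> (\<Sum>b\<in>A - {a}. degree [:-b, 1:])"
    using degree_prod_sum_le[of "A - {a}" "\<lambda>b. [:-b, 1:]"] assms(1) by (simp add: o_def)
  also have "\<dots> = card A - 1" using assms by simp
  finally show ?thesis using assms by (metis Suc_pred' card_gt_0_iff diff_less_Suc empty_iff le_imp_less_Suc)
qed

lemma poly_lagrange_poly: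
  "poly (lagrange_poly A a) x = (\<Prod>b\<in>A - {a}. 1 / (a - b)) * (\<Prod>b\<in>A - {a}. x - b)"
  by (simp add: lagrange_poly_def poly_prod)

lemma poly_lagrange_poly_node:
  assumes "finite A" "a \<in> A" "c \<in> A"
  shows "poly (lagrange_poly A a) c = (if a = c then 1 else 0)"
proof (cases "a = c")
  case True
  then show ?thesis
    unfolding poly_lagrange_poly prod.distrib[symmetric] by (simp) (intro prod.neutral, auto)
next
  case False
  then have "(\<Prod>b\<in>A - {a}. c - b) = 0" using assms by (intro prod_zero) auto
  then show ?thesis using False by (simp add: poly_lagrange_poly)
qed

lemma sum_lagrange_poly:
  assumes "finite A" "A \<noteq> {}"
  shows "(\<Sum>a\<in>A. lagrange_poly A a) = 1"
proof -
  have "(\<Sum>a\<in>A. lagrange_poly A a) - 1 = 0"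
  proof (rule poly_eq_0_if_many_roots[OF assms(1)])
    have "card A > 0" using assms by (simp add: card_gt_0_iff)
    have "degree (\<Sum>a\<in>A. lagrange_poly A a) < card A"
      by (rule degree_sum_less) (use assms \<open>card A > 0\<close> in \<open>auto intro: degree_lagrange_poly\<close>)
    with \<open>card A > 0\<close> show "degree ((\<Sum>a\<in>A. lagrange_poly A a) - 1) < card A"
      by (intro degree_diff_less) auto
    fix c assume "c \<in> A"
    then show "poly ((\<Sum>a\<in>A. lagrange_poly A a) - 1) c = 0"
      using assms by (simp add: poly_sum poly_lagrange_poly_node)
  qed
  then show ?thesis by simp
qed

text \<open>After multiplication by the nodal polynomial the left side is the sum of the Lagrange
  polynomials at z, which is 1. It serves to merge the Cauchy integrals at the nodes into a single
  one.\<close>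

lemma lagrange_partial_fractions:
  fixes z :: "'a::field"
  assumes "finite A" "A \<noteq> {}" "z \<notin> A"
  shows "(\<Sum>a\<in>A. (\<Prod>b\<in>A - {a}. 1 / (a - b)) / (z - a)) = 1 / (\<Prod>a\<in>A. z - a)"
proof -
  have nz: "(\<Prod>a\<in>A. z - a) \<noteq> 0" using assms by auto
  have "(\<Sum>a\<in>A. (\<Prod>b\<in>A - {a}. 1 / (a - b)) / (z - a)) * (\<Prod>a\<in>A. z - a) =
      (\<Sum>a\<in>A. poly (lagrange_poly A a) z)"
    unfolding sum_distrib_right
  proof (rule sum.cong[OF refl])
    fix a assume a: "a \<in> A"
    then have "(\<Prod>b\<in>A. z - b) = (z - a) * (\<Prod>b\<in>A - {a}. z - b)" using assms by (simp add: prod.remove)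
    moreover have "z - a \<noteq> 0" using a assms by auto
    ultimately show "(\<Prod>b\<in>A - {a}. 1 / (a - b)) / (z - a) * (\<Prod>a\<in>A. z - a) = poly (lagrange_poly A a) z"
      by (simp add: poly_lagrange_poly)
  qed
  also have "\<dots> = 1" using sum_lagrange_poly[OF assms(1,2)] by (simp flip: poly_sum)
  finally show ?thesis using nz by (simp add: field_simps)
qed

section \<open>The Joukowski map and the Chebyshev nodes\<close>

definition joukowski :: "complex \<Rightarrow> complex" where
  "joukowski w = (w + inverse w) / 2"

fun chebyshev :: "nat \<Rightarrow> complex poly" where
  "chebyshev 0 = 1"
| "chebyshev (Suc 0) = [:0, 1:]"
| "chebyshev (Suc (Suc n)) = [:0, 2:] * chebyshev (Suc n) - chebyshev n"

text \<open>The three-term recurrence matches the expansion of (w + 1/w)(w^(n+1) + w^(-n-1)). On the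
  unit circle the identity is the familiar T_n(cos t) = cos(nt).\<close>

lemma poly_chebyshev_joukowski:
  "w \<noteq> 0 \<Longrightarrow> poly (chebyshev n) (joukowski w) = (w ^ n + inverse w ^ n) / 2"
proof (induction n rule: chebyshev.induct)
  case (3 n)
  obtain v where v: "v = inverse w" by blast
  then have wv: "w * v = 1" "v * w = 1" using 3(3) by simp_all
  have 1: "w * v ^ Suc n = v ^ n" "v * w ^ Suc n = w ^ n"
    by (simp_all add: wv flip: mult.assoc)
  have "poly (chebyshev (Suc (Suc n))) (joukowski w) =
      (w + v) * ((w ^ Suc n + v ^ Suc n) / 2) - (w ^ n + v ^ n) / 2"
    unfolding chebyshev.simps poly_diff poly_mult 3(1)[OF 3(3)] 3(2)[OF 3(3)]
    by (simp add: joukowski_def v algebra_simps)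
  also have "\<dots> = (w * w ^ Suc n + w * v ^ Suc n + v * w ^ Suc n + v * v ^ Suc n - (w ^ n + v ^ n)) / 2"
    by (simp only: distrib_left distrib_right diff_divide_distrib add_divide_distrib times_divide_eq_right add_ac)
  finally show ?case unfolding 1 by (simp add: v)
qed (auto simp: joukowski_def)

lemma degree_chebyshev: "degree (chebyshev n) \<le> n"
proof (induction n rule: chebyshev.induct)
  case (3 n)
  have "degree ([:0, 2:] * chebyshev (Suc n)) \<le> degree [:0, 2 :: complex:] + degree (chebyshev (Suc n))"
    by (rule degree_mult_le)
  then have "degree ([:0, 2:] * chebyshev (Suc n)) \<le> Suc (Suc n)" using 3 by simp
  with 3 show ?case by (simp only: chebyshev.simps) (intro degree_diff_le; simp)
qed auto

lemma coeff_chebyshev: "coeff (chebyshev (Suc n)) (Suc n) = 2 ^ n"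
proof (induction n)
  case (Suc n)
  have "coeff (chebyshev n) (Suc (Suc n)) = 0"
    by (rule coeff_eq_0) (use degree_chebyshev[of n] in simp)
  then show ?case using Suc by (simp add: mult_pCons_left)
qed simp

definition chebyshev_nodes :: "nat \<Rightarrow> real set" where
  "chebyshev_nodes n = (\<lambda>i. cos ((2 * real i + 1) * pi / (2 * real n))) ` {..<n}"

lemma chebyshev_nodes_interval: "chebyshev_nodes n \<subseteq> {-1..1}"
  by (auto simp: chebyshev_nodes_def)

lemma finite_chebyshev_nodes [simp]: "finite (chebyshev_nodes n)"
  by (simp add: chebyshev_nodes_def)

lemma card_chebyshev_nodes: "card (chebyshev_nodes n) = n"
proof -
  have "inj_on (\<lambda>i. cos ((2 * real i + 1) * pi / (2 * real n))) {..<n}"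
  proof (rule inj_onI)
    fix i j assume ij: "i \<in> {..<n}" "j \<in> {..<n}"
      and eq: "cos ((2 * real i + 1) * pi / (2 * real n)) = cos ((2 * real j + 1) * pi / (2 * real n))"
    have r: "0 \<le> (2 * real i + 1) * pi / (2 * real n)" "(2 * real i + 1) * pi / (2 * real n) \<le> pi" if "i < n" for i
    proof -
      have "2 * real i + 1 \<le> 2 * real n" using that by linarith
      then have "(2 * real i + 1) * pi \<le> 2 * real n * pi" by (rule mult_right_mono) simp
      then show "(2 * real i + 1) * pi / (2 * real n) \<le> pi" using that by (simp add: field_simps)
    qed simp
    have "(2 * real i + 1) * pi / (2 * real n) = (2 * real j + 1) * pi / (2 * real n)"
      by (rule cos_inj_pi) (use r ij eq in auto)
    then show "i = j" using ij by simp
  qed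
  then show ?thesis by (simp add: chebyshev_nodes_def card_image)
qed

lemma joukowski_cis: "joukowski (cis t) = of_real (cos t)"
  by (simp add: joukowski_def complex_eq_iff)

lemma chebyshev_node_root:
  assumes "a \<in> chebyshev_nodes n"
  shows "poly (chebyshev n) (of_real a) = 0"
proof -
  obtain i where i: "i < n" "a = cos ((2 * real i + 1) * pi / (2 * real n))"
    using assms by (auto simp: chebyshev_nodes_def)
  define t where "t = (2 * real i + 1) * pi / (2 * real n)"
  have nt: "real n * t = real i * pi + pi / 2" using i by (simp add: t_def field_simps)
  have "poly (chebyshev n) (of_real a) = (cis t ^ n + inverse (cis t) ^ n) / 2"
    using poly_chebyshev_joukowski[of "cis t" n] by (simp add: joukowski_cis i t_def)
  also have "cis t ^ n = cis (real n * t)" by (rule Complex.DeMoivre)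
  also have "inverse (cis t) ^ n = cis (- (real n * t))"
    by (simp add: power_inverse Complex.DeMoivre)
  also have "(cis (real n * t) + cis (- (real n * t))) / 2 = of_real (cos (real n * t))"
    by (simp add: complex_eq_iff)
  also have "cos (real n * t) = 0" unfolding nt by (simp add: cos_add)
  finally show ?thesis by simp
qed

text \<open>T_n and the nodal polynomial have the same n zeros, and the leading coefficient of T_n
  is 2^(n-1) for n > 0, so they are proportional. The closed form is used twice: from below on the
  ellipse and from above on the interval.\<close>

lemma prod_chebyshev_nodes:
  assumes "w \<noteq> 0" "n > 0"
  shows "(\<Prod>a\<in>chebyshev_nodes n. joukowski w - of_real a) = (w ^ n + inverse w ^ n) / 2 ^ n"
proof -
  define A where "A = complex_of_real ` chebyshev_nodes n"
  obtain m where n: "n = Suc m" using assms(2) by (cases n) auto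
  have inj: "inj_on complex_of_real (chebyshev_nodes n)" by (simp add: inj_on_def)
  have A: "finite A" "card A = n" by (simp_all add: A_def card_image inj card_chebyshev_nodes)
  define P where "P = (\<Prod>a\<in>A. [:-a, 1:])"
  have dP: "degree P = n" unfolding P_def using A by (subst degree_prod_eq_sum_degree) auto
  have "lead_coeff P = 1" unfolding P_def by (simp add: lead_coeff_prod)
  then have cP: "coeff P n = 1" by (simp add: dP)
  have "chebyshev n - smult (2 ^ m) P = 0"
  proof (rule poly_eq_0_if_many_roots[OF A(1)])
    have "degree (chebyshev n - smult (2 ^ m) P) \<le> m"
    proof (rule degree_le, intro allI impI)
      fix i assume "m < i"
      show "coeff (chebyshev n - smult (2 ^ m) P) i = 0"
      proof (cases "i = n")
        case True then show ?thesis using cP coeff_chebyshev[of m] n by simp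
      next
        case False
        with \<open>m < i\<close> n have "n < i" by simp
        then show ?thesis using degree_chebyshev[of n] dP by (simp add: coeff_eq_0)
      qed
    qed
    then show "degree (chebyshev n - smult (2 ^ m) P) < card A" using A n by simp
    fix a assume a: "a \<in> A"
    then have "poly P a = 0" unfolding P_def poly_prod using A(1) by (intro prod_zero) auto
    moreover have "poly (chebyshev n) a = 0" using a by (auto simp: A_def chebyshev_node_root)
    ultimately show "poly (chebyshev n - smult (2 ^ m) P) a = 0" by simp
  qed
  then have "poly (chebyshev n) (joukowski w) = 2 ^ m * poly P (joukowski w)"
    by (metis eq_iff_diff_eq_0 poly_smult)
  moreover have "poly P (joukowski w) = (\<Prod>a\<in>chebyshev_nodes n. joukowski w - of_real a)"
    unfolding P_def poly_prod A_def by (simp add: prod.reindex[OF inj])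
  ultimately show ?thesis using poly_chebyshev_joukowski[OF assms(1), of n] by (simp add: n field_simps)
qed

text \<open>With x = cos \<phi> and u = exp(i \<phi>), the difference z - x has in the variable w
  two zeros on the unit circle and a pole at 0. Both the distance bound and the winding number come
  from this factorization.\<close>

lemma joukowski_diff:
  assumes "w \<noteq> 0" "x \<in> {-1..1}"
  defines "u \<equiv> cis (arccos x)"
  shows "joukowski w - of_real x = (w - u) * (w - cnj u) / (2 * w)"
proof -
  have 1: "u + cnj u = 2 * of_real x"
    using assms by (simp add: u_def complex_eq_iff)
  have 2: "u * cnj u = 1" by (simp add: u_def cis_cnj cis_mult)
  have "(w - u) * (w - cnj u) = w * w - (u + cnj u) * w + u * cnj u" by (simp add: algebra_simps)
  then show ?thesis unfolding 1 2 using assms(1) by (simp add: joukowski_def field_simps)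
qed

lemma joukowski_diff_lower:
  assumes "norm w = \<rho>" "1 < \<rho>" "x \<in> {-1..1}"
  shows "(\<rho> - 1)\<^sup>2 / (2 * \<rho>) \<le> norm (joukowski w - of_real x)"
proof -
  let ?u = "cis (arccos x)"
  have w: "w \<noteq> 0" using assms by auto
  have "\<rho> - 1 \<le> norm (w - ?u)" using norm_triangle_ineq2[of w ?u] assms by simp
  moreover have "\<rho> - 1 \<le> norm (w - cnj ?u)" using norm_triangle_ineq2[of w "cnj ?u"] assms by simp
  ultimately have "(\<rho> - 1) * (\<rho> - 1) \<le> norm (w - ?u) * norm (w - cnj ?u)"
    using assms by (intro mult_mono) auto
  then show ?thesis unfolding joukowski_diff[OF w assms(3)]
    using assms by (simp add: norm_mult norm_divide power2_eq_square divide_right_mono)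
qed

section \<open>Neighbourhoods of the interval and Bernstein ellipses\<close>

lemma nbhd_cinterval_open: "open (nbhd \<zeta> cinterval)"
proof -
  have "nbhd \<zeta> cinterval = (\<Union>y\<in>cinterval. ball y \<zeta>)"
    by (auto simp: nbhd_def dist_commute)
  then show ?thesis by auto
qed

text \<open>The neighbourhood is the Minkowski sum of the interval and a disc. Convexity makes
  Cauchy's formula applicable to closed contours inside it.\<close>

lemma nbhd_cinterval_convex: "convex (nbhd \<zeta> cinterval)"
proof -
  have "nbhd \<zeta> cinterval = (\<Union>x\<in>cinterval. \<Union>y\<in>ball 0 \<zeta>. {x + y})"
  proof (intro set_eqI iffI)
    fix z assume "z \<in> nbhd \<zeta> cinterval"
    then obtain x where "x \<in> cinterval" "dist z x < \<zeta>" by (auto simp: nbhd_def)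
    moreover from this have "z = x + (z - x)" "z - x \<in> ball 0 \<zeta>"
      by (simp_all add: dist_norm norm_minus_commute)
    ultimately show "z \<in> (\<Union>x\<in>cinterval. \<Union>y\<in>ball 0 \<zeta>. {x + y})" by blast
  next
    fix z assume "z \<in> (\<Union>x\<in>cinterval. \<Union>y\<in>ball 0 \<zeta>. {x + y})"
    then obtain x y where "x \<in> cinterval" "y \<in> ball 0 \<zeta>" "z = x + y" by blast
    moreover from this have "dist z x < \<zeta>" by (simp add: dist_norm)
    ultimately show "z \<in> nbhd \<zeta> cinterval" unfolding nbhd_def by blast
  qed
  moreover have "convex cinterval"
    by (rule convex_linear_image) (auto simp: bounded_linear_of_real bounded_linear.linear)
  ultimately show ?thesis using convex_sums[of cinterval "ball 0 \<zeta>"] by simp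
qed

lemma cinterval_subset_nbhd: "0 < \<zeta> \<Longrightarrow> cinterval \<subseteq> nbhd \<zeta> cinterval"
  by (force simp: nbhd_def)

text \<open>For w = \<rho>u with |u| = 1, the image is compared with the point Re u of the interval:
  the distance is at most ((\<rho> - 1) + (1 - 1/\<rho>))/2 \<le> \<rho> - 1. This is the reason for
  the choice of radii 1 + \<zeta>.\<close>

lemma joukowski_in_nbhd:
  assumes "norm w = \<rho>" "1 < \<rho>" "\<rho> < 1 + \<zeta>"
  shows "joukowski w \<in> nbhd \<zeta> cinterval"
proof -
  define u where "u = w / of_real \<rho>"
  have w: "w = of_real \<rho> * u" and nu: "norm u = 1" using assms by (auto simp: u_def norm_divide)
  have inv: "inverse u = cnj u" using nu
    by (metis complex_norm_square inverse_unique of_real_1 one_power2)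
  have re: "of_real (Re u) = (u + cnj u) / 2" by (simp add: complex_eq_iff)
  have "inverse (of_real \<rho> * u) = of_real (1 / \<rho>) * cnj u"
    by (simp add: inv divide_inverse)
  then have "joukowski w - of_real (Re u) = (of_real (\<rho> - 1) * u + of_real (1 / \<rho> - 1) * cnj u) / 2"
    unfolding joukowski_def w re by (simp add: algebra_simps add_divide_distrib diff_divide_distrib)
  also have "norm \<dots> \<le> (norm (of_real (\<rho> - 1) * u) + norm (of_real (1 / \<rho> - 1) * cnj u)) / 2"
    by (simp add: norm_divide norm_triangle_ineq)
  also have "\<dots> = ((\<rho> - 1) + (1 - 1 / \<rho>)) / 2"
    unfolding norm_mult norm_of_real using assms(2) nu by (simp add: field_simps)
  also have "\<dots> \<le> \<rho> - 1"
  proof -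
    have "0 \<le> (\<rho> - 1)\<^sup>2" by simp
    then have "1 - 1 / \<rho> \<le> \<rho> - 1" using assms(2) by (simp add: field_simps power2_eq_square)
    then show ?thesis by simp
  qed
  also have "\<dots> < \<zeta>" using assms by simp
  finally have "dist (joukowski w) (of_real (Re u)) < \<zeta>" by (simp add: dist_norm)
  moreover have "Re u \<in> {-1..1}" using abs_Re_le_cmod[of u] nu by auto
  ultimately show ?thesis by (auto simp: nbhd_def)
qed

lemma joukowski_holomorphic: "joukowski holomorphic_on - {0}"
  unfolding joukowski_def by (intro holomorphic_intros) auto

lemma deriv_joukowski: "w \<noteq> 0 \<Longrightarrow> deriv joukowski w = (1 - inverse (w\<^sup>2)) / 2"
  unfolding joukowski_def
  by (rule DERIV_imp_deriv) (auto intro!: derivative_eq_intros simp: power2_eq_square)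

section \<open>Cauchy's formula on a Bernstein ellipse and Hermite's remainder formula\<close>

context
  fixes \<rho> \<zeta> :: real
  assumes rho: "1 < \<rho>" "\<rho> < 1 + \<zeta>"
begin

text \<open>The image of the circle of radius \<rho> is the Bernstein ellipse with foci 1 and -1.
  Parametrizing it through the circle turns every contour integral into one over the circle.\<close>

definition "ellipse = joukowski \<circ> circlepath 0 \<rho>"

lemma circle_subset: "path_image (circlepath 0 \<rho>) \<subseteq> - {0}"
  using rho by (auto simp: sphere_def)

lemma ellipse_valid: "valid_path ellipse"
  unfolding ellipse_def
  by (rule valid_path_compose_holomorphic[OF _ joukowski_holomorphic _ circle_subset]) auto

lemma ellipse_closed: "pathfinish ellipse = pathstart ellipse"
  by (simp add: ellipse_def pathfinish_compose pathstart_compose)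

lemma ellipse_image: "path_image ellipse = joukowski ` sphere 0 \<rho>"
  unfolding ellipse_def using rho by (simp add: path_image_compose)

lemma contour_integral_ellipse:
  "contour_integral ellipse g = contour_integral (circlepath 0 \<rho>) (\<lambda>w. deriv joukowski w * g (joukowski w))"
  unfolding ellipse_def
  by (rule contour_integral_comp_analyticW[of _ "- {0}"])
     (use circle_subset joukowski_holomorphic in \<open>auto simp: analytic_on_open open_Compl\<close>)

lemma ellipse_avoids:
  assumes "x \<in> {-1..1}" shows "of_real x \<notin> path_image ellipse"
proof
  assume "of_real x \<in> path_image ellipse"
  then obtain w where w: "norm w = \<rho>" "of_real x = joukowski w" by (auto simp: ellipse_image)
  have "0 < (\<rho> - 1)\<^sup>2 / (2 * \<rho>)" using rho by simp
  with joukowski_diff_lower[OF w(1) rho(1) assms] w(2) show False by simp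
qed

text \<open>In the variable w the logarithmic derivative of z - x is 1/(w - u) + 1/(w - cnj u) -
  1/w. All three poles lie inside the circle, which gives 1 + 1 - 1 = 1.\<close>

lemma winding_ellipse:
  assumes "x \<in> {-1..1}" shows "winding_number ellipse (of_real x) = 1"
proof -
  let ?u = "cis (arccos x)" and ?c = "circlepath 0 \<rho>"
  have C: "((\<lambda>w. 1 / (w - v)) has_contour_integral (2 * of_real pi * \<i>)) ?c" if "norm v < \<rho>" for v
    using Cauchy_integral_circlepath_simple[of "\<lambda>_. 1" 0 \<rho> v] that by simp
  have "((\<lambda>w. 1 / (w - ?u) + 1 / (w - cnj ?u) - 1 / (w - 0)) has_contour_integral
      (2 * of_real pi * \<i> + 2 * of_real pi * \<i> - 2 * of_real pi * \<i>)) ?c"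
    by (intro has_contour_integral_add has_contour_integral_diff C) (use rho in auto)
  then have I: "((\<lambda>w. 1 / (w - ?u) + 1 / (w - cnj ?u) - 1 / (w - 0)) has_contour_integral (2 * of_real pi * \<i>)) ?c"
    by (simp add: mult_ac)
  have "contour_integral ellipse (\<lambda>z. 1 / (z - of_real x)) =
      contour_integral ?c (\<lambda>w. deriv joukowski w * (1 / (joukowski w - of_real x)))"
    by (rule contour_integral_ellipse)
  also have "\<dots> = 2 * of_real pi * \<i>"
  proof (rule contour_integral_unique, rule has_contour_integral_eq[OF I])
    fix w assume "w \<in> path_image ?c"
    then have nw: "norm w = \<rho>" using rho by simp
    then have w: "w \<noteq> 0" "w - ?u \<noteq> 0" "w - cnj ?u \<noteq> 0" using rho by auto
    have 1: "?u + cnj ?u = 2 * of_real x" using assms by (simp add: complex_eq_iff)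
    have 2: "?u * cnj ?u = 1" by (simp add: cis_cnj cis_mult)
    have e: "(w - ?u) * (w - cnj ?u) = w * w - 2 * of_real x * w + 1"
    proof -
      have "(w - ?u) * (w - cnj ?u) = w * w - (?u + cnj ?u) * w + ?u * cnj ?u" by (simp add: algebra_simps)
      then show ?thesis unfolding 1 2 .
    qed
    have frac: "1 / a + 1 / b - 1 / w = ((a + b) * w - a * b) / (w * (a * b))"
      if "a \<noteq> 0" "b \<noteq> 0" for a b
      using that w by (simp add: field_simps)
    have "1 / (w - ?u) + 1 / (w - cnj ?u) - 1 / (w - 0) =
        ((2 * w - (?u + cnj ?u)) * w - (w - ?u) * (w - cnj ?u)) / (w * ((w - ?u) * (w - cnj ?u)))"
      using frac[OF w(2,3)] by (simp add: algebra_simps)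
    also have "\<dots> = (w * w - 1) / (w * ((w - ?u) * (w - cnj ?u)))"
      unfolding 1 e by (simp add: algebra_simps)
    also have "\<dots> = deriv joukowski w * (1 / (joukowski w - of_real x))"
      unfolding joukowski_diff[OF w(1) assms] deriv_joukowski[OF w(1)]
      using w by (simp add: divide_simps power2_eq_square)
    finally show "1 / (w - ?u) + 1 / (w - cnj ?u) - 1 / (w - 0) = deriv joukowski w * (1 / (joukowski w - of_real x))" .
  qed
  finally show ?thesis
    by (subst winding_number_valid_path[OF ellipse_valid ellipse_avoids[OF assms]]) simp
qed

lemma ellipse_Cauchy:
  assumes "h holomorphic_on nbhd \<zeta> cinterval" "x \<in> {-1..1}"
  shows "((\<lambda>z. h z / (z - of_real x)) has_contour_integral (2 * of_real pi * \<i> * h (of_real x))) ellipse"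
proof -
  have "of_real x \<in> nbhd \<zeta> cinterval"
    using cinterval_subset_nbhd[of \<zeta>] assms(2) rho by auto
  then have "of_real x \<in> interior (nbhd \<zeta> cinterval)"
    by (simp add: interior_open nbhd_cinterval_open)
  moreover have "path_image ellipse \<subseteq> nbhd \<zeta> cinterval - {of_real x}"
  proof
    fix z assume z: "z \<in> path_image ellipse"
    then obtain w where "norm w = \<rho>" "z = joukowski w" by (auto simp: ellipse_image)
    then have "z \<in> nbhd \<zeta> cinterval" using joukowski_in_nbhd[OF _ rho] by simp
    then show "z \<in> nbhd \<zeta> cinterval - {of_real x}" using z ellipse_avoids[OF assms(2)] by auto
  qed
  ultimately have "((\<lambda>z. h z / (z - of_real x)) has_contour_integral
     (of_real (2 * pi) * \<i> * winding_number ellipse (of_real x) * h (of_real x))) ellipse"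
    by (rule Cauchy_integral_formula_convex_simple
        [OF nbhd_cinterval_convex assms(1) _ ellipse_valid _ ellipse_closed])
  then show ?thesis by (simp add: winding_ellipse[OF assms(2)])
qed

text \<open>Hermite's remainder formula, obtained as a linear combination of Cauchy's formulas at
  \<open>x\<close> and at the nodes, without residues. The case of \<open>x\<close> being a node is
  excluded because of the divisions by x - a.\<close>

lemma chebyshev_interpolation_remainder:
  assumes h: "h holomorphic_on nbhd \<zeta> cinterval" and x: "x \<in> {-1..1}" "x \<notin> chebyshev_nodes n" and n: "n > 0"
  defines "A \<equiv> chebyshev_nodes n"
  shows "2 * of_real pi * \<i> * (h (of_real x) - (\<Sum>a\<in>A. h (of_real a) * of_real (poly (lagrange_poly A a) x))) =
    of_real (\<Prod>a\<in>A. x - a) *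
    contour_integral ellipse (\<lambda>z. h z / ((z - of_real x) * (\<Prod>a\<in>A. z - of_real a)))"
proof -
  define k where "k a = (\<Prod>b\<in>A - {a}. 1 / (a - b))" for a :: real
  have A: "finite A" "A \<subseteq> {-1..1}" "A \<noteq> {}" "x \<notin> A"
    using chebyshev_nodes_interval card_chebyshev_nodes[of n] n x by (auto simp: A_def)
  \<comment> \<open>The weights are chosen so that 1/((z - x)(z - a)) = (1/(z - x) - 1/(z - a))/(x -
    a), together with the partial fractions, collapses the sum to the kernel of the
    remainder.\<close>
  let ?G = "\<lambda>z. \<Sum>a\<in>A. of_real (k a / (x - a)) * (h z / (z - of_real x) - h z / (z - of_real a))"
  have "(?G has_contour_integral (\<Sum>a\<in>A. of_real (k a / (x - a)) *
      (2 * of_real pi * \<i> * h (of_real x) - 2 * of_real pi * \<i> * h (of_real a)))) ellipse"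
    by (intro has_contour_integral_sum has_contour_integral_lmul has_contour_integral_diff ellipse_Cauchy h)
       (use A x in auto)
  moreover have "?G z = h z / ((z - of_real x) * (\<Prod>a\<in>A. z - of_real a))" if "z \<in> path_image ellipse" for z
  proof -
    have zx: "z - of_real x \<noteq> 0" using ellipse_avoids[OF x(1)] that by auto
    have za: "z - of_real a \<noteq> 0" if "a \<in> A" for a
      using ellipse_avoids[of a] \<open>z \<in> _\<close> A that by auto
    have inj: "inj_on complex_of_real S" for S by (simp add: inj_on_def)
    have "1 / (\<Prod>a\<in>A. z - of_real a) = 1 / (\<Prod>a\<in>complex_of_real ` A. z - a)"
      by (simp add: prod.reindex[OF inj])
    also have "\<dots> = (\<Sum>a\<in>complex_of_real ` A. (\<Prod>b\<in>complex_of_real ` A - {a}. 1 / (a - b)) / (z - a))"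
      by (rule lagrange_partial_fractions[symmetric]) (use A za in auto)
    also have "\<dots> = (\<Sum>a\<in>A. (\<Prod>b\<in>complex_of_real ` (A - {a}). 1 / (of_real a - b)) / (z - of_real a))"
      by (simp add: sum.reindex[OF inj] image_set_diff inj_of_real)
    also have "\<dots> = (\<Sum>a\<in>A. of_real (k a) / (z - of_real a))"
      by (simp add: prod.reindex[OF inj] k_def)
    finally have pf: "1 / (\<Prod>a\<in>A. z - of_real a) = (\<Sum>a\<in>A. of_real (k a) / (z - of_real a))" .
    have "h z / ((z - of_real x) * (\<Prod>a\<in>A. z - of_real a)) = h z / (z - of_real x) * (1 / (\<Prod>a\<in>A. z - of_real a))"
      by simp
    also have "\<dots> = (\<Sum>a\<in>A. h z / (z - of_real x) * (of_real (k a) / (z - of_real a)))"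
      unfolding pf by (rule sum_distrib_left)
    also have "\<dots> = ?G z"
    proof (rule sum.cong[OF refl])
      fix a assume a: "a \<in> A"
      then have "complex_of_real x - of_real a \<noteq> 0" using A(4) by auto
      then show "h z / (z - of_real x) * (of_real (k a) / (z - of_real a)) =
          of_real (k a / (x - a)) * (h z / (z - of_real x) - h z / (z - of_real a))"
        using zx za[OF a] by (simp add: divide_simps) (simp add: algebra_simps)
    qed
    finally show ?thesis by simp
  qed
  ultimately have eq: "contour_integral ellipse (\<lambda>z. h z / ((z - of_real x) * (\<Prod>a\<in>A. z - of_real a))) =
     (\<Sum>a\<in>A. of_real (k a / (x - a)) * (2 * of_real pi * \<i> * h (of_real x) - 2 * of_real pi * \<i> * h (of_real a)))"
    by (intro contour_integral_unique) (rule has_contour_integral_eq)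
  have "of_real (\<Prod>a\<in>A. x - a) * contour_integral ellipse (\<lambda>z. h z / ((z - of_real x) * (\<Prod>a\<in>A. z - of_real a))) =
     (\<Sum>a\<in>A. of_real (poly (lagrange_poly A a) x) * (2 * of_real pi * \<i> * (h (of_real x) - h (of_real a))))"
    unfolding eq sum_distrib_left
  proof (intro sum.cong refl)
    fix a assume a: "a \<in> A"
    have "(\<Prod>b\<in>A. x - b) = (x - a) * (\<Prod>b\<in>A - {a}. x - b)" using A a by (simp add: prod.remove)
    moreover have "x - a \<noteq> 0" using A a by auto
    ultimately have "(\<Prod>b\<in>A. x - b) * (k a / (x - a)) = poly (lagrange_poly A a) x"
      by (simp add: poly_lagrange_poly k_def)
    then have *: "complex_of_real (\<Prod>b\<in>A. x - b) * of_real (k a / (x - a)) = of_real (poly (lagrange_poly A a) x)"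
      by (simp only: flip: of_real_mult)
    show "of_real (\<Prod>a\<in>A. x - a) * (of_real (k a / (x - a)) * (2 * of_real pi * \<i> * h (of_real x) - 2 * of_real pi * \<i> * h (of_real a))) =
        of_real (poly (lagrange_poly A a) x) * (2 * of_real pi * \<i> * (h (of_real x) - h (of_real a)))"
      unfolding *[symmetric] by (simp only: right_diff_distrib mult.assoc)
  qed
  also have "\<dots> = 2 * of_real pi * \<i> * (h (of_real x) * (\<Sum>a\<in>A. of_real (poly (lagrange_poly A a) x)) -
      (\<Sum>a\<in>A. h (of_real a) * of_real (poly (lagrange_poly A a) x)))"
  proof -
    have "of_real (poly (lagrange_poly A a) x) * (2 * of_real pi * \<i> * (h (of_real x) - h (of_real a))) =
        2 * of_real pi * \<i> * (h (of_real x) * of_real (poly (lagrange_poly A a) x) -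
          h (of_real a) * of_real (poly (lagrange_poly A a) x))" for a
      by (simp only: right_diff_distrib mult_ac)
    then show ?thesis by (simp only: sum_distrib_left[symmetric] sum_subtractf)
  qed
  also have "(\<Sum>a\<in>A. complex_of_real (poly (lagrange_poly A a) x)) = 1"
    using sum_lagrange_poly[OF A(1,3)] by (simp flip: poly_sum of_real_sum)
  finally show ?thesis by simp
qed

text \<open>In the remainder the nodal polynomial appears at \<open>x\<close>, where it is at most
  2/2^n, divided by its values on the ellipse, which are at least \<rho>^n (1 - 1/\<rho>)/2^n. The
  powers of 2 cancel and \<rho>^(-n) is left; at a node the error is zero.\<close>

lemma chebyshev_interpolation_error:
  assumes h: "h holomorphic_on nbhd \<zeta> cinterval" and B: "\<And>z. z \<in> nbhd \<zeta> cinterval \<Longrightarrow> norm (h z) \<le> B"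
    and x: "x \<in> {-1..1}" and n: "n > 0"
  defines "A \<equiv> chebyshev_nodes n"
  shows "norm (h (of_real x) - (\<Sum>a\<in>A. h (of_real a) * of_real (poly (lagrange_poly A a) x))) \<le>
    4 * (\<rho> / (\<rho> - 1)) ^ 3 * B / \<rho> ^ n"
proof (cases "x \<in> A")
  case True
  have B0: "0 \<le> B" using B[of 0] cinterval_subset_nbhd[of \<zeta>] rho
    by (smt (verit) atLeastAtMost_iff image_eqI norm_ge_zero of_real_0 subsetD)
  have "(\<Sum>a\<in>A. h (of_real a) * of_real (poly (lagrange_poly A a) x)) = (\<Sum>a\<in>A. if a = x then h (of_real x) else 0)"
    by (rule sum.cong) (use True in \<open>auto simp: poly_lagrange_poly_node A_def\<close>)
  also have "\<dots> = h (of_real x)" using True by (simp add: A_def)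
  finally show ?thesis using B0 rho by simp
next
  case False
  have B0: "0 \<le> B" using B[of 0] cinterval_subset_nbhd[of \<zeta>] rho
    by (smt (verit) atLeastAtMost_iff image_eqI norm_ge_zero of_real_0 subsetD)
  let ?F = "\<lambda>z. h z / ((z - of_real x) * (\<Prod>a\<in>A. z - of_real a))"
  let ?H = "\<lambda>w. deriv joukowski w * ?F (joukowski w)"
  \<comment> \<open>A bound for the integrand on the circle: 1 for the derivative of the Joukowski
    map, \<open>B\<close> for \<open>h\<close>, and in the denominator the lower bounds for |z - x|
    and for the nodal polynomial.\<close>
  define K where "K = 1 * (B / ((\<rho> - 1)\<^sup>2 / (2 * \<rho>) * (\<rho> ^ n * (1 - 1 / \<rho>) / 2 ^ n)))"
  have A: "finite A" "A \<subseteq> {-1..1}" by (simp_all add: A_def chebyshev_nodes_interval)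
  have bound: "norm (?H w) \<le> K" if "norm w = \<rho>" for w
  proof -
    have w: "w \<noteq> 0" using that rho by auto
    have "norm (deriv joukowski w) \<le> 1"
    proof -
      have "norm (inverse (w\<^sup>2)) \<le> 1"
        using that rho by (simp add: norm_inverse norm_power inverse_le_1_iff)
      then have "norm (1 - inverse (w\<^sup>2)) \<le> 2" using norm_triangle_ineq4[of 1 "inverse (w\<^sup>2)"] by simp
      then show ?thesis by (simp add: deriv_joukowski[OF w] norm_divide)
    qed
    moreover have "norm (?F (joukowski w)) \<le> B / ((\<rho> - 1)\<^sup>2 / (2 * \<rho>) * (\<rho> ^ n * (1 - 1 / \<rho>) / 2 ^ n))"
      unfolding norm_divide norm_mult
    proof (intro frac_le mult_mono)
      show "norm (h (joukowski w)) \<le> B" by (rule B) (rule joukowski_in_nbhd[OF that rho])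
      show "(\<rho> - 1)\<^sup>2 / (2 * \<rho>) \<le> norm (joukowski w - of_real x)"
        by (rule joukowski_diff_lower[OF that rho(1) x])
      \<comment> \<open>Here n \<ge> 1 enters, in the form \<rho>^(n-1) \<ge> 1.\<close>
      have "\<rho> ^ n * (1 - 1 / \<rho>) \<le> \<rho> ^ n - 1"
      proof -
        obtain m where m: "n = Suc m" using n by (cases n) auto
        have "1 \<le> \<rho> ^ m" using rho by simp
        then show ?thesis using rho by (simp add: m field_simps)
      qed
      also have "\<dots> \<le> norm (w ^ n) - norm (inverse w ^ n)"
        using that rho by (simp add: norm_power norm_inverse power_le_one inverse_le_1_iff)
      also have "\<dots> \<le> norm (w ^ n + inverse w ^ n)" by (rule norm_diff_ineq)
      finally show "\<rho> ^ n * (1 - 1 / \<rho>) / 2 ^ n \<le> norm (\<Prod>a\<in>A. joukowski w - of_real a)"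
        unfolding A_def prod_chebyshev_nodes[OF w n] by (simp add: norm_divide norm_power divide_right_mono)
    qed (use rho B0 in auto)
    ultimately show ?thesis unfolding norm_mult K_def using rho B0 by (intro mult_mono) auto
  qed
  have cont: "continuous_on (path_image (circlepath 0 \<rho>)) ?H"
  proof -
    have sub: "path_image (circlepath 0 \<rho>) \<subseteq> - {0}" by (rule circle_subset)
    have cj: "continuous_on (path_image (circlepath 0 \<rho>)) joukowski"
      using joukowski_holomorphic holomorphic_on_imp_continuous_on holomorphic_on_subset sub by blast
    have cd: "continuous_on (path_image (circlepath 0 \<rho>)) (deriv joukowski)"
      using holomorphic_deriv[OF joukowski_holomorphic] holomorphic_on_imp_continuous_on holomorphic_on_subset sub
      by blast
    have ch: "continuous_on (path_image (circlepath 0 \<rho>)) (\<lambda>w. h (joukowski w))"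
      by (rule continuous_on_compose2[OF holomorphic_on_imp_continuous_on[OF h] cj])
         (use joukowski_in_nbhd rho in auto)
    have nz: "joukowski w - of_real y \<noteq> 0" if "w \<in> path_image (circlepath 0 \<rho>)" "y \<in> {-1..1}" for w y
    proof
      assume "joukowski w - of_real y = 0"
      moreover have "joukowski w \<in> path_image ellipse"
        unfolding ellipse_image by (rule imageI) (use that(1) rho in auto)
      ultimately show False using ellipse_avoids[OF that(2)] by simp
    qed
    show ?thesis by (intro continuous_intros cj cd ch) (use nz x A in auto)
  qed
  have "norm (contour_integral (circlepath 0 \<rho>) ?H) \<le> K * (2 * pi * \<rho>)"
    by (rule has_contour_integral_bound_circlepath[OF has_contour_integral_integral
          [OF contour_integrable_continuous_circlepath[OF cont]]])
       (use rho B0 bound in \<open>auto simp: K_def\<close>)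
  moreover have "2 * pi * norm (h (of_real x) - (\<Sum>a\<in>A. h (of_real a) * of_real (poly (lagrange_poly A a) x))) =
      norm (complex_of_real (\<Prod>a\<in>A. x - a)) * norm (contour_integral (circlepath 0 \<rho>) ?H)"
    using arg_cong[OF chebyshev_interpolation_remainder[OF h x False[unfolded A_def] n], of norm, folded A_def]
    unfolding contour_integral_ellipse by (simp add: norm_mult)
  moreover have "norm (complex_of_real (\<Prod>a\<in>A. x - a)) \<le> 2 / 2 ^ n"
  proof -
    \<comment> \<open>The interval is the image of the unit circle, so the same closed form of the
      nodal polynomial applies with |w| = 1.\<close>
    let ?u = "cis (arccos x)"
    have "complex_of_real (\<Prod>a\<in>A. x - a) = (\<Prod>a\<in>A. joukowski ?u - of_real a)"
      using x by (simp add: joukowski_cis)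
    also have "\<dots> = (?u ^ n + inverse ?u ^ n) / 2 ^ n"
      unfolding A_def by (rule prod_chebyshev_nodes[OF _ n]) simp
    finally have eq: "complex_of_real (\<Prod>a\<in>A. x - a) = (?u ^ n + inverse ?u ^ n) / 2 ^ n" .
    have "norm (?u ^ n + inverse ?u ^ n) \<le> norm (?u ^ n) + norm (inverse ?u ^ n)"
      by (rule norm_triangle_ineq)
    also have "\<dots> = 2" by (simp add: norm_power norm_inverse)
    finally show ?thesis unfolding eq by (simp add: norm_divide norm_power divide_right_mono)
  qed
  ultimately have "2 * pi * norm (h (of_real x) - (\<Sum>a\<in>A. h (of_real a) * of_real (poly (lagrange_poly A a) x))) \<le>
      2 / 2 ^ n * (K * (2 * pi * \<rho>))"
    by (simp only:) (intro mult_mono; simp)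
  also have "\<dots> = 2 * pi * (4 * (\<rho> / (\<rho> - 1)) ^ 3 * B / \<rho> ^ n)"
  proof -
    have "\<rho> - 1 \<noteq> 0" "\<rho> \<noteq> 0" using rho by auto
    moreover have "1 - 1 / \<rho> = (\<rho> - 1) / \<rho>" using \<open>\<rho> \<noteq> 0\<close> by (simp add: field_simps)
    ultimately show ?thesis unfolding K_def by (simp add: divide_simps power2_eq_square power3_eq_cube)
  qed
  finally show ?thesis by (rule mult_left_le_imp_le) simp
qed

end

text \<open>Nodes and weights depend on \<open>n\<close> alone and not on \<open>h\<close>, so the
  operator can be applied to one variable with the others as parameters. For n = 0 there are no
  nodes and the error is \<open>h\<close> itself; this is where C \<ge> 1 is used.\<close>

lemma polynomial_interpolation:
  fixes \<zeta> \<rho> :: real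
  assumes rho: "1 < \<rho>" "\<rho> < 1 + \<zeta>"
  obtains C where "1 \<le> C" "\<And>n. \<exists>A w. finite A \<and> A \<subseteq> {-1..1} \<and> (\<forall>a\<in>A. degree (w a :: real poly) < n) \<and>
     (\<forall>h B. h holomorphic_on nbhd \<zeta> cinterval \<longrightarrow> (\<forall>z\<in>nbhd \<zeta> cinterval. norm (h z) \<le> B) \<longrightarrow>
       (\<forall>x\<in>{-1..1}. norm (h (of_real x) - (\<Sum>a\<in>A. h (of_real a) * of_real (poly (w a) x))) \<le> C * B / \<rho> ^ n))"
proof
  let ?C = "4 * (\<rho> / (\<rho> - 1)) ^ 3"
  have "1 \<le> (\<rho> / (\<rho> - 1)) ^ 3" using rho by (intro one_le_power) simp
  then show C: "1 \<le> ?C" by simp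
  show "\<exists>A w. finite A \<and> A \<subseteq> {-1..1} \<and> (\<forall>a\<in>A. degree (w a :: real poly) < n) \<and>
     (\<forall>h B. h holomorphic_on nbhd \<zeta> cinterval \<longrightarrow> (\<forall>z\<in>nbhd \<zeta> cinterval. norm (h z) \<le> B) \<longrightarrow>
       (\<forall>x\<in>{-1..1}. norm (h (of_real x) - (\<Sum>a\<in>A. h (of_real a) * of_real (poly (w a) x))) \<le> ?C * B / \<rho> ^ n))" for n
  proof (cases "n = 0")
    case True
    have "norm (h (of_real x)) \<le> ?C * B"
      if "\<forall>z\<in>nbhd \<zeta> cinterval. norm (h z) \<le> B" "x \<in> {-1..1}" for h :: "complex \<Rightarrow> complex" and B x
    proof -
      have 1: "norm (h (of_real x)) \<le> B"
      proof -
        have "complex_of_real x \<in> nbhd \<zeta> cinterval"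
          by (rule subsetD[OF cinterval_subset_nbhd]) (use rho that in auto)
        then show ?thesis using that by blast
      qed
      then have "0 \<le> B" using norm_ge_zero order_trans by blast
      then have "1 * B \<le> ?C * B" by (intro mult_right_mono C)
      with 1 show ?thesis by simp
    qed
    then show ?thesis using True by (intro exI[of _ "{}"]) auto
  next
    case False
    then have "n > 0" by simp
    show ?thesis
      by (intro exI[of _ "chebyshev_nodes n"] exI[of _ "lagrange_poly (chebyshev_nodes n)"] conjI allI impI ballI)
         (use chebyshev_nodes_interval chebyshev_interpolation_error[OF rho _ _ _ \<open>n > 0\<close>]
            degree_lagrange_poly[of "chebyshev_nodes n"] in \<open>auto simp: card_chebyshev_nodes\<close>)
  qed
qed

section \<open>Separately holomorphic functions on polyneighbourhoods\<close>

lemma cemb_upd: "j \<in> {1..k} \<Longrightarrow> (cemb k x)(j := of_real a) = cemb k (x(j := a))"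
  by (auto simp: cemb_def)

lemma cemb_in_PiE: "x \<in> cube k \<Longrightarrow> cemb k x \<in> PiE {1..k} (\<lambda>_. cinterval)"
  by (fastforce simp: cemb_def cube_def)

lemma cemb_in_poly_nbhd:
  assumes "x \<in> cube k" "\<And>j. j \<in> {1..k} \<Longrightarrow> 0 < \<zeta> j"
  shows "cemb k x \<in> poly_nbhd k \<zeta>"
proof -
  have "PiE {1..k} (\<lambda>_. cinterval) \<subseteq> poly_nbhd k \<zeta>"
    unfolding poly_nbhd_def by (rule PiE_mono) (use assms cinterval_subset_nbhd in auto)
  then show ?thesis using cemb_in_PiE[OF assms(1)] by blast
qed

lemma cube_upd: "x \<in> cube k \<Longrightarrow> j \<in> {1..k} \<Longrightarrow> t \<in> {-1..1} \<Longrightarrow> x(j := t) \<in> cube k"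
  by (auto simp: cube_def PiE_def extensional_def Pi_def)

lemma holomorphic_nE:
  assumes "holomorphic_n k U g" "z \<in> U"
  obtains a :: "nat \<Rightarrow> complex" where "\<forall>e>0. \<exists>r>0. \<forall>w\<in>U. (\<forall>i\<in>{1..k}. norm (w i - z i) < r) \<longrightarrow>
    norm (g w - g z - (\<Sum>i=1..k. a i * (w i - z i))) \<le> e * (\<Sum>i=1..k. norm (w i - z i))"
  using bspec[OF assms(1)[unfolded holomorphic_n_def] assms(2)] by (elim exE) (rule that)

lemma holomorphic_n_separately:
  assumes "holomorphic_n k (poly_nbhd k \<zeta>) g" "z \<in> poly_nbhd k \<zeta>" "j \<in> {1..k}"
  shows "(\<lambda>s. g (z(j := s))) holomorphic_on nbhd (\<zeta> j) cinterval"
proof (rule holomorphic_onI)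
  fix s0 assume s0: "s0 \<in> nbhd (\<zeta> j) cinterval"
  have upd: "z(j := s) \<in> poly_nbhd k \<zeta>" if "s \<in> nbhd (\<zeta> j) cinterval" for s
    using assms(2,3) that by (auto simp: poly_nbhd_def PiE_def extensional_def Pi_def)
  obtain a where a: "\<forall>e>0. \<exists>r>0. \<forall>w\<in>poly_nbhd k \<zeta>.
      (\<forall>i\<in>{1..k}. norm (w i - (z(j := s0)) i) < r) \<longrightarrow>
      norm (g w - g (z(j := s0)) - (\<Sum>i=1..k. a i * (w i - (z(j := s0)) i))) \<le> e * (\<Sum>i=1..k. norm (w i - (z(j := s0)) i))"
    by (rule holomorphic_nE[OF assms(1) upd[OF s0]])
  have "((\<lambda>s. g (z(j := s))) has_derivative (\<lambda>h. a j * h)) (at s0 within nbhd (\<zeta> j) cinterval)"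
    unfolding has_derivative_within_alt
  proof (intro conjI allI impI)
    show "bounded_linear ((*) (a j))" by (rule bounded_linear_mult_right)
    fix e :: real assume "e > 0"
    from a[THEN spec, THEN mp, OF this] obtain r where r: "r > 0" "\<And>w. w \<in> poly_nbhd k \<zeta> \<Longrightarrow>
      (\<forall>i\<in>{1..k}. norm (w i - (z(j := s0)) i) < r) \<Longrightarrow>
      norm (g w - g (z(j := s0)) - (\<Sum>i=1..k. a i * (w i - (z(j := s0)) i))) \<le> e * (\<Sum>i=1..k. norm (w i - (z(j := s0)) i))"
      by blast
    show "\<exists>d>0. \<forall>y\<in>nbhd (\<zeta> j) cinterval. norm (y - s0) < d \<longrightarrow>
        norm (g (z(j := y)) - g (z(j := s0)) - a j * (y - s0)) \<le> e * norm (y - s0)"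
    proof (intro exI[of _ r] conjI r(1) ballI impI)
      fix y assume y: "y \<in> nbhd (\<zeta> j) cinterval" "norm (y - s0) < r"
      have "(\<Sum>i=1..k. a i * ((z(j := y)) i - (z(j := s0)) i)) = (\<Sum>i=1..k. if i = j then a j * (y - s0) else 0)"
        by (rule sum.cong) auto
      moreover have "(\<Sum>i=1..k. norm ((z(j := y)) i - (z(j := s0)) i)) = (\<Sum>i=1..k. if i = j then norm (y - s0) else 0)"
        by (rule sum.cong) auto
      moreover have "\<forall>i\<in>{1..k}. norm ((z(j := y)) i - (z(j := s0)) i) < r" using y r(1) by auto
      ultimately show "norm (g (z(j := y)) - g (z(j := s0)) - a j * (y - s0)) \<le> e * norm (y - s0)"
        using r(2)[OF upd[OF y(1)]] assms(3) by simp
    qed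
  qed
  then show "(\<lambda>s. g (z(j := s))) field_differentiable at s0 within nbhd (\<zeta> j) cinterval"
    unfolding field_differentiable_def has_field_derivative_def by blast
qed

lemma holomorphic_n_continuous:
  assumes "holomorphic_n k (poly_nbhd k \<zeta>) g" "\<And>j. j \<in> {1..k} \<Longrightarrow> 0 < \<zeta> j"
  shows "continuous_on (cube k) (\<lambda>x. g (cemb k x))"
  unfolding continuous_on_def
proof
  fix x assume x: "x \<in> cube k"
  have in_nbhd: "cemb k y \<in> poly_nbhd k \<zeta>" if "y \<in> cube k" for y
    by (rule cemb_in_poly_nbhd[OF that assms(2)])
  obtain a where a: "\<forall>e>0. \<exists>r>0. \<forall>w\<in>poly_nbhd k \<zeta>.
      (\<forall>i\<in>{1..k}. norm (w i - cemb k x i) < r) \<longrightarrow>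
      norm (g w - g (cemb k x) - (\<Sum>i=1..k. a i * (w i - cemb k x i))) \<le> e * (\<Sum>i=1..k. norm (w i - cemb k x i))"
    by (rule holomorphic_nE[OF assms(1) in_nbhd[OF x]])
  \<comment> \<open>The single choice e = 1 suffices for continuity: it bounds the increment by a
    combination of the finitely many coordinate increments with coefficients |a_i| + 1.\<close>
  from a[THEN spec, THEN mp, of 1] obtain r where r: "r > 0" "\<And>w. w \<in> poly_nbhd k \<zeta> \<Longrightarrow>
      (\<forall>i\<in>{1..k}. norm (w i - cemb k x i) < r) \<Longrightarrow>
      norm (g w - g (cemb k x) - (\<Sum>i=1..k. a i * (w i - cemb k x i))) \<le> (\<Sum>i=1..k. norm (w i - cemb k x i))"
    by auto
  have coord: "((\<lambda>y. y i) \<longlongrightarrow> x i) (at x within cube k)" for i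
    using continuous_on_subset[OF continuous_on_product_coordinates subset_UNIV, of "cube k" i] x
    unfolding continuous_on_def by blast
  have c0: "((\<lambda>y. norm (cemb k y i - cemb k x i)) \<longlongrightarrow> 0) (at x within cube k)" if "i \<in> {1..k}" for i
  proof -
    have "((\<lambda>y. norm (of_real (y i) - of_real (x i) :: complex)) \<longlongrightarrow> norm (of_real (x i) - of_real (x i) :: complex)) (at x within cube k)"
      by (intro tendsto_intros coord)
    then show ?thesis using that by (simp add: cemb_def)
  qed
  have "((\<lambda>y. g (cemb k y) - g (cemb k x)) \<longlongrightarrow> 0) (at x within cube k)"
  proof (rule Lim_null_comparison)
    have "\<forall>\<^sub>F y in at x within cube k. \<forall>i\<in>{1..k}. norm (cemb k y i - cemb k x i) < r"
      by (intro eventually_ball_finite ballI order_tendstoD(2)[OF c0]) (use r in auto)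
    moreover have "\<forall>\<^sub>F y in at x within cube k. y \<in> cube k"
      by (simp add: eventually_at_topological) (use open_UNIV in blast)
    ultimately show "\<forall>\<^sub>F y in at x within cube k. norm (g (cemb k y) - g (cemb k x)) \<le>
        (\<Sum>i=1..k. (norm (a i) + 1) * norm (cemb k y i - cemb k x i))"
    proof eventually_elim
      case (elim y)
      have "norm (g (cemb k y) - g (cemb k x)) \<le>
          norm (g (cemb k y) - g (cemb k x) - (\<Sum>i=1..k. a i * (cemb k y i - cemb k x i))) +
          norm (\<Sum>i=1..k. a i * (cemb k y i - cemb k x i))"
        using norm_triangle_sub[of "g (cemb k y) - g (cemb k x)" "\<Sum>i=1..k. a i * (cemb k y i - cemb k x i)"]
        by (simp only: add.commute)
      also have "\<dots> \<le> (\<Sum>i=1..k. norm (cemb k y i - cemb k x i)) + (\<Sum>i=1..k. norm (a i) * norm (cemb k y i - cemb k x i))"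
        by (intro add_mono r(2) in_nbhd) (use elim in \<open>auto intro!: order_trans[OF norm_sum] simp: norm_mult\<close>)
      finally show ?case by (simp add: algebra_simps sum.distrib)
    qed
    have "((\<lambda>y. \<Sum>i=1..k. (norm (a i) + 1) * norm (cemb k y i - cemb k x i)) \<longlongrightarrow> (\<Sum>i=1..k. (norm (a i) + 1) * 0)) (at x within cube k)"
      by (intro tendsto_sum tendsto_mult_left c0) auto
    then show "((\<lambda>y. \<Sum>i=1..k. (norm (a i) + 1) * norm (cemb k y i - cemb k x i)) \<longlongrightarrow> 0) (at x within cube k)"
      by simp
  qed
  then show "((\<lambda>x. g (cemb k x)) \<longlongrightarrow> g (cemb k x)) (at x within cube k)"
    by (simp add: LIM_zero_iff)
qed

section \<open>Measurability and bounds for integrals over the cube\<close>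

lemma closed_cube: "closed (cube k)"
proof -
  have "cube k = (\<Inter>i\<in>{1..k}. (\<lambda>x. x i) -` {-1..1}) \<inter> (\<Inter>i\<in>-{1..k}. (\<lambda>x. x i) -` {undefined})"
    by (auto simp: cube_def PiE_iff extensional_def)
  then show ?thesis by (auto intro!: closed_Int closed_INT closed_vimage continuous_on_product_coordinates)
qed

lemma measurable_continuous_on_cube:
  fixes f :: "(nat \<Rightarrow> real) \<Rightarrow> 'b::{real_normed_vector, second_countable_topology}"
  shows "continuous_on (cube k) f \<Longrightarrow> f \<in> borel_measurable (mu {1..k})"
  by (rule continuous_on_mu_measurable[OF _ closed_cube]) (auto simp: cube_def)

lemma norm_integral_mu_le:
  fixes F :: "(nat \<Rightarrow> real) \<Rightarrow> 'b::{banach, second_countable_topology}"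
  assumes "F \<in> borel_measurable (mu I)" "\<And>x. x \<in> PiE I (\<lambda>_. {-1..1}) \<Longrightarrow> norm (F x) \<le> B"
  shows "norm (\<integral>x. F x \<partial>mu I) \<le> B"
proof -
  interpret prob_space "mu I" by (rule prob_space_mu)
  have "integrable (mu I) F" by (rule integrable_mu_bounded[OF assms])
  have "norm (\<integral>x. F x \<partial>mu I) \<le> (\<integral>x. norm (F x) \<partial>mu I)" by (rule integral_norm_bound)
  also have "\<dots> \<le> (\<integral>x. B \<partial>mu I)"
    by (intro integral_mono) (use assms(2) \<open>integrable (mu I) F\<close> in \<open>auto simp: space_mu\<close>)
  finally show ?thesis by (simp add: prob_space)
qed

lemma measurable_mu_poly: "(\<lambda>x. poly p (x j)) \<in> borel_measurable (mu I)" for p :: "real poly"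
  by (rule measurable_compose[OF measurable_mu_component]) (intro borel_measurable_continuous_onI continuous_intros)

lemma measurable_mu_tensor: "(\<lambda>x. \<Prod>j\<in>J. poly (q j :: real poly) (x j)) \<in> borel_measurable (mu I)"
  by (intro borel_measurable_prod measurable_mu_poly)

lemma tensor_bound:
  assumes "\<And>j x. j \<in> J \<Longrightarrow> x \<in> {-1..1} \<Longrightarrow> \<bar>poly (q j :: real poly) x\<bar> \<le> b j" "x \<in> PiE J (\<lambda>_. {-1..1})"
  shows "\<bar>\<Prod>j\<in>J. poly (q j) (x j)\<bar> \<le> (\<Prod>j\<in>J. b j)"
  unfolding abs_prod by (rule prod_mono) (use assms in \<open>auto simp: PiE_iff\<close>)

lemma tensor_upd:
  assumes "finite J" "j \<in> J"
  shows "(\<Prod>i\<in>J. poly (q i) ((x(j := t)) i)) = poly (q j) t * (\<Prod>i\<in>J - {j}. poly (q i) (x i))"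
proof -
  have "(\<Prod>i\<in>J. poly (q i) ((x(j := t)) i)) = poly (q j) t * (\<Prod>i\<in>J - {j}. poly (q i) ((x(j := t)) i))"
    using prod.remove[OF assms, of "\<lambda>i. poly (q i) ((x(j := t)) i)"] by simp
  also have "(\<Prod>i\<in>J - {j}. poly (q i) ((x(j := t)) i)) = (\<Prod>i\<in>J - {j}. poly (q i) (x i))"
    by (rule prod.cong) auto
  finally show ?thesis .
qed

text \<open>Each variable contributes its own factor C_j/\<rho>_j^(n_j), where n_j is the number of
  degrees that \<open>q j\<close> annihilates. Formulated for arbitrary factors instead of Legendre
  polynomials because in the last variable an antiderivative will take that place. The constant is
  uniform in all data quantified inside.\<close>

lemma tensor_coefficient_bound:
  assumes rho: "\<And>j. j \<in> {1..k} \<Longrightarrow> 1 < \<rho> j" "\<And>j. j \<in> {1..k} \<Longrightarrow> \<rho> j < 1 + \<zeta> j"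
  shows "\<exists>C>0. \<forall>h B n q b.
    (\<forall>z\<in>poly_nbhd k \<zeta>. \<forall>j\<in>{1..k}. (\<lambda>s. h (z(j := s))) holomorphic_on nbhd (\<zeta> j) cinterval) \<longrightarrow>
    (\<forall>z\<in>poly_nbhd k \<zeta>. norm (h z) \<le> B) \<longrightarrow>
    (\<lambda>x. h (cemb k x)) \<in> borel_measurable (mu {1..k}) \<longrightarrow>
    (\<forall>j\<in>{1..k}. \<forall>p. degree p < n j \<longrightarrow> (\<integral>x. poly (q j * p) x \<partial>mu1) = 0) \<longrightarrow>
    (\<forall>j\<in>{1..k}. \<forall>x\<in>{-1..1}. \<bar>poly (q j) x\<bar> \<le> b j) \<longrightarrow>
    norm (\<integral>x. h (cemb k x) * of_real (\<Prod>j=1..k. poly (q j) (x j)) \<partial>mu {1..k}) \<le>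
      C * B * (\<Prod>j=1..k. b j / \<rho> j ^ n j)"
proof -
  define interp where "interp j C n A w \<longleftrightarrow> finite A \<and> A \<subseteq> {-1..1} \<and> (\<forall>a\<in>A. degree (w a :: real poly) < n) \<and>
     (\<forall>h B. h holomorphic_on nbhd (\<zeta> j) cinterval \<longrightarrow> (\<forall>z\<in>nbhd (\<zeta> j) cinterval. norm (h z) \<le> B) \<longrightarrow>
       (\<forall>x\<in>{-1..1}. norm (h (of_real x) - (\<Sum>a\<in>A. h (of_real a) * of_real (poly (w a) x))) \<le> C * B / \<rho> j ^ n))"
    for j n :: nat and C :: real and A w
  have "\<forall>j\<in>{1..k}. \<exists>C. 1 \<le> C \<and> (\<forall>n. \<exists>A w. interp j C n A w)"
  proof
    fix j assume j: "j \<in> {1..k}"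
    obtain C where "1 \<le> C" "\<And>n. \<exists>A w. interp j C n A w"
      using polynomial_interpolation[OF rho(1)[OF j] rho(2)[OF j]] unfolding interp_def by blast
    then show "\<exists>C. 1 \<le> C \<and> (\<forall>n. \<exists>A w. interp j C n A w)" by blast
  qed
  then obtain C where "\<forall>j\<in>{1..k}. 1 \<le> C j \<and> (\<forall>n. \<exists>A w. interp j (C j) n A w)"
    by (rule bchoice[THEN exE])
  then have C: "\<And>j. j \<in> {1..k} \<Longrightarrow> 1 \<le> C j" "\<And>j n. j \<in> {1..k} \<Longrightarrow> \<exists>A w. interp j (C j) n A w"
    by blast+
  have C0: "0 \<le> C j" if "j \<in> {1..k}" for j using C(1)[OF that] by simp
  have zeta: "0 < \<zeta> j" if "j \<in> {1..k}" for j using rho(1)[OF that] rho(2)[OF that] by simp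
  show ?thesis
  proof (intro exI[of _ "\<Prod>j=1..k. C j"] conjI allI impI)
    show "0 < (\<Prod>j=1..k. C j)" using C(1) by (intro prod_pos) (auto intro: less_le_trans[OF zero_less_one])
    fix h B n q b
    assume holo: "\<forall>z\<in>poly_nbhd k \<zeta>. \<forall>j\<in>{1..k}. (\<lambda>s. h (z(j := s))) holomorphic_on nbhd (\<zeta> j) cinterval"
      and B: "\<forall>z\<in>poly_nbhd k \<zeta>. norm (h z) \<le> B"
      and meas: "(\<lambda>x. h (cemb k x)) \<in> borel_measurable (mu {1..k})"
      and orth: "\<forall>j\<in>{1..k}. \<forall>p. degree p < n j \<longrightarrow> (\<integral>x. poly (q j * p) x \<partial>mu1) = 0"
      and b: "\<forall>j\<in>{1..k}. \<forall>x\<in>{-1..1}. \<bar>poly (q j) x\<bar> \<le> b j"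
    \<comment> \<open>The first \<open>m\<close> variables have been treated and are real from then
      on; the others still range over complex neighbourhoods, where holomorphy is available for the
      next steps.\<close>
    define Z where "Z m = PiE {1..k} (\<lambda>i. if i \<le> m then cinterval else nbhd (\<zeta> i) cinterval)" for m
    define Q where "Q x = (\<Prod>j=1..k. poly (q j) (x j))" for x
    define Bm where "Bm m = B * (\<Prod>j=1..m. C j / \<rho> j ^ n j)" for m
    have "(\<lambda>j\<in>{1..k}. 0) \<in> cube k" by (auto simp: cube_def)
    then have B0: "0 \<le> B"
      by (rule order_trans[OF norm_ge_zero bspec[OF B cemb_in_poly_nbhd[OF _ zeta]]])
    have Q_bound: "\<bar>Q x\<bar> \<le> (\<Prod>j=1..k. b j)" if "x \<in> cube k" for x
      unfolding Q_def by (rule tensor_bound) (use b that in \<open>auto simp: cube_def\<close>)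
    have Q_meas: "Q \<in> borel_measurable (mu {1..k})" unfolding Q_def by (rule measurable_mu_tensor)
    have cemb_Z: "cemb k x \<in> Z m" if "x \<in> cube k" for x m
    proof -
      have "PiE {1..k} (\<lambda>_. cinterval) \<subseteq> Z m"
        unfolding Z_def by (rule PiE_mono) (use cinterval_subset_nbhd zeta in auto)
      then show ?thesis using cemb_in_PiE[OF that] by blast
    qed
    have Z_upd: "z(j := s) \<in> Z m" if "z \<in> Z m" "j \<in> {1..k}" "m < j" "s \<in> nbhd (\<zeta> j) cinterval" for z j s m
      unfolding Z_def
    proof (rule PiE_I)
      fix i assume "i \<in> {1..k}"
      then show "(z(j := s)) i \<in> (if i \<le> m then cinterval else nbhd (\<zeta> i) cinterval)"
        using PiE_mem[OF that(1)[unfolded Z_def]] that(3,4) by (cases "i = j") auto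
    next
      fix i assume "i \<notin> {1..k}"
      then show "(z(j := s)) i = undefined" using that(1,2) by (auto simp: Z_def PiE_iff extensional_def)
    qed
    have Bm0: "0 \<le> Bm m" if "m \<le> k" for m
      unfolding Bm_def
      by (intro mult_nonneg_nonneg B0 prod_nonneg ballI divide_nonneg_nonneg C0 zero_le_power)
         (use rho(1) that in \<open>auto intro: less_imp_le[OF less_trans[OF zero_less_one]]\<close>)
    define good where "good m H \<longleftrightarrow> (\<forall>z\<in>Z m. norm (H z) \<le> Bm m) \<and>
        (\<forall>z\<in>Z m. \<forall>j\<in>{m<..k}. (\<lambda>s. H (z(j := s))) holomorphic_on nbhd (\<zeta> j) cinterval) \<and>
        (\<lambda>x. H (cemb k x)) \<in> borel_measurable (mu {1..k}) \<and>
        (\<integral>x. H (cemb k x) * of_real (Q x) \<partial>mu {1..k}) = (\<integral>x. h (cemb k x) * of_real (Q x) \<partial>mu {1..k})"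
      for m and H :: "(nat \<Rightarrow> complex) \<Rightarrow> complex"
    have goodD: "z \<in> Z m \<Longrightarrow> norm (H z) \<le> Bm m"
        "z \<in> Z m \<Longrightarrow> j \<in> {m<..k} \<Longrightarrow> (\<lambda>s. H (z(j := s))) holomorphic_on nbhd (\<zeta> j) cinterval"
        "(\<lambda>x. H (cemb k x)) \<in> borel_measurable (mu {1..k})"
        "(\<integral>x. H (cemb k x) * of_real (Q x) \<partial>mu {1..k}) = (\<integral>x. h (cemb k x) * of_real (Q x) \<partial>mu {1..k})"
      if "good m H" for m H z j
      using that unfolding good_def by blast+
    have "\<exists>H. good m H" if "m \<le> k" for m
      using that
    proof (induction m)
      case 0
      have Z0: "Z 0 = poly_nbhd k \<zeta>" unfolding Z_def poly_nbhd_def by (rule PiE_cong) auto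
      have "{0<..k} = {1..k}" by auto
      then have "good 0 h" unfolding good_def Z0 using holo B meas by (simp add: Bm_def)
      then show ?case by (intro exI[of _ h])
    next
      case (Suc m)
      then obtain H where "good m H" by auto
      note H = goodD[OF this]
      define j where "j = Suc m"
      have j: "j \<in> {1..k}" "j \<in> {m<..k}" using Suc.prems by (auto simp: j_def)
      from C(2)[OF j(1)] obtain A w where "interp j (C j) (n j) A w" by blast
      then have A: "finite A" "A \<subseteq> {-1..1}" "\<And>a. a \<in> A \<Longrightarrow> degree (w a) < n j"
        and err: "\<And>f B x. f holomorphic_on nbhd (\<zeta> j) cinterval \<Longrightarrow> \<forall>z\<in>nbhd (\<zeta> j) cinterval. norm (f z) \<le> B \<Longrightarrow> x \<in> {-1..1} \<Longrightarrow>
          norm (f (of_real x) - (\<Sum>a\<in>A. f (of_real a) * of_real (poly (w a) x))) \<le> C j * B / \<rho> j ^ n j"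
        unfolding interp_def by blast+
      have A_nbhd: "of_real a \<in> nbhd (\<zeta> j) cinterval" if "a \<in> A" for a
        by (rule subsetD[OF cinterval_subset_nbhd[OF zeta[OF j(1)]]]) (use A that in auto)
      \<comment> \<open>The interpolation error in the variable \<open>j\<close>; the subtracted terms have degree less than \<open>n j\<close> in
        that variable and are invisible to \<open>q j\<close>.\<close>
      define H' where "H' z = H z - (\<Sum>a\<in>A. H (z(j := of_real a)) * of_real (poly (w a) (Re (z j))))" for z
      have Z_mono: "z \<in> Z m" if "z \<in> Z (Suc m)" for z
      proof -
        have "Z (Suc m) \<subseteq> Z m"
          unfolding Z_def by (rule PiE_mono) (use cinterval_subset_nbhd zeta in auto)
        then show ?thesis using that by blast
      qed
      have H'_cemb: "H' (cemb k x) = H (cemb k x) - (\<Sum>a\<in>A. H (cemb k (x(j := a))) * of_real (poly (w a) (x j)))" for x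
        unfolding H'_def using j(1) by (simp add: cemb_upd) (simp add: cemb_def)
      have upd_meas: "(\<lambda>x. H (cemb k (x(j := a)))) \<in> borel_measurable (mu {1..k})" if "a \<in> A" for a
        by (rule measurable_compose[OF measurable_mu_upd H(3)]) (use that A j in auto)
      have w_meas: "(\<lambda>x. complex_of_real (poly (w a) (x j))) \<in> borel_measurable (mu {1..k})" for a
        by (rule measurable_compose[OF measurable_mu_poly]) simp
      show ?case
        unfolding good_def
      proof (intro exI[of _ H'] conjI ballI)
        fix z assume z: "z \<in> Z (Suc m)"
        then have "z j \<in> cinterval" using PiE_mem[OF z[unfolded Z_def] j(1)] by (simp add: j_def)
        \<comment> \<open>On \<open>Z (Suc m)\<close> the coordinate \<open>j\<close> is real, so
          the \<open>Re\<close> in the definition of \<open>H'\<close> returns exactly the point at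
          which the interpolant is evaluated.\<close>
        then obtain x where x: "x \<in> {-1..1}" "z j = of_real x" by blast
        then have zz: "z(j := of_real x) = z" by auto
        have "norm (H (z(j := of_real x)) - (\<Sum>a\<in>A. H (z(j := of_real a)) * of_real (poly (w a) x))) \<le> C j * Bm m / \<rho> j ^ n j"
          by (rule err[where f = "\<lambda>s. H (z(j := s))"])
             (use H(1,2) Z_mono[OF z] Z_upd j x in auto)
        also have "C j * Bm m / \<rho> j ^ n j = Bm (Suc m)"
          by (simp add: Bm_def j_def prod.nat_ivl_Suc')
        finally show "norm (H' z) \<le> Bm (Suc m)" unfolding H'_def zz by (simp add: x)
      next
        fix z i assume z: "z \<in> Z (Suc m)" and i: "i \<in> {Suc m<..k}"
        then have ij: "i \<noteq> j" by (auto simp: j_def)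
        have "H' (z(i := s)) = H (z(i := s)) - (\<Sum>a\<in>A. H ((z(j := of_real a))(i := s)) * of_real (poly (w a) (Re (z j))))" for s
          unfolding H'_def using ij by (simp add: fun_upd_twist)
        moreover have "(\<lambda>s. H (z(i := s)) - (\<Sum>a\<in>A. H ((z(j := of_real a))(i := s)) * of_real (poly (w a) (Re (z j)))))
            holomorphic_on nbhd (\<zeta> i) cinterval"
          by (intro holomorphic_intros H(2) Z_upd Z_mono[OF z] A_nbhd) (use i j in auto)
        ultimately show "(\<lambda>s. H' (z(i := s))) holomorphic_on nbhd (\<zeta> i) cinterval" by simp
      next
        show "(\<lambda>x. H' (cemb k x)) \<in> borel_measurable (mu {1..k})"
          unfolding H'_cemb by (intro borel_measurable_diff H(3) borel_measurable_sum borel_measurable_times upd_meas w_meas)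
      next
        let ?G = "\<lambda>a x. H (cemb k (x(j := a))) * of_real (poly (w a) (x j)) * of_real (Q x)"
        have int0: "integrable (mu {1..k}) (\<lambda>x. H (cemb k x) * of_real (Q x))"
        proof (rule integrable_mu_bounded)
          fix x assume "x \<in> PiE {1..k} (\<lambda>_. {-1..1::real})"
          then have x: "x \<in> cube k" by (simp add: cube_def)
          have "norm (H (cemb k x)) * \<bar>Q x\<bar> \<le> Bm m * (\<Prod>j=1..k. b j)"
            by (intro mult_mono H(1) cemb_Z Q_bound x) (use Bm0 Suc.prems in auto)
          then show "norm (H (cemb k x) * of_real (Q x)) \<le> Bm m * (\<Prod>j=1..k. b j)" by (simp add: norm_mult)
        qed (use H(3) Q_meas in measurable)
        have intG: "integrable (mu {1..k}) (?G a)" if a: "a \<in> A" for a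
        proof -
          have "bounded (poly (w a) ` {-1..1})"
            by (intro compact_imp_bounded compact_continuous_image continuous_intros) simp
          then obtain W where "\<forall>y\<in>poly (w a) ` {-1..1}. norm y \<le> W" unfolding bounded_iff by blast
          then have W: "\<bar>poly (w a) t\<bar> \<le> W" if "t \<in> {-1..1}" for t using that by auto
          show ?thesis
          proof (rule integrable_mu_bounded)
            fix x assume "x \<in> PiE {1..k} (\<lambda>_. {-1..1::real})"
            then have x: "x \<in> cube k" by (simp add: cube_def)
            have xa: "x(j := a) \<in> cube k" by (rule cube_upd[OF x j(1)]) (use a A in auto)
            have xj: "x j \<in> {-1..1}" using x j by (auto simp: cube_def PiE_iff)
            have "norm (H (cemb k (x(j := a)))) * \<bar>poly (w a) (x j)\<bar> * \<bar>Q x\<bar> \<le> Bm m * W * (\<Prod>j=1..k. b j)"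
            proof (intro mult_mono H(1) cemb_Z Q_bound x xa W xj)
              show "0 \<le> Bm m" using Bm0 Suc.prems by simp
              moreover have "0 \<le> W" using W[OF xj] by simp
              ultimately show "0 \<le> Bm m * W" by simp
            qed auto
            then show "norm (?G a x) \<le> Bm m * W * (\<Prod>j=1..k. b j)" by (simp add: norm_mult)
          qed (use upd_meas[OF a] w_meas Q_meas in measurable)
        qed
        have G0: "(\<integral>x. ?G a x \<partial>mu {1..k}) = 0" if a: "a \<in> A" for a
        proof -
          have "(\<integral>x. ?G a x \<partial>mu {1..k}) = (\<integral>x. 0 \<partial>mu {1..k})"
          proof (rule integral_mu_eq_coord[OF _ j(1) intG[OF a]])
            fix x assume "x \<in> PiE {1..k} (\<lambda>_. {-1..1::real})"
            \<comment> \<open>Everything that is constant along coordinate \<open>j\<close>: the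
              function value is taken at the node \<open>a\<close>, so \<open>t\<close> occurs only
              in \<open>q j * w a\<close>, which integrates to zero.\<close>
            define K where "K = H (cemb k (x(j := a))) * of_real (\<Prod>i\<in>{1..k} - {j}. poly (q i) (x i))"
            have "?G a (x(j := t)) = K * of_real (poly (q j * w a) t)" for t
              unfolding Q_def tensor_upd[OF finite_atLeastAtMost j(1)] K_def by simp
            then have "(\<integral>t. ?G a (x(j := t)) \<partial>mu1) = (\<integral>t. K * of_real (poly (q j * w a) t) \<partial>mu1)"
              by (simp only:)
            also have "\<dots> = K * of_real (\<integral>t. poly (q j * w a) t \<partial>mu1)"
              by (simp del: poly_mult of_real_mult)
            also have "(\<integral>t. poly (q j * w a) t \<partial>mu1) = 0" using orth j(1) A(3)[OF a] by blast
            finally show "(\<integral>t. ?G a (x(j := t)) \<partial>mu1) = (\<integral>t. 0 \<partial>mu1)" by (simp only: of_real_0 mult_zero_right Bochner_Integration.integral_zero)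
          qed auto
          then show ?thesis by simp
        qed
        have "(\<integral>x. H' (cemb k x) * of_real (Q x) \<partial>mu {1..k}) =
            (\<integral>x. H (cemb k x) * of_real (Q x) - (\<Sum>a\<in>A. ?G a x) \<partial>mu {1..k})"
          by (simp add: H'_cemb left_diff_distrib sum_distrib_right)
        also have "\<dots> = (\<integral>x. H (cemb k x) * of_real (Q x) \<partial>mu {1..k}) - (\<Sum>a\<in>A. \<integral>x. ?G a x \<partial>mu {1..k})"
          by (subst Bochner_Integration.integral_diff[OF int0 Bochner_Integration.integrable_sum[OF intG]], assumption,
              subst Bochner_Integration.integral_sum[OF intG], assumption, rule refl)
        also have "(\<Sum>a\<in>A. \<integral>x. ?G a x \<partial>mu {1..k}) = 0" by (intro sum.neutral ballI G0)
        finally show "(\<integral>x. H' (cemb k x) * of_real (Q x) \<partial>mu {1..k}) = (\<integral>x. h (cemb k x) * of_real (Q x) \<partial>mu {1..k})"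
          unfolding H(4) by (simp only: diff_zero)
      qed
    qed
    then obtain H where "good k H" by blast
    note H = goodD(1,3,4)[OF this]
    have "norm (\<integral>x. H (cemb k x) * of_real (Q x) \<partial>mu {1..k}) \<le> Bm k * (\<Prod>j=1..k. b j)"
    proof (rule norm_integral_mu_le)
      fix x assume "x \<in> PiE {1..k} (\<lambda>_. {-1..1::real})"
      then have x: "x \<in> cube k" by (simp add: cube_def)
      have "norm (H (cemb k x)) * \<bar>Q x\<bar> \<le> Bm k * (\<Prod>j=1..k. b j)"
        by (intro mult_mono H(1) cemb_Z Q_bound x) (use Bm0 in auto)
      then show "norm (H (cemb k x) * of_real (Q x)) \<le> Bm k * (\<Prod>j=1..k. b j)" by (simp add: norm_mult)
    qed (use H(2) Q_meas in measurable)
    then show "norm (\<integral>x. h (cemb k x) * of_real (\<Prod>j=1..k. poly (q j) (x j)) \<partial>mu {1..k}) \<le>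
      (\<Prod>j=1..k. C j) * B * (\<Prod>j=1..k. b j / \<rho> j ^ n j)"
      unfolding H(3) unfolding Q_def Bm_def by (simp add: prod_dividef mult_ac)
  qed
qed

section \<open>The Knothe--Rosenblatt map\<close>

lemma integral_bounds_mu:
  fixes F :: "(nat \<Rightarrow> real) \<Rightarrow> real"
  assumes "F \<in> borel_measurable (mu I)" "\<And>x. x \<in> PiE I (\<lambda>_. {-1..1}) \<Longrightarrow> a \<le> F x \<and> F x \<le> b"
  shows "a \<le> (\<integral>x. F x \<partial>mu I) \<and> (\<integral>x. F x \<partial>mu I) \<le> b"
proof -
  interpret prob_space "mu I" by (rule prob_space_mu)
  have "integrable (mu I) F"
  proof (rule integrable_mu_bounded[OF assms(1)])
    fix x assume "x \<in> PiE I (\<lambda>_. {-1..1::real})"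
    from assms(2)[OF this] show "norm (F x) \<le> \<bar>a\<bar> + \<bar>b\<bar>" unfolding real_norm_def by linarith
  qed
  then have "(\<integral>x. a \<partial>mu I) \<le> (\<integral>x. F x \<partial>mu I)" "(\<integral>x. F x \<partial>mu I) \<le> (\<integral>x. b \<partial>mu I)"
    by (intro integral_mono; use assms(2) in \<open>auto simp: space_mu\<close>)+
  then show ?thesis by (simp add: prob_space)
qed

text \<open>No continuity of \<open>c\<close> is assumed, since conditional densities are known here
  as bounded measurable functions: the lower bound gives strict monotonicity and the intermediate
  value theorem gives the range.\<close>

lemma strict_mono_indefinite_integral:
  fixes c :: "real \<Rightarrow> real"
  assumes int: "c integrable_on {-1..1}" and lo: "0 < l" "\<And>t. t \<in> {-1..1} \<Longrightarrow> l \<le> c t"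
    and total: "integral {-1..1} c = 2"
  defines "G \<equiv> \<lambda>y. integral {-1..y} c"
  shows "strict_mono_on {-1..1} G" "G ` {-1..1} = {0..2}"
proof -
  have sub: "c integrable_on {a..b}" if "-1 \<le> a" "b \<le> 1" for a b
    by (rule integrable_on_subinterval[OF int]) (use that in auto)
  have diff: "G b = G a + integral {a..b} c" if "-1 \<le> a" "a \<le> b" "b \<le> 1" for a b
    unfolding G_def by (rule Henstock_Kurzweil_Integration.integral_combine[symmetric]) (use that sub in auto)
  show mono: "strict_mono_on {-1..1} G"
  proof (rule strict_mono_onI)
    fix a b :: real assume ab: "a \<in> {-1..1}" "b \<in> {-1..1}" "a < b"
    have "integral {a..b} (\<lambda>_. l) \<le> integral {a..b} c"
      by (rule integral_le) (use ab lo sub in auto)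
    moreover have "0 < integral {a..b} (\<lambda>_. l)" using ab lo by simp
    ultimately show "G a < G b" using diff[of a b] ab by simp
  qed
  have ends: "G (-1) = 0" "G 1 = 2" using total by (auto simp: G_def)
  have cont: "continuous_on {-1..1} G"
    unfolding G_def by (rule indefinite_integral_continuous_1[OF int])
  show "G ` {-1..1} = {0..2}"
  proof
    show "G ` {-1..1} \<subseteq> {0..2}"
    proof
      fix v assume "v \<in> G ` {-1..1}"
      then obtain y where y: "y \<in> {-1..1}" "v = G y" by blast
      have "G (-1) \<le> G y" "G y \<le> G 1"
        using strict_mono_on_imp_mono_on[OF mono] y(1) by (auto intro: mono_onD)
      then show "v \<in> {0..2}" using ends y by simp
    qed
    show "{0..2} \<subseteq> G ` {-1..1}"
    proof
      fix v :: real assume "v \<in> {0..2}"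
      then have "\<exists>y. -1 \<le> y \<and> y \<le> 1 \<and> G y = v" by (intro IVT') (use ends cont in auto)
      then show "v \<in> G ` {-1..1}" by auto
    qed
  qed
qed

text \<open>The real-variable content of Assumption (A): on the cube the modulus of the extension is
  the positive density itself, so M and L bound \<open>f\<close> from both sides.\<close>

definition density_between :: "nat \<Rightarrow> real \<Rightarrow> real \<Rightarrow> ((nat \<Rightarrow> real) \<Rightarrow> real) \<Rightarrow> bool" where
  "density_between d M L f \<longleftrightarrow> 0 < M \<and> f \<in> borel_measurable (mu {1..d}) \<and>
     (\<forall>x\<in>cube d. M \<le> f x \<and> f x \<le> L) \<and> (\<integral>x. f x \<partial>mu {1..d}) = 1"

lemma assumption_A_density_between:
  assumes A: "assumption_A d M L \<delta> C f" and "0 < M" "\<And>j. j \<in> {1..d} \<Longrightarrow> 0 < \<delta> j"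
  shows "density_between d M L f"
proof -
  have pd: "prob_density d f" using A by (simp add: assumption_A_def)
  from A obtain g where g: "\<forall>x\<in>cube d. g (cemb d x) = complex_of_real (f x)"
    "\<forall>z\<in>poly_nbhd d \<delta>. M \<le> norm (g z) \<and> norm (g z) \<le> L"
    unfolding assumption_A_def by (elim conjE exE) (rule that)
  have "M \<le> f x \<and> f x \<le> L" if x: "x \<in> cube d" for x
  proof -
    have "M \<le> norm (g (cemb d x)) \<and> norm (g (cemb d x)) \<le> L"
      by (rule bspec[OF g(2) cemb_in_poly_nbhd[OF x assms(3)]])
    moreover have "norm (g (cemb d x)) = f x"
      using bspec[OF g(1) x] pd x by (simp add: prob_density_def less_imp_le)
    ultimately show ?thesis by simp
  qed
  then show ?thesis using pd assms(2) by (auto simp: density_between_def prob_density_def)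
qed

text \<open>Used in place of membership in \<open>cube k\<close>, since functions of the first k
  coordinates are also evaluated at points with further coordinates.\<close>

definition interval_upto :: "nat \<Rightarrow> (nat \<Rightarrow> real) \<Rightarrow> bool" where
  "interval_upto k x \<longleftrightarrow> (\<forall>j\<in>{1..k}. x j \<in> {-1..1})"

lemma interval_upto_upd: "interval_upto (k - 1) x \<Longrightarrow> t \<in> {-1..1} \<Longrightarrow> interval_upto k (x(k := t))"
  by (auto simp: interval_upto_def)

section \<open>Marginals and conditional distribution functions of one density\<close>

context
  fixes d :: nat and M L :: real and f :: "(nat \<Rightarrow> real) \<Rightarrow> real"
  assumes dens: "density_between d M L f"
begin

lemma dens_facts: "0 < M" "f \<in> borel_measurable (mu {1..d})" "\<And>x. x \<in> cube d \<Longrightarrow> M \<le> f x \<and> f x \<le> L"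
    "(\<integral>x. f x \<partial>mu {1..d}) = 1"
  using dens by (auto simp: density_between_def)

lemma merge_in_cube:
  assumes "k \<le> d" "interval_upto k x" "s \<in> PiE {k+1..d} (\<lambda>_. {-1..1})"
  shows "merge {1..k} {k+1..d} (x, s) \<in> cube d"
  using assms by (auto simp: merge_def cube_def interval_upto_def PiE_iff extensional_def)

lemma merge_pair_measurable:
  assumes "1 \<le> k" "k \<le> d" "interval_upto (k - 1) x"
  shows "(\<lambda>(t, s). merge {1..k} {k+1..d} (x(k := t), s)) \<in> measurable (mu1 \<Otimes>\<^sub>M mu {k+1..d}) (mu {1..d})"
  unfolding mu_def
proof (rule measurable_PiM_single')
  fix i assume i: "i \<in> {1..d}"
  consider "i = k" | "i < k" | "k < i" by linarith
  then show "(\<lambda>p. (case p of (t, s) \<Rightarrow> merge {1..k} {k+1..d} (x(k := t), s)) i)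
      \<in> measurable (mu1 \<Otimes>\<^sub>M PiM {k+1..d} (\<lambda>_. mu1)) mu1"
  proof cases
    case 1
    then show ?thesis using assms i by (simp add: merge_def split_beta')
  next
    case 2
    then have "x i \<in> space mu1" using assms i by (auto simp: interval_upto_def)
    moreover have "(\<lambda>p. (case p of (t, s) \<Rightarrow> merge {1..k} {k+1..d} (x(k := t), s)) i) = (\<lambda>p. x i)"
      using 2 i by (auto simp: merge_def)
    ultimately show ?thesis by simp
  next
    case 3
    then have "(\<lambda>p. (case p of (t, s) \<Rightarrow> merge {1..k} {k+1..d} (x(k := t), s)) i) = (\<lambda>p. snd p i)"
      using i by (auto simp: merge_def)
    moreover have "(\<lambda>p. snd p i) \<in> measurable (mu1 \<Otimes>\<^sub>M PiM {k+1..d} (\<lambda>_. mu1)) mu1"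
      by (rule measurable_compose[OF measurable_snd measurable_component_singleton]) (use 3 i in auto)
    ultimately show ?thesis by simp
  qed
next
  show "(\<lambda>(t, s). merge {1..k} {k+1..d} (x(k := t), s)) \<in>
      space (mu1 \<Otimes>\<^sub>M PiM {k+1..d} (\<lambda>_. mu1)) \<rightarrow> (\<Pi>\<^sub>E i\<in>{1..d}. space mu1)"
    using assms by (auto simp: space_pair_measure space_PiM merge_def interval_upto_def PiE_iff extensional_def)
qed

text \<open>The convention for k = 0 agrees with the integral because the total mass is 1. The
  passage from k - 1 to k then includes k = 1.\<close>

lemma marginal_eq: "k \<le> d \<Longrightarrow> marginal d f k x = (\<integral>s. f (merge {1..k} {k+1..d} (x, s)) \<partial>mu {k+1..d})"
proof (cases "k = 0")
  case True
  have "(\<integral>s. f (merge {} {1..d} (x, s)) \<partial>mu {1..d}) = (\<integral>s. f s \<partial>mu {1..d})"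
  proof (rule Bochner_Integration.integral_cong)
    fix s assume "s \<in> space (mu {1..d})"
    then have "merge {} {1..d} (x, s) = s" by (auto simp: space_mu merge_def PiE_iff extensional_def)
    then show "f (merge {} {1..d} (x, s)) = f s" by simp
  qed simp
  then show ?thesis using True dens_facts(4) by (simp add: marginal_def)
qed (simp add: marginal_def)

lemma marginal_depends:
  assumes "\<And>j. j \<in> {1..k} \<Longrightarrow> x j = y j"
  shows "marginal d f k x = marginal d f k y"
proof -
  have "merge {1..k} {k+1..d} (x, t) = merge {1..k} {k+1..d} (y, t)" for t
    using assms by (auto simp: merge_def)
  then show ?thesis by (simp add: marginal_def)
qed

lemma merge_f_measurable:
  assumes "1 \<le> k" "k \<le> d" "interval_upto (k - 1) x"
  shows "(\<lambda>(t, s). f (merge {1..k} {k+1..d} (x(k := t), s))) \<in> borel_measurable (mu1 \<Otimes>\<^sub>M mu {k+1..d})"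
  using measurable_compose[OF merge_pair_measurable[OF assms] dens_facts(2)] by (simp add: split_beta')

lemma marginal_bounds:
  assumes "1 \<le> k" "k \<le> d" "interval_upto k x"
  shows "M \<le> marginal d f k x \<and> marginal d f k x \<le> L"
  unfolding marginal_eq[OF assms(2)]
proof (rule integral_bounds_mu)
  have x: "interval_upto (k - 1) x" "x k \<in> {-1..1}" using assms by (auto simp: interval_upto_def)
  have "(\<lambda>s. (x k, s)) \<in> measurable (mu {k+1..d}) (mu1 \<Otimes>\<^sub>M mu {k+1..d})"
    by (rule measurable_Pair1') (use x in auto)
  from measurable_compose[OF this merge_f_measurable[OF assms(1,2) x(1)]]
  show "(\<lambda>s. f (merge {1..k} {k+1..d} (x, s))) \<in> borel_measurable (mu {k+1..d})" by simp
  show "M \<le> f (merge {1..k} {k+1..d} (x, s)) \<and> f (merge {1..k} {k+1..d} (x, s)) \<le> L"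
    if "s \<in> PiE {k+1..d} (\<lambda>_. {-1..1})" for s
    by (rule dens_facts(3)) (rule merge_in_cube[OF assms(2,3) that])
qed

lemma marginal_measurable:
  assumes "1 \<le> k" "k \<le> d" "interval_upto (k - 1) x"
  shows "(\<lambda>t. marginal d f k (x(k := t))) \<in> borel_measurable mu1"
proof -
  interpret prob_space "mu {k+1..d}" by (rule prob_space_mu)
  show ?thesis
    unfolding marginal_eq[OF assms(2)] by (rule borel_measurable_lebesgue_integral) (rule merge_f_measurable[OF assms])
qed

text \<open>Fubini: integrating out coordinate k as well gives the previous marginal. Hence the
  conditional densities have mean 1 with respect to \<open>mu1\<close>.\<close>

lemma integral_marginal:
  assumes "1 \<le> k" "k \<le> d" "interval_upto (k - 1) x"
  shows "(\<integral>t. marginal d f k (x(k := t)) \<partial>mu1) = marginal d f (k - 1) x"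
proof -
  interpret S: prob_space "mu {k+1..d}" by (rule prob_space_mu)
  interpret P: pair_sigma_finite mu1 "mu {k+1..d}" by unfold_locales
  interpret PP: pair_prob_space mu1 "mu {k+1..d}" by unfold_locales
  have ins: "insert k {k+1..d} = {k..d}" using assms by auto
  have mrg: "merge {1..k-1} {k..d} (x, s(k := t)) = merge {1..k} {k+1..d} (x(k := t), s)" for s t
    using assms by (auto simp: merge_def fun_eq_iff)
  have k1: "k - 1 \<le> d" "k - 1 + 1 = k" using assms by auto
  have int: "integrable (mu1 \<Otimes>\<^sub>M mu {k+1..d}) (\<lambda>(t, s). f (merge {1..k} {k+1..d} (x(k := t), s)))"
  proof (rule PP.integrable_const_bound[where B = L])
    have "norm (f (merge {1..k} {k+1..d} (x(k := t), s))) \<le> L"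
      if "t \<in> {-1..1}" "s \<in> PiE {k+1..d} (\<lambda>_. {-1..1})" for t s
      using dens_facts(3)[OF merge_in_cube[OF assms(2) interval_upto_upd[OF assms(3) that(1)] that(2)]] dens_facts(1)
      by simp
    then show "AE p in mu1 \<Otimes>\<^sub>M mu {k+1..d}. norm (case p of (t, s) \<Rightarrow> f (merge {1..k} {k+1..d} (x(k := t), s))) \<le> L"
      by (intro AE_I2) (auto simp: space_pair_measure space_mu)
  qed (rule merge_f_measurable[OF assms])
  have meas: "(\<lambda>s. f (merge {1..k-1} {k..d} (x, s))) \<in> borel_measurable (mu {k..d})"
  proof (rule measurable_compose[OF _ dens_facts(2)])
    show "(\<lambda>s. merge {1..k-1} {k..d} (x, s)) \<in> measurable (mu {k..d}) (mu {1..d})"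
      unfolding mu_def
    proof (rule measurable_PiM_single')
      fix i assume i: "i \<in> {1..d}"
      show "(\<lambda>s. merge {1..k-1} {k..d} (x, s) i) \<in> measurable (PiM {k..d} (\<lambda>_. mu1)) mu1"
      proof (cases "i < k")
        case True
        then have "x i \<in> space mu1" using assms i by (auto simp: interval_upto_def)
        moreover have "merge {1..k-1} {k..d} (x, s) i = x i" for s
          using True i by (auto simp: merge_def)
        ultimately show ?thesis by (simp only: measurable_const)
      next
        case False
        then have "merge {1..k-1} {k..d} (x, s) i = s i" for s
          using assms i by (auto simp: merge_def)
        then show ?thesis using False i by (simp del: One_nat_def)
      qed
    next
      show "(\<lambda>s. merge {1..k-1} {k..d} (x, s)) \<in> space (PiM {k..d} (\<lambda>_. mu1)) \<rightarrow> (\<Pi>\<^sub>E i\<in>{1..d}. space mu1)"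
        using assms by (auto simp: space_PiM merge_def interval_upto_def PiE_iff extensional_def)
    qed
  qed
  have int2: "integrable (mu {k..d}) (\<lambda>s. f (merge {1..k-1} {k..d} (x, s)))"
  proof (rule integrable_mu_bounded[OF meas])
    fix s assume "s \<in> PiE {k..d} (\<lambda>_. {-1..1::real})"
    then have "merge {1..k-1} {k..d} (x, s) \<in> cube d"
      by (rule merge_in_cube[OF k1(1) assms(3), unfolded k1(2)])
    from dens_facts(3)[OF this] show "norm (f (merge {1..k-1} {k..d} (x, s))) \<le> L"
      using dens_facts(1) by simp
  qed
  have "marginal d f (k - 1) x = (\<integral>s. f (merge {1..k-1} {k..d} (x, s)) \<partial>mu {k..d})"
    unfolding marginal_eq[OF k1(1)] k1(2) ..
  also have "\<dots> = (\<integral>s. (\<integral>t. f (merge {1..k-1} {k..d} (x, s(k := t))) \<partial>mu1) \<partial>mu {k+1..d})"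
    using integral_mu_insert[of "{k+1..d}" k "\<lambda>s. f (merge {1..k-1} {k..d} (x, s))"] int2 unfolding ins by simp
  also have "\<dots> = (\<integral>t. (\<integral>s. f (merge {1..k} {k+1..d} (x(k := t), s)) \<partial>mu {k+1..d}) \<partial>mu1)"
    unfolding mrg by (rule P.Fubini_integral[OF int])
  finally show ?thesis unfolding marginal_eq[OF assms(2)] by simp
qed

lemma marginal_prev_pos:
  assumes "1 \<le> k" "k \<le> d" "interval_upto (k - 1) x"
  shows "0 < marginal d f (k - 1) x"
proof (cases "k = 1")
  case True then show ?thesis by (simp add: marginal_def)
next
  case False
  then have "1 \<le> k - 1" "k - 1 \<le> d" using assms by auto
  from marginal_bounds[OF this assms(3)] show ?thesis using dens_facts(1) by simp
qed

text \<open>Mean 1 with respect to \<open>mu1\<close> is total mass 2 with respect to dt. The range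
  {0..2} depends neither on the density nor on the preceding coordinates, and this is what makes the
  composition of one distribution function with the inverse of another meaningful.\<close>

lemma cond_cdf_facts:
  assumes "1 \<le> k" "k \<le> d" "interval_upto (k - 1) x"
  defines "G \<equiv> \<lambda>y. cond_cdf d f k (x(k := y))"
  shows "strict_mono_on {-1..1} G" "G ` {-1..1} = {0..2}"
proof -
  define m where "m = marginal d f (k - 1) x"
  define c where "c t = marginal d f k (x(k := t)) / m" for t
  have m: "0 < m" unfolding m_def by (rule marginal_prev_pos[OF assms(1-3)])
  have prev: "marginal d f (k - 1) (x(k := t)) = m" for t
    unfolding m_def by (rule marginal_depends) (use assms in auto)
  have "c \<in> borel_measurable mu1" unfolding c_def using marginal_measurable[OF assms(1-3)] by simp
  then have meas: "set_borel_measurable lborel {-1..1} c"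
    unfolding measurable_mu1 set_borel_measurable_def by (subst (asm) borel_measurable_restrict_space_iff) auto
  have bnd: "M / m \<le> c t \<and> c t \<le> L / m" if "t \<in> {-1..1}" for t
    using marginal_bounds[OF assms(1,2) interval_upto_upd[OF assms(3) that]] m
    unfolding c_def by (simp add: divide_right_mono)
  have int: "set_integrable lborel {-1..1} c"
    unfolding set_integrable_def
  proof (rule integrableI_bounded_set[where A = "{-1..1}" and B = "L / m"])
    show "AE t\<in>{-1..1} in lborel. norm (indicator {-1..1} t *\<^sub>R c t) \<le> L / m"
    proof (intro AE_I2 impI)
      fix t :: real assume t: "t \<in> {-1..1}"
      have "0 < M / m" using m dens_facts(1) by simp
      then show "norm (indicator {-1..1} t *\<^sub>R c t) \<le> L / m" using bnd[OF t] t by simp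
    qed
  qed (use meas in \<open>auto simp: set_borel_measurable_def\<close>)
  have sub: "set_integrable lborel {-1..y} c" if "y \<le> 1" for y
    by (rule set_integrable_subset[OF int]) (use that in auto)
  have G: "G y = integral {-1..y} c" if "y \<in> {-1..1}" for y
  proof -
    have "G y = (LINT t:{-1..y}|lborel. c t)"
      unfolding G_def cond_cdf_def cond_density_def fun_upd_upd fun_upd_same prev c_def ..
    also have "\<dots> = integral {-1..y} c"
      by (rule set_borel_integral_eq_integral(2)[OF sub]) (use that in auto)
    finally show ?thesis .
  qed
  have total: "integral {-1..1} c = 2"
  proof -
    have "integral {-1..1} c = (LINT t:{-1..1}|lborel. c t)"
      by (rule set_borel_integral_eq_integral(2)[OF int, symmetric])
    also have "\<dots> = 2 * (\<integral>t. c t \<partial>mu1)" by (simp add: integral_mu1[OF meas])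
    also have "(\<integral>t. c t \<partial>mu1) = 1"
      unfolding c_def using integral_marginal[OF assms(1-3)] m by (simp add: m_def)
    finally show ?thesis by simp
  qed
  have "c integrable_on {-1..1}" by (rule set_borel_integral_eq_integral(1)[OF int])
  note facts = strict_mono_indefinite_integral[OF this _ _ total, of "M / m"]
  show "strict_mono_on {-1..1} G"
    using facts(1) bnd m dens_facts(1) G unfolding strict_mono_on_def by simp
  have "G ` {-1..1} = (\<lambda>y. integral {-1..y} c) ` {-1..1}" by (rule image_cong) (use G in auto)
  then show "G ` {-1..1} = {0..2}"
    using facts(2) bnd m dens_facts(1) by simp
qed

lemma cond_cdf_depends:
  assumes "1 \<le> k" "\<And>j. j \<in> {1..k} \<Longrightarrow> x j = y j"
  shows "cond_cdf d f k x = cond_cdf d f k y"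
proof -
  have "cond_density d f k (x(k := t)) = cond_density d f k (y(k := t))" for t
    unfolding cond_density_def by (intro arg_cong2[where f = "(/)"] marginal_depends) (use assms(2) in auto)
  moreover have "x k = y k" using assms by simp
  ultimately show ?thesis by (simp add: cond_cdf_def)
qed

end

section \<open>The triangular transport map\<close>

lemma KR_vec_depends:
  assumes "density_between d M L f" "density_between d M L g" "\<And>j. j \<in> {1..k} \<Longrightarrow> x j = y j"
  shows "KR_vec d f g k x = KR_vec d f g k y"
  using assms(3)
proof (induction k)
  case (Suc k)
  then have "KR_vec d f g k x = KR_vec d f g k y" by auto
  moreover have "cond_cdf d f (Suc k) x = cond_cdf d f (Suc k) y"
    by (rule cond_cdf_depends[OF assms(1)]) (use Suc.prems in auto)
  ultimately show ?case by simp
qed simp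

lemma KR_depends:
  assumes "density_between d M L f" "density_between d M L g" "\<And>j. j \<in> {1..k} \<Longrightarrow> x j = y j"
  shows "KR d f g k x = KR d f g k y"
  using KR_vec_depends[OF assms] by (simp add: KR_def)

text \<open>Source and target distribution functions have the same range, so the value to be
  inverted is attained and \<open>inv_into\<close> returns a genuine preimage in [-1,1].\<close>

lemma KR_vec_interval:
  assumes fg: "density_between d M L f" "density_between d M L g" and "k \<le> d" "interval_upto k x"
  shows "interval_upto k (KR_vec d f g k x)"
  using assms(3,4)
proof (induction k)
  case (Suc k)
  let ?v = "KR_vec d f g k x" and ?H = "\<lambda>y. cond_cdf d g (Suc k) ((KR_vec d f g k x)(Suc k := y))"
  have v: "interval_upto (Suc k - 1) ?v" and x: "interval_upto (Suc k - 1) x" "x (Suc k) \<in> {-1..1}"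
    using Suc by (auto simp: interval_upto_def)
  have "cond_cdf d f (Suc k) x = cond_cdf d f (Suc k) (x(Suc k := x (Suc k)))" by simp
  also have "\<dots> \<in> (\<lambda>y. cond_cdf d f (Suc k) (x(Suc k := y))) ` {-1..1}" using x(2) by blast
  also have "\<dots> = ?H ` {-1..1}"
    using cond_cdf_facts(2)[OF fg(1), of "Suc k" x] cond_cdf_facts(2)[OF fg(2), of "Suc k" ?v] Suc.prems v x by simp
  finally have "inv_into {-1..1} ?H (cond_cdf d f (Suc k) x) \<in> {-1..1}" by (rule inv_into_into)
  from interval_upto_upd[OF v this] show ?case by (simp only: KR_vec.simps)
qed (simp add: interval_upto_def)

text \<open>Both distribution functions vanish at -1 and the target one is injective. This is the
  initial condition that recovers T_k from its derivative.\<close>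

lemma KR_left_end:
  assumes fg: "density_between d M L f" "density_between d M L g"
    and "1 \<le> k" "k \<le> d" "interval_upto k x" "x k = -1"
  shows "KR d f g k x = -1"
proof -
  obtain l where k: "k = Suc l" using assms(3) by (cases k) auto
  let ?v = "KR_vec d f g l x" and ?H = "\<lambda>y. cond_cdf d g (Suc l) ((KR_vec d f g l x)(Suc l := y))"
  have v: "interval_upto (Suc l - 1) ?v"
    using KR_vec_interval[OF fg, of l x] assms(4,5) k by (auto simp: interval_upto_def)
  have H: "strict_mono_on {-1..1} ?H"
    using cond_cdf_facts(1)[OF fg(2), of "Suc l" ?v] v assms(4) k by simp
  \<comment> \<open>The interval of integration degenerates to a point, so the value is 0 for every
    integrand.\<close>
  have z: "cond_cdf d h j (z(j := -1)) = 0" for h j z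
  proof -
    have "AE t in lborel. indicator {-1..-1} t *\<^sub>R c t = 0" for c :: "real \<Rightarrow> real"
      using AE_lborel_singleton[of "-1 :: real"] by eventually_elim (auto simp: indicator_def)
    then show ?thesis by (simp add: cond_cdf_def set_lebesgue_integral_def integral_eq_zero_AE)
  qed
  have "x(k := -1) = x" using assms(6) by auto
  with z[of f k x] have "cond_cdf d f k x = ?H (-1)" using z[of g "Suc l" ?v] by simp
  then have "KR d f g k x = inv_into {-1..1} ?H (?H (-1))" by (simp add: KR_def k)
  also have "\<dots> = -1" by (rule inv_into_f_f) (use strict_mono_on_imp_inj_on[OF H] in auto)
  finally show ?thesis .
qed

text \<open>The bound 1 + C_8 comes from the ball of radius C_8 around 1. The transport is real on
  the cube, so taking real parts turns the complex derivative into a real one.\<close>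

lemma KR_extension:
  assumes reg: "regularity_constants M L C\<^sub>6 C\<^sub>7 C\<^sub>8" and "1 \<le> d" "\<And>j. j \<in> {1..d} \<Longrightarrow> 0 < \<delta> j"
    and A: "assumption_A d M L \<delta> C\<^sub>6 f" "assumption_A d M L \<delta> C\<^sub>6 g" and k: "k \<in> {1..d}"
  obtains R where "holomorphic_n k (poly_nbhd k (\<lambda>j. C\<^sub>7 * \<delta> j)) R"
    "\<And>z. z \<in> poly_nbhd k (\<lambda>j. C\<^sub>7 * \<delta> j) \<Longrightarrow> norm (R z) \<le> 1 + C\<^sub>8"
    "\<And>x. x \<in> cube k \<Longrightarrow> ((\<lambda>t. KR d f g k (x(k := t))) has_vector_derivative Re (R (cemb k x))) (at (x k) within {-1..1})"
proof -
  have "\<exists>R. holomorphic_n k (poly_nbhd k (\<lambda>j. C\<^sub>7 * \<delta> j)) R \<and>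
             (\<forall>x\<in>cube k.
                ((\<lambda>t. complex_of_real (KR d f g k (x(k := t)))) has_vector_derivative R (cemb k x))
                  (at (x k) within {-1..1})) \<and>
             (\<forall>z\<in>poly_nbhd k (\<lambda>j. C\<^sub>7 * \<delta> j). R z \<in> ball 1 C\<^sub>8 \<and> 1 / C\<^sub>8 \<le> Re (R z)) \<and>
             (2 \<le> k \<longrightarrow>
                (\<forall>z\<in>PiE {1..k} (\<lambda>i. if i < k then nbhd (C\<^sub>7 * \<delta> i) cinterval else cinterval).
                   R z \<in> ball 1 (C\<^sub>8 / max 1 (\<delta> k))))"
    by (rule reg[unfolded regularity_constants_def Let_def, THEN conjunct2, THEN conjunct2, THEN conjunct2, rule_format])
       (use assms(2) A k assms(3) in auto)
  then obtain R where R: "holomorphic_n k (poly_nbhd k (\<lambda>j. C\<^sub>7 * \<delta> j)) R"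
      "\<forall>x\<in>cube k. ((\<lambda>t. complex_of_real (KR d f g k (x(k := t)))) has_vector_derivative R (cemb k x)) (at (x k) within {-1..1})"
      "\<forall>z\<in>poly_nbhd k (\<lambda>j. C\<^sub>7 * \<delta> j). R z \<in> ball 1 C\<^sub>8 \<and> 1 / C\<^sub>8 \<le> Re (R z)"
    by (elim exE conjE) (rule that)
  show thesis
  proof (rule that[OF R(1)])
    fix z assume "z \<in> poly_nbhd k (\<lambda>j. C\<^sub>7 * \<delta> j)"
    then have "R z \<in> ball 1 C\<^sub>8" using R(3) by blast
    then have "norm (R z - 1) < C\<^sub>8" by (simp add: dist_norm norm_minus_commute)
    then show "norm (R z) \<le> 1 + C\<^sub>8" using norm_triangle_ineq2[of "R z" 1] by simp
  next
    fix x assume "x \<in> cube k"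
    then have "((\<lambda>t. complex_of_real (KR d f g k (x(k := t)))) has_vector_derivative R (cemb k x)) (at (x k) within {-1..1})"
      using R(2) by blast
    from bounded_linear.has_vector_derivative[OF bounded_linear_Re this]
    show "((\<lambda>t. KR d f g k (x(k := t))) has_vector_derivative Re (R (cemb k x))) (at (x k) within {-1..1})" by simp
  qed
qed

section \<open>Weak derivatives of polynomial series\<close>

text \<open>Tychonoff in the full function space: the coordinates outside {1..k} range over the
  compact singleton containing \<open>undefined\<close>.\<close>

lemma compact_cube: "compact (cube k)"
proof -
  have "cube k = PiE UNIV (\<lambda>i. if i \<in> {1..k} then {-1..1} else {undefined})"
  proof (rule set_eqI)
    fix x :: "nat \<Rightarrow> real"
    have "x i \<in> (if i \<in> {1..k} then {-1..1} else {undefined}) \<longleftrightarrow>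
        (i \<in> {1..k} \<longrightarrow> x i \<in> {-1..1}) \<and> (i \<notin> {1..k} \<longrightarrow> x i = undefined)" for i
      by auto
    then show "x \<in> cube k \<longleftrightarrow> x \<in> PiE UNIV (\<lambda>i. if i \<in> {1..k} then {-1..1} else {undefined})"
      unfolding cube_def PiE_iff extensional_def by blast
  qed
  moreover have "compactin (product_topology (\<lambda>_. euclidean) UNIV) (PiE UNIV (\<lambda>i. if i \<in> {1..k} then {-1..1::real} else {undefined}))"
    unfolding compactin_PiE by auto
  ultimately show ?thesis by (simp add: euclidean_product_topology)
qed

lemma bounded_on_cube:
  fixes f :: "(nat \<Rightarrow> real) \<Rightarrow> 'b::real_normed_vector"
  assumes "continuous_on (cube k) f"
  obtains B where "\<forall>x\<in>cube k. norm (f x) \<le> B"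
proof -
  have "bounded (f ` cube k)"
    by (rule compact_imp_bounded[OF compact_continuous_image[OF assms compact_cube]])
  then obtain B where "\<forall>y\<in>f ` cube k. norm y \<le> B" unfolding bounded_iff by blast
  then show thesis by (intro that[of B]) auto
qed

lemma integrable_continuous_on_cube:
  fixes f :: "(nat \<Rightarrow> real) \<Rightarrow> real"
  assumes "continuous_on (cube k) f"
  shows "integrable (mu {1..k}) f"
proof -
  obtain B where "\<forall>x\<in>cube k. norm (f x) \<le> B" by (rule bounded_on_cube[OF assms])
  then show ?thesis
    by (intro integrable_mu_bounded[OF measurable_continuous_on_cube[OF assms], of B]) (simp add: cube_def)
qed

lemma continuous_on_tensor: "continuous_on S (\<lambda>x. \<Prod>j\<in>J. poly (q j :: real poly) (x j))"
  by (intro continuous_intros continuous_on_compose2[OF continuous_on_poly[OF continuous_on_id]]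
      continuous_on_subset[OF continuous_on_product_coordinates]) auto

lemma continuous_on_upd: "continuous_on S (\<lambda>t. (x :: nat \<Rightarrow> real)(i := t))"
proof (rule continuous_on_coordinatewise_then_product)
  fix j show "continuous_on S (\<lambda>t. (x(i := t)) j)" by (cases "j = i") auto
qed

section \<open>Integration by parts against test functions\<close>

abbreviation ext_space :: "nat \<Rightarrow> (nat \<Rightarrow> real) set" where
  "ext_space d \<equiv> PiE {1..d} (\<lambda>_. UNIV)"

lemma cube_subset_ext_space: "cube d \<subseteq> ext_space d"
  unfolding cube_def by (rule PiE_mono) auto

lemma ext_space_upd: "x \<in> ext_space d \<Longrightarrow> i \<in> {1..d} \<Longrightarrow> x(i := t) \<in> ext_space d"
  by (auto simp: PiE_iff extensional_def)

lemma partials_Cons: "partials (i # is) \<phi> = partial_deriv i (partials is \<phi>)"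
  by (simp add: partials_def)

lemma test_function_continuous:
  assumes "\<phi> \<in> test_functions d" "set is \<subseteq> {1..d}"
  shows "continuous_on (ext_space d) (partials is \<phi>)"
  using assms(1)[unfolded test_functions_def mem_Collect_eq, THEN conjunct1, THEN spec, THEN mp, OF assms(2)]
  by (rule conjunct1)

lemma test_function_deriv:
  assumes "\<phi> \<in> test_functions d" "set is \<subseteq> {1..d}" "i \<in> {1..d}" "x \<in> ext_space d"
  shows "((\<lambda>t. partials is \<phi> (x(i := t))) has_real_derivative partials (i # is) \<phi> (x(i := s))) (at s)"
proof -
  have "(\<lambda>t. partials is \<phi> ((x(i := s))(i := t))) field_differentiable at ((x(i := s)) i)"
    by (rule assms(1)[unfolded test_functions_def mem_Collect_eq, THEN conjunct1, THEN spec, THEN mp,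
          OF assms(2), THEN conjunct2, THEN bspec, OF assms(3), THEN bspec, OF ext_space_upd[OF assms(4,3)]])
  then have "(\<lambda>t. partials is \<phi> (x(i := t))) field_differentiable at s" by simp
  then show ?thesis
    unfolding DERIV_deriv_iff_field_differentiable[symmetric] partials_Cons partial_deriv_def by simp
qed

text \<open>A function that vanishes where some |x_i| exceeds r has all its partial derivatives zero
  there, so one \<open>r\<close> serves all orders.\<close>

lemma test_function_support:
  assumes "\<phi> \<in> test_functions d"
  obtains r where "r < 1"
    "\<forall>is x i. set is \<subseteq> {1..d} \<longrightarrow> x \<in> ext_space d \<longrightarrow> i \<in> {1..d} \<longrightarrow> r < \<bar>x i\<bar> \<longrightarrow> partials is \<phi> x = 0"
proof -
  obtain r where r: "r < 1" "\<forall>x\<in>ext_space d. (\<exists>i\<in>{1..d}. r < \<bar>x i\<bar>) \<longrightarrow> \<phi> x = 0"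
    using assms[unfolded test_functions_def mem_Collect_eq, THEN conjunct2] by (elim exE conjE) (rule that)
  have "partials is \<phi> x = 0" if "set is \<subseteq> {1..d}" "x \<in> ext_space d" "i \<in> {1..d}" "r < \<bar>x i\<bar>" for "is" x i
    using that
  proof (induction "is" arbitrary: x)
    case Nil
    then show ?case using r(2) by (auto simp: partials_def)
  next
    case (Cons j "is")
    have "deriv (\<lambda>t. partials is \<phi> (x(j := t))) (x j) = deriv (\<lambda>_. 0) (x j)"
    proof (rule deriv_cong_ev[OF _ refl])
      have IH: "partials is \<phi> (x(j := t)) = 0" if "r < \<bar>(x(j := t)) i\<bar>" for t
        by (rule Cons.IH[OF _ ext_space_upd Cons.prems(3) that]) (use Cons.prems in auto)
      show "\<forall>\<^sub>F t in nhds (x j). partials is \<phi> (x(j := t)) = 0"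
      \<comment> \<open>Moving coordinate \<open>i\<close> itself keeps the point in an open region
        of zeros; moving another coordinate does not change |x_i| at all.\<close>
      proof (cases "i = j")
        case True
        have "open {t. r < \<bar>t\<bar>}" by (intro open_Collect_less continuous_intros)
        moreover have "x j \<in> {t. r < \<bar>t\<bar>}" using Cons.prems True by simp
        ultimately have "\<forall>\<^sub>F t in nhds (x j). t \<in> {t. r < \<bar>t\<bar>}" by (rule eventually_nhds_in_open)
        then show ?thesis by eventually_elim (use IH True in auto)
      next
        case False
        then show ?thesis using IH Cons.prems by simp
      qed
    qed
    then show ?case by (simp add: partials_Cons partial_deriv_def)
  qed
  then show thesis using r(1) by (intro that[of r]) blast+
qed

text \<open>The two integrands add up to the derivative in x_i of the product, and the boundary
  terms vanish because |x_i| = 1 exceeds the radius of the support.\<close>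

lemma tensor_parts:
  assumes phi: "\<phi> \<in> test_functions d" and "is": "set is \<subseteq> {1..d}" and i: "i \<in> {1..d}"
  shows "(\<integral>x. (\<Prod>j=1..d. poly (q j) (x j)) * partials (i # is) \<phi> x \<partial>mu {1..d}) =
    - (\<integral>x. (\<Prod>j=1..d. poly ((q(i := pderiv (q i))) j) (x j)) * partials is \<phi> x \<partial>mu {1..d})"
proof -
  let ?P = "\<lambda>q x. \<Prod>j=1..d. poly (q j :: real poly) (x j)"
  let ?q' = "q(i := pderiv (q i))"
  obtain r where r: "r < 1"
    "\<forall>is x i. set is \<subseteq> {1..d} \<longrightarrow> x \<in> ext_space d \<longrightarrow> i \<in> {1..d} \<longrightarrow> r < \<bar>x i\<bar> \<longrightarrow> partials is \<phi> x = 0"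
    by (rule test_function_support[OF phi])
  have iis: "set (i # is) \<subseteq> {1..d}" using "is" i by simp
  have c0: "continuous_on (ext_space d) (partials is \<phi>)" by (rule test_function_continuous[OF phi "is"])
  have c1: "continuous_on (ext_space d) (partials (i # is) \<phi>)" by (rule test_function_continuous[OF phi iis])
  have int1: "integrable (mu {1..d}) (\<lambda>x. ?P q x * partials (i # is) \<phi> x)"
    by (intro integrable_continuous_on_cube continuous_on_mult continuous_on_tensor continuous_on_subset[OF c1] cube_subset_ext_space)
  have int2: "integrable (mu {1..d}) (\<lambda>x. ?P ?q' x * partials is \<phi> x)"
    by (intro integrable_continuous_on_cube continuous_on_mult continuous_on_tensor continuous_on_subset[OF c0] cube_subset_ext_space)
  have "(\<integral>x. ?P q x * partials (i # is) \<phi> x + ?P ?q' x * partials is \<phi> x \<partial>mu {1..d}) = (\<integral>x. 0 \<partial>mu {1..d})"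
  proof (rule integral_mu_eq_coord[OF _ i])
    fix x assume "x \<in> PiE {1..d} (\<lambda>_. {-1..1::real})"
    then have x: "x \<in> ext_space d" using cube_subset_ext_space by (auto simp: cube_def)
    define K where "K = (\<Prod>j\<in>{1..d} - {i}. poly (q j) (x j))"
    have K': "(\<Prod>j\<in>{1..d} - {i}. poly (?q' j) (x j)) = K" unfolding K_def by (rule prod.cong) auto
    let ?g = "\<lambda>t. poly (q i) t * K * partials is \<phi> (x(i := t))"
    let ?g' = "\<lambda>t. poly (q i) t * K * partials (i # is) \<phi> (x(i := t)) + poly (pderiv (q i)) t * K * partials is \<phi> (x(i := t))"
    have "(\<integral>t. ?P q (x(i := t)) * partials (i # is) \<phi> (x(i := t)) + ?P ?q' (x(i := t)) * partials is \<phi> (x(i := t)) \<partial>mu1) = (\<integral>t. ?g' t \<partial>mu1)"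
      unfolding tensor_upd[OF finite_atLeastAtMost i] K' K_def[symmetric] by simp
    also have "\<dots> = (?g 1 - ?g (-1)) / 2"
    proof (rule integral_mu1_FTC)
      fix t
      have "((\<lambda>t. poly (q i) t * K * partials is \<phi> (x(i := t))) has_real_derivative ?g' t) (at t)"
        by (auto intro!: derivative_eq_intros test_function_deriv[OF phi "is" i x] poly_DERIV)
      then show "(?g has_vector_derivative ?g' t) (at t within {-1..1})"
        unfolding has_real_derivative_iff_has_vector_derivative[symmetric] by (rule DERIV_subset) simp
      show "continuous_on {-1..1} ?g'"
        by (intro continuous_intros continuous_on_compose2[OF c1 continuous_on_upd] continuous_on_compose2[OF c0 continuous_on_upd])
           (use ext_space_upd[OF x i] in auto)
    qed
    also have "\<dots> = 0"
    proof -
      have "partials is \<phi> (x(i := 1)) = 0" "partials is \<phi> (x(i := -1)) = 0"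
        by (rule r(2)[rule_format, OF "is" ext_space_upd[OF x i] i]; use r(1) in simp)+
      then show ?thesis by simp
    qed
    finally show "(\<integral>t. ?P q (x(i := t)) * partials (i # is) \<phi> (x(i := t)) + ?P ?q' (x(i := t)) * partials is \<phi> (x(i := t)) \<partial>mu1) = (\<integral>t. 0 \<partial>mu1)"
      by simp
  qed (use int1 int2 in auto)
  then show ?thesis using Bochner_Integration.integral_add[OF int1 int2] by simp
qed

text \<open>Factors in different variables are differentiated independently, so of the list
  \<open>is\<close> only the multiplicities \<open>count_list\<close> matter.\<close>

lemma tensor_weak_deriv:
  assumes phi: "\<phi> \<in> test_functions d" and "is": "set is \<subseteq> {1..d}"
  shows "(\<integral>x. (\<Prod>j=1..d. poly (q j) (x j)) * partials is \<phi> x \<partial>mu {1..d}) =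
    (-1) ^ length is * (\<integral>x. (\<Prod>j=1..d. poly ((pderiv ^^ count_list is j) (q j)) (x j)) * \<phi> x \<partial>mu {1..d})"
  using "is"
proof (induction "is" arbitrary: q)
  case Nil
  then show ?case by (simp add: partials_def)
next
  case (Cons i "is")
  have "(pderiv ^^ count_list is j) ((q(i := pderiv (q i))) j) = (pderiv ^^ count_list (i # is) j) (q j)" for j
    by (auto simp: funpow_swap1)
  note eq = this
  have i: "i \<in> {1..d}" and "is": "set is \<subseteq> {1..d}" using Cons.prems by auto
  have "(\<integral>x. (\<Prod>j=1..d. poly (q j) (x j)) * partials (i # is) \<phi> x \<partial>mu {1..d}) =
      - ((-1) ^ length is * (\<integral>x. (\<Prod>j=1..d. poly ((pderiv ^^ count_list is j) ((q(i := pderiv (q i))) j)) (x j)) * \<phi> x \<partial>mu {1..d}))"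
    unfolding tensor_parts[OF phi "is" i] Cons.IH[OF "is"] ..
  also have "\<dots> = (-1) ^ length (i # is) *
      (\<integral>x. (\<Prod>j=1..d. poly ((pderiv ^^ count_list (i # is) j) (q j)) (x j)) * \<phi> x \<partial>mu {1..d})"
    unfolding eq by (simp del: count_list.simps)
  finally show ?case .
qed

text \<open>The constants \<open>a n * W\<close> form a summable majorant on a probability space, so
  sum and integral may be exchanged.\<close>

lemma integral_bounded_series:
  fixes F :: "nat \<Rightarrow> (nat \<Rightarrow> real) \<Rightarrow> real"
  assumes F: "\<And>n. F n \<in> borel_measurable (mu {1..d})" "\<And>n x. x \<in> cube d \<Longrightarrow> \<bar>F n x\<bar> \<le> a n" and a: "summable a"
    and psi: "\<psi> \<in> borel_measurable (mu {1..d})" "\<And>x. x \<in> cube d \<Longrightarrow> \<bar>\<psi> x\<bar> \<le> W"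
  shows "(\<lambda>n. \<integral>x. F n x * \<psi> x \<partial>mu {1..d}) sums (\<integral>x. (\<Sum>n. F n x) * \<psi> x \<partial>mu {1..d})"
proof -
  have "(\<lambda>_\<in>{1..d}. 0) \<in> cube d" by (auto simp: cube_def)
  then have W: "0 \<le> W" by (rule order_trans[OF abs_ge_zero psi(2)])
  have bnd: "norm (F n x * \<psi> x) \<le> a n * W" if "x \<in> cube d" for n x
    unfolding real_norm_def abs_mult
    by (intro mult_mono F(2) psi(2) that order_trans[OF abs_ge_zero F(2)[OF that]]) auto
  have meas: "(\<lambda>x. F n x * \<psi> x) \<in> borel_measurable (mu {1..d})" for n
    using F(1) psi(1) by (rule borel_measurable_times)
  have sa: "summable (\<lambda>n. a n * W)" using a by (rule summable_mult2)
  have eq: "(\<Sum>n. F n x * \<psi> x) = (\<Sum>n. F n x) * \<psi> x" if "x \<in> cube d" for x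
  proof (rule suminf_mult2[symmetric])
    show "summable (\<lambda>n. F n x)" by (rule summable_comparison_test'[OF a]) (use F(2)[OF that] in simp)
  qed
  have "(\<lambda>n. \<integral>x. F n x * \<psi> x \<partial>mu {1..d}) sums (\<integral>x. (\<Sum>n. F n x * \<psi> x) \<partial>mu {1..d})"
  proof (rule sums_integral)
    show "integrable (mu {1..d}) (\<lambda>x. F n x * \<psi> x)" for n
      by (rule integrable_mu_bounded[OF meas]) (rule bnd, simp add: cube_def)
    show "AE x in mu {1..d}. summable (\<lambda>n. norm (F n x * \<psi> x))"
    proof (rule AE_I2)
      fix x assume "x \<in> space (mu {1..d})"
      then have "x \<in> cube d" by (simp only: space_mu_cube)
      then show "summable (\<lambda>n. norm (F n x * \<psi> x))"
        by (intro summable_comparison_test'[OF sa]) (use bnd in simp)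
    qed
    show "summable (\<lambda>n. \<integral>x. norm (F n x * \<psi> x) \<partial>mu {1..d})"
    proof (rule summable_comparison_test'[OF sa])
      fix n
      show "norm (\<integral>x. norm (F n x * \<psi> x) \<partial>mu {1..d}) \<le> a n * W"
        by (rule norm_integral_mu_le) (use meas bnd in \<open>auto simp: cube_def\<close>)
    qed
  qed
  also have "(\<integral>x. (\<Sum>n. F n x * \<psi> x) \<partial>mu {1..d}) = (\<integral>x. (\<Sum>n. F n x) * \<psi> x \<partial>mu {1..d})"
    by (rule Bochner_Integration.integral_cong) (use eq in \<open>simp_all only: space_mu_cube\<close>)
  finally show ?thesis .
qed

lemma locally_integrable_AE_bounded:
  assumes "u \<in> borel_measurable (mu {1..d})" "AE x in mu {1..d}. \<bar>u x\<bar> \<le> B"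
  shows "locally_integrable d u"
proof -
  interpret prob_space "mu {1..d}" by (rule prob_space_mu)
  have int: "integrable (mu {1..d}) u"
    by (rule integrable_const_bound[of _ B]) (use assms in auto)
  have "PiE {1..d} (\<lambda>_. {-r..r}) \<in> sets (mu {1..d})" if "r < 1" for r :: real
    unfolding mu_def
  proof (rule sets_PiM_I_finite)
    show "{-r..r} \<in> sets mu1" unfolding sets_mu1 sets_restrict_space
      by (rule image_eqI[of _ _ "{-r..r}"]) (use that in auto)
  qed simp
  then show ?thesis
    unfolding locally_integrable_def set_integrable_def
    by (intro conjI allI impI assms(1) integrable_mult_indicator int) simp
qed

text \<open>The Euclidean norm of the j-th derivative is at most the square root of the number of
  its entries times a common bound for the entries.\<close>

definition sobolev_const :: "nat \<Rightarrow> nat \<Rightarrow> real" where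
  "sobolev_const d m = (\<Sum>j\<le>m. sqrt (card {is. set is \<subseteq> {1..d} \<and> length is = j}))"

lemma sobolev_const_nonneg: "0 \<le> sobolev_const d m"
  unfolding sobolev_const_def by (intro sum_nonneg) simp

text \<open>The termwise differentiated series are the weak derivatives. Agreement of
  \<open>u\<close> with its series almost everywhere is enough, because weak derivatives are tested
  by integrals.\<close>

lemma sobolev_norm_series:
  fixes q :: "nat \<Rightarrow> nat \<Rightarrow> real poly"
  assumes a: "summable a"
    and bound: "\<And>is n x. set is \<subseteq> {1..d} \<Longrightarrow> length is \<le> m \<Longrightarrow> x \<in> cube d \<Longrightarrow>
       \<bar>c n * (\<Prod>j=1..d. poly ((pderiv ^^ count_list is j) (q n j)) (x j))\<bar> \<le> a n"
    and u: "u \<in> borel_measurable (mu {1..d})"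
       "AE x in mu {1..d}. (\<lambda>n. c n * (\<Prod>j=1..d. poly (q n j) (x j))) sums u x"
  shows "sobolev_norm d m u \<le> ennreal (sobolev_const d m * suminf a)"
proof -
  define F where "F is n x = c n * (\<Prod>j=1..d. poly ((pderiv ^^ count_list is j) (q n j)) (x j))" for "is" n x
  define D where "D is x = (\<Sum>n. F is n x)" for "is" x
  have F_meas: "F is n \<in> borel_measurable (mu {1..d})" for "is" n
    unfolding F_def by (intro borel_measurable_times measurable_mu_tensor) simp
  have D_meas: "D is \<in> borel_measurable (mu {1..d})" for "is"
    unfolding D_def by (rule borel_measurable_suminf) (rule F_meas)
  have F_bound: "\<bar>F is n x\<bar> \<le> a n" if "set is \<subseteq> {1..d}" "length is \<le> m" "x \<in> cube d" for "is" n x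
    unfolding F_def by (rule bound[OF that])
  have D_bound: "\<bar>D is x\<bar> \<le> suminf a" if "set is \<subseteq> {1..d}" "length is \<le> m" "x \<in> cube d" for "is" x
  proof -
    have s: "summable (\<lambda>n. \<bar>F is n x\<bar>)"
      by (rule summable_comparison_test'[OF a]) (use F_bound[OF that] in simp)
    have "\<bar>D is x\<bar> \<le> (\<Sum>n. \<bar>F is n x\<bar>)" unfolding D_def by (rule summable_rabs[OF s])
    also have "\<dots> \<le> suminf a" by (rule suminf_le[OF F_bound[OF that] s a])
    finally show ?thesis .
  qed
  have cube0: "(\<lambda>_\<in>{1..d}. 0) \<in> cube d" by (auto simp: cube_def)
  have S0: "0 \<le> suminf a" by (rule order_trans[OF abs_ge_zero D_bound[OF _ _ cube0, of "[]"]]) auto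
  have uD: "AE x in mu {1..d}. u x = D [] x"
    using u(2) by eventually_elim (simp add: D_def F_def sums_iff)
  have u_bound: "AE x in mu {1..d}. \<bar>u x\<bar> \<le> suminf a"
    using uD AE_space by eventually_elim (use D_bound[of "[]"] in \<open>simp add: space_mu_cube[simplified]\<close>)
  have weak: "weak_deriv d is u (D is)" if "is": "set is \<subseteq> {1..d}" "length is \<le> m" for "is"
    unfolding weak_deriv_def
  proof (intro conjI ballI)
    show "locally_integrable d u" by (rule locally_integrable_AE_bounded[OF u(1) u_bound])
    have "AE x in mu {1..d}. \<bar>D is x\<bar> \<le> suminf a"
      by (rule AE_I2) (use D_bound[OF "is"] in \<open>simp only: space_mu_cube\<close>)
    then show "locally_integrable d (D is)" by (rule locally_integrable_AE_bounded[OF D_meas])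
    fix \<phi> assume phi: "\<phi> \<in> test_functions d"
    have c0: "continuous_on (cube d) \<phi>"
      using continuous_on_subset[OF test_function_continuous[OF phi, of "[]"] cube_subset_ext_space]
      by (simp add: partials_def)
    have c1: "continuous_on (cube d) (partials is \<phi>)"
      by (rule continuous_on_subset[OF test_function_continuous[OF phi "is"(1)] cube_subset_ext_space])
    obtain B0 where B0: "\<forall>x\<in>cube d. norm (\<phi> x) \<le> B0" by (rule bounded_on_cube[OF c0])
    obtain B1 where B1: "\<forall>x\<in>cube d. norm (partials is \<phi> x) \<le> B1" by (rule bounded_on_cube[OF c1])
    have "(\<lambda>n. \<integral>x. F [] n x * partials is \<phi> x \<partial>mu {1..d}) sums (\<integral>x. (\<Sum>n. F [] n x) * partials is \<phi> x \<partial>mu {1..d})"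
      by (rule integral_bounded_series[OF F_meas F_bound a measurable_continuous_on_cube[OF c1]]) (use B1 in auto)
    moreover have "(\<lambda>n. (-1) ^ length is * (\<integral>x. F is n x * \<phi> x \<partial>mu {1..d})) sums ((-1) ^ length is * (\<integral>x. (\<Sum>n. F is n x) * \<phi> x \<partial>mu {1..d}))"
      by (intro sums_mult integral_bounded_series[OF F_meas F_bound a measurable_continuous_on_cube[OF c0]]) (use B0 "is" in auto)
    moreover have "(\<integral>x. F [] n x * partials is \<phi> x \<partial>mu {1..d}) = (-1) ^ length is * (\<integral>x. F is n x * \<phi> x \<partial>mu {1..d})" for n
      using tensor_weak_deriv[OF phi "is"(1), of "q n"] unfolding F_def by (simp add: mult.assoc)
    ultimately have "(\<integral>x. D [] x * partials is \<phi> x \<partial>mu {1..d}) = (-1) ^ length is * (\<integral>x. D is x * \<phi> x \<partial>mu {1..d})"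
      unfolding D_def by (simp add: sums_unique2)
    moreover have "(\<integral>x. u x * partials is \<phi> x \<partial>mu {1..d}) = (\<integral>x. D [] x * partials is \<phi> x \<partial>mu {1..d})"
      by (intro integral_cong_AE borel_measurable_times u(1) D_meas measurable_continuous_on_cube[OF c1])
         (use uD in eventually_elim, simp)
    ultimately show "(\<integral>x. u x * partials is \<phi> x \<partial>mu {1..d}) = (-1) ^ length is * (\<integral>x. D is x * \<phi> x \<partial>mu {1..d})"
      by simp
  qed
  \<comment> \<open>The family \<open>D\<close> is admissible in the infimum that defines the
    norm.\<close>
  have "sobolev_norm d m u \<le> (\<Sum>j\<le>m. esssup (mu {1..d})
      (\<lambda>x. ennreal (sqrt (\<Sum>is\<in>{is. set is \<subseteq> {1..d} \<and> length is = j}. (D is x)\<^sup>2))))"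
    unfolding sobolev_norm_def by (rule INF_lower) (use weak in simp)
  also have "\<dots> \<le> (\<Sum>j\<le>m. ennreal (sqrt (card {is. set is \<subseteq> {1..d} \<and> length is = j}) * suminf a))"
  proof (rule sum_mono)
    fix j assume j: "j \<in> {..m}"
    let ?I = "{is. set is \<subseteq> {1..d} \<and> length is = j}"
    show "esssup (mu {1..d}) (\<lambda>x. ennreal (sqrt (\<Sum>is\<in>?I. (D is x)\<^sup>2))) \<le> ennreal (sqrt (card ?I) * suminf a)"
    proof (rule esssup_I)
      show "(\<lambda>x. ennreal (sqrt (\<Sum>is\<in>?I. (D is x)\<^sup>2))) \<in> borel_measurable (mu {1..d})"
        using D_meas by measurable
      show "AE x in mu {1..d}. ennreal (sqrt (\<Sum>is\<in>?I. (D is x)\<^sup>2)) \<le> ennreal (sqrt (card ?I) * suminf a)"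
      proof (intro AE_I2 ennreal_leI)
        fix x assume "x \<in> space (mu {1..d})"
        then have x: "x \<in> cube d" by (simp only: space_mu_cube)
        have "(\<Sum>is\<in>?I. (D is x)\<^sup>2) \<le> (\<Sum>is\<in>?I. (suminf a)\<^sup>2)"
        proof (rule sum_mono)
          fix "is" assume "is \<in> ?I"
          then have "\<bar>D is x\<bar> \<le> suminf a" using j by (intro D_bound x) auto
          then show "(D is x)\<^sup>2 \<le> (suminf a)\<^sup>2" using S0 by (simp add: abs_le_square_iff[symmetric])
        qed
        then have "sqrt (\<Sum>is\<in>?I. (D is x)\<^sup>2) \<le> sqrt (card ?I * (suminf a)\<^sup>2)" by simp
        then show "sqrt (\<Sum>is\<in>?I. (D is x)\<^sup>2) \<le> sqrt (card ?I) * suminf a" using S0 by (simp add: real_sqrt_mult)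
      qed
    qed
  qed
  also have "\<dots> = ennreal (\<Sum>j\<le>m. sqrt (card {is. set is \<subseteq> {1..d} \<and> length is = j}) * suminf a)"
    by (rule sum_ennreal) (use S0 in simp)
  finally show ?thesis by (simp add: sobolev_const_def sum_distrib_right)
qed

section \<open>Counting multi-indices\<close>

definition simplex_indices :: "(nat \<Rightarrow> real) \<Rightarrow> nat \<Rightarrow> real \<Rightarrow> (nat \<Rightarrow> nat) set" where
  "simplex_indices a k s = {\<nu> \<in> PiE {1..k} (\<lambda>_. UNIV). (\<Sum>j=1..k. real (\<nu> j) * a j) \<le> s}"

text \<open>The increment of t^(k+1) over an interval of length \<alpha>, compared with the
  derivative at its left end.\<close>

lemma power_Suc_diff_ge:
  fixes y \<alpha> :: real
  assumes "0 \<le> y" "0 \<le> \<alpha>"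
  shows "real (Suc k) * \<alpha> * y ^ k \<le> (y + \<alpha>) ^ Suc k - y ^ Suc k"
proof (induction k)
  case (Suc k)
  have "real (Suc (Suc k)) * \<alpha> * y ^ Suc k = y * (real (Suc k) * \<alpha> * y ^ k) + \<alpha> * y ^ Suc k"
    by (simp add: algebra_simps)
  also have "\<dots> \<le> (y + \<alpha>) * ((y + \<alpha>) ^ Suc k - y ^ Suc k) + \<alpha> * y ^ Suc k"
    by (intro add_mono mult_mono Suc) (use assms in auto)
  also have "\<dots> = (y + \<alpha>) ^ Suc (Suc k) - y ^ Suc (Suc k)" by (simp add: algebra_simps)
  finally show ?case .
qed simp

text \<open>A telescoping sum of \<open>power_Suc_diff_ge\<close>: the lower Riemann sum of the k-th
  power is bounded by the integral.\<close>

lemma sum_powers_le: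
  fixes x \<alpha> :: real
  assumes "0 \<le> \<alpha>" "real m * \<alpha> \<le> x"
  shows "(\<Sum>n\<le>m. real (Suc k) * \<alpha> * (x - real n * \<alpha>) ^ k) \<le> (x + \<alpha>) ^ Suc k - (x - real m * \<alpha>) ^ Suc k"
  using assms(2)
proof (induction m)
  case 0
  then show ?case using power_Suc_diff_ge[of x \<alpha> k] assms(1) by simp
next
  case (Suc m)
  let ?y = "x - real (Suc m) * \<alpha>"
  have "real m * \<alpha> \<le> real (Suc m) * \<alpha>" using assms(1) by (intro mult_right_mono) auto
  then have "real m * \<alpha> \<le> x" using Suc.prems by linarith
  note IH = Suc.IH[OF this]
  have "real (Suc k) * \<alpha> * ?y ^ k \<le> (?y + \<alpha>) ^ Suc k - ?y ^ Suc k"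
    by (rule power_Suc_diff_ge) (use Suc.prems assms(1) in auto)
  moreover have "?y + \<alpha> = x - real m * \<alpha>" by (simp add: algebra_simps)
  ultimately show ?case unfolding sum.atMost_Suc using IH by (simp only:)
qed

text \<open>The right side is the volume of the simplex enlarged by the sum of the a_j, which
  contains the unit cells attached to the lattice points. The proof slices by the last index, so
  that each slice is a simplex of one dimension less with a smaller bound.\<close>

lemma simplex_indices_card:
  assumes "\<And>j. j \<in> {1..k} \<Longrightarrow> 0 < a j" "0 \<le> s"
  shows "finite (simplex_indices a k s) \<and>
    real (card (simplex_indices a k s)) \<le> (s + (\<Sum>j=1..k. a j)) ^ k / (fact k * (\<Prod>j=1..k. a j))"
  using assms
proof (induction k arbitrary: s)
  case 0
  then have "simplex_indices a 0 s = {\<lambda>_. undefined}" by (auto simp: simplex_indices_def)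
  then show ?case by simp
next
  case (Suc k)
  define \<alpha> where "\<alpha> = a (Suc k)"
  define A where "A = (\<Sum>j=1..k. a j)"
  define P where "P = (\<Prod>j=1..k. a j)"
  have al: "0 < \<alpha>" using Suc.prems by (simp add: \<alpha>_def)
  have A: "0 \<le> A" unfolding A_def by (intro sum_nonneg less_imp_le Suc.prems(1)) auto
  have P: "0 < P" unfolding P_def by (intro prod_pos Suc.prems(1)) auto
  \<comment> \<open>The largest value that the last index can take.\<close>
  define m where "m = nat \<lfloor>s / \<alpha>\<rfloor>"
  have m: "real n * \<alpha> \<le> s \<longleftrightarrow> n \<le> m" for n
  proof -
    have "real n * \<alpha> \<le> s \<longleftrightarrow> real n \<le> s / \<alpha>" using al by (simp add: field_simps)
    also have "\<dots> \<longleftrightarrow> n \<le> m" using Suc.prems(2) al unfolding m_def by (simp add: le_nat_iff le_floor_iff)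
    finally show ?thesis .
  qed
  let ?S = "\<lambda>n. simplex_indices a k (s - real n * \<alpha>)"
  have IH: "finite (?S n)" "real (card (?S n)) \<le> (s - real n * \<alpha> + A) ^ k / (fact k * P)" if "n \<le> m" for n
    using Suc.IH[of "s - real n * \<alpha>"] Suc.prems(1) m[of n] that unfolding A_def P_def by auto
  have sub: "simplex_indices a (Suc k) s \<subseteq> (\<Union>n\<in>{..m}. (\<lambda>\<nu>. \<nu>(Suc k := n)) ` ?S n)"
  proof
    fix \<nu> assume "\<nu> \<in> simplex_indices a (Suc k) s"
    then have nu: "\<nu> \<in> PiE {1..Suc k} (\<lambda>_. UNIV)" "(\<Sum>j=1..k. real (\<nu> j) * a j) + real (\<nu> (Suc k)) * \<alpha> \<le> s"
      by (auto simp: simplex_indices_def \<alpha>_def)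
    have "0 \<le> (\<Sum>j=1..k. real (\<nu> j) * a j)"
      by (intro sum_nonneg mult_nonneg_nonneg) (use Suc.prems(1) in \<open>auto intro: less_imp_le\<close>)
    then have "\<nu> (Suc k) \<le> m" using nu(2) m[of "\<nu> (Suc k)"] by simp
    \<comment> \<open>Resetting the last coordinate to \<open>undefined\<close> makes the slice
      extensional on {1..k}.\<close>
    moreover have "\<nu>(Suc k := undefined) \<in> ?S (\<nu> (Suc k))"
    proof -
      have "(\<Sum>j=1..k. real ((\<nu>(Suc k := undefined)) j) * a j) = (\<Sum>j=1..k. real (\<nu> j) * a j)"
        by (rule sum.cong) auto
      then show ?thesis using nu by (auto simp: simplex_indices_def PiE_iff extensional_def)
    qed
    moreover have "\<nu> = (\<nu>(Suc k := undefined))(Suc k := \<nu> (Suc k))" by simp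
    ultimately show "\<nu> \<in> (\<Union>n\<in>{..m}. (\<lambda>\<nu>. \<nu>(Suc k := n)) ` ?S n)" by blast
  qed
  have fin: "finite (\<Union>n\<in>{..m}. (\<lambda>\<nu>. \<nu>(Suc k := n)) ` ?S n)" using IH(1) by simp
  have "real (card (simplex_indices a (Suc k) s)) \<le> real (card (\<Union>n\<in>{..m}. (\<lambda>\<nu>. \<nu>(Suc k := n)) ` ?S n))"
    using card_mono[OF fin sub] by simp
  also have "\<dots> \<le> (\<Sum>n\<le>m. real (card (?S n)))"
  proof -
    have "card (\<Union>n\<in>{..m}. (\<lambda>\<nu>. \<nu>(Suc k := n)) ` ?S n) \<le> (\<Sum>n\<le>m. card ((\<lambda>\<nu>. \<nu>(Suc k := n)) ` ?S n))"
      by (rule card_UN_le) simp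
    also have "\<dots> \<le> (\<Sum>n\<le>m. card (?S n))" by (intro sum_mono card_image_le IH(1)) simp
    finally show ?thesis by (simp flip: of_nat_sum)
  qed
  also have "\<dots> \<le> (\<Sum>n\<le>m. (s - real n * \<alpha> + A) ^ k / (fact k * P))" by (intro sum_mono IH(2)) simp
  also have "\<dots> = (\<Sum>n\<le>m. real (Suc k) * \<alpha> * (s + A - real n * \<alpha>) ^ k) / (fact (Suc k) * (P * \<alpha>))"
  proof -
    have "y / (fact k * P) = real (Suc k) * \<alpha> * y / (fact (Suc k) * (P * \<alpha>))" for y
      using al P by (simp add: divide_simps)
    moreover have "s - real n * \<alpha> + A = s + A - real n * \<alpha>" for n by simp
    ultimately show ?thesis by (simp only: sum_divide_distrib)
  qed
  also have "\<dots> \<le> (s + A + \<alpha>) ^ Suc k / (fact (Suc k) * (P * \<alpha>))"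
  proof (intro divide_right_mono)
    have le: "real m * \<alpha> \<le> s + A" using m[of m] A by simp
    then have "0 \<le> (s + A - real m * \<alpha>) ^ Suc k" by (intro zero_le_power) simp
    then show "(\<Sum>n\<le>m. real (Suc k) * \<alpha> * (s + A - real n * \<alpha>) ^ k) \<le> (s + A + \<alpha>) ^ Suc k"
      using sum_powers_le[OF less_imp_le[OF al] le, of k] by linarith
  qed (use al P in simp)
  finally have "real (card (simplex_indices a (Suc k) s)) \<le>
      (s + (\<Sum>j=1..Suc k. a j)) ^ Suc k / (fact (Suc k) * (\<Prod>j=1..Suc k. a j))"
    by (simp add: A_def P_def \<alpha>_def add.assoc)
  then show ?case using finite_subset[OF sub fin] by blast
qed

section \<open>The sets \<open>Lambda\<close> compared with lattice simplices\<close>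

lemma powi_minus_nat: "x powi (- int n) = inverse x ^ n" for x :: real
  by (simp add: power_int_minus power_inverse)

lemma Lambda_iff:
  "\<nu> \<in> Lambda r k \<epsilon> \<longleftrightarrow> \<nu> \<in> PiE {1..k} (\<lambda>_. UNIV) \<and>
    \<epsilon> \<le> inverse (r k) ^ max 1 (\<nu> k) * (\<Prod>j=1..<k. inverse (r j) ^ \<nu> j)"
  unfolding Lambda_def powi_minus_nat by simp

lemma prod_upto_last: "1 \<le> k \<Longrightarrow> (\<Prod>j=1..k. f j) = f k * (\<Prod>j=1..<k. f j)"
  for k :: nat and f :: "nat \<Rightarrow> real"
  by (cases k) (simp_all add: atLeastLessThanSuc_atLeastAtMost mult.commute)

text \<open>Replacing max{1,\<nu>_k} by \<nu>_k can only increase the weight, since 1/r_k < 1. The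
  resulting pure product weight is what the counting uses.\<close>

lemma Lambda_weight:
  assumes k: "1 \<le> k" and r: "\<And>j. j \<in> {1..k} \<Longrightarrow> 1 < r j" and "\<nu> \<in> Lambda r k \<epsilon>"
  shows "\<epsilon> \<le> (\<Prod>j=1..k. inverse (r j) ^ \<nu> j)"
proof -
  have rk: "1 < r k" using r k by simp
  have pos: "0 \<le> (\<Prod>j=1..<k. inverse (r j) ^ \<nu> j)"
  proof (intro prod_nonneg zero_le_power)
    fix j assume "j \<in> {1..<k}"
    then have "1 < r j" by (intro r) auto
    then show "0 \<le> inverse (r j)" by simp
  qed
  have "\<epsilon> \<le> inverse (r k) ^ max 1 (\<nu> k) * (\<Prod>j=1..<k. inverse (r j) ^ \<nu> j)"
    using assms(3) by (simp add: Lambda_iff)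
  also have "\<dots> \<le> inverse (r k) ^ \<nu> k * (\<Prod>j=1..<k. inverse (r j) ^ \<nu> j)"
    by (intro mult_right_mono power_decreasing pos) (use rk in \<open>auto simp: inverse_le_1_iff\<close>)
  finally show ?thesis unfolding prod_upto_last[OF k] .
qed

text \<open>The converse comparison for the truncation error: replacing max{1,\<nu>_k} by \<nu>_k
  increases the weight by at most the factor r_k.\<close>

lemma not_Lambda_weight:
  assumes k: "1 \<le> k" and r: "\<And>j. j \<in> {1..k} \<Longrightarrow> 1 < r j"
    and "\<nu> \<in> PiE {1..k} (\<lambda>_. UNIV)" "\<nu> \<notin> Lambda r k \<epsilon>"
  shows "(\<Prod>j=1..k. inverse (r j) ^ \<nu> j) \<le> \<epsilon> * r k"
proof -
  have rk: "1 < r k" using r k by simp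
  have pos: "0 \<le> (\<Prod>j=1..<k. inverse (r j) ^ \<nu> j)"
  proof (intro prod_nonneg zero_le_power)
    fix j assume "j \<in> {1..<k}"
    then have "1 < r j" by (intro r) auto
    then show "0 \<le> inverse (r j)" by simp
  qed
  have lt: "inverse (r k) ^ max 1 (\<nu> k) * (\<Prod>j=1..<k. inverse (r j) ^ \<nu> j) < \<epsilon>"
    using assms(3,4) by (simp add: Lambda_iff)
  \<comment> \<open>One factor is borrowed from r_k, because \<nu>_k + 1 \<ge>
    max{1,\<nu>_k}.\<close>
  have "inverse (r k) ^ \<nu> k = inverse (r k) ^ Suc (\<nu> k) * r k" using rk by simp
  also have "\<dots> \<le> inverse (r k) ^ max 1 (\<nu> k) * r k"
    by (intro mult_right_mono power_decreasing) (use rk in \<open>auto simp: inverse_le_1_iff\<close>)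
  finally have "inverse (r k) ^ \<nu> k * (\<Prod>j=1..<k. inverse (r j) ^ \<nu> j) \<le>
      inverse (r k) ^ max 1 (\<nu> k) * r k * (\<Prod>j=1..<k. inverse (r j) ^ \<nu> j)"
    using pos by (rule mult_right_mono)
  also have "\<dots> = inverse (r k) ^ max 1 (\<nu> k) * (\<Prod>j=1..<k. inverse (r j) ^ \<nu> j) * r k" by (simp only: mult_ac)
  also have "\<dots> \<le> \<epsilon> * r k" using lt rk by (intro mult_right_mono) auto
  finally show ?thesis unfolding prod_upto_last[OF k] .
qed

lemma prod_inverse_power_eq_exp:
  assumes "\<And>j. j \<in> J \<Longrightarrow> 0 < r j"
  shows "(\<Prod>j\<in>J. inverse (r j) ^ \<nu> j) = exp (- (\<Sum>j\<in>J. real (\<nu> j) * ln (r j)))"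
proof (cases "finite J")
  case True
  have "(\<Prod>j\<in>J. inverse (r j) ^ \<nu> j) = (\<Prod>j\<in>J. exp (- (real (\<nu> j) * ln (r j))))"
  proof (rule prod.cong[OF refl])
    fix j assume "j \<in> J"
    from assms[OF this] show "inverse (r j) ^ \<nu> j = exp (- (real (\<nu> j) * ln (r j)))"
      by (simp add: exp_minus exp_of_nat_mult power_inverse)
  qed
  then show ?thesis using True by (simp add: exp_sum sum_negf flip: sum_negf)
qed simp

text \<open>Taking logarithms makes the product condition linear. For k < d the indices are regarded
  as d-dimensional ones, so that all k obey the same bound.\<close>

lemma Lambda_card:
  assumes k: "1 \<le> k" "k \<le> d" and r: "\<And>j. j \<in> {1..d} \<Longrightarrow> 1 < r j" and eps: "0 < \<epsilon>" "\<epsilon> < 1"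
  shows "finite (Lambda r k \<epsilon>)"
    and "real (card (Lambda r k \<epsilon>)) \<le>
      (ln (1 / \<epsilon>) + (\<Sum>j=1..d. ln (r j))) ^ d / (fact d * (\<Prod>j=1..d. ln (r j)))"
proof -
  let ?S = "simplex_indices (\<lambda>j. ln (r j)) d (ln (1 / \<epsilon>))"
  \<comment> \<open>Padding by zeros leaves the weighted sum unchanged and is injective on indices
    of length k.\<close>
  let ?e = "\<lambda>\<nu> :: nat \<Rightarrow> nat. \<lambda>j\<in>{1..d}. if j \<le> k then \<nu> j else 0"
  have S: "finite ?S" "real (card ?S) \<le> (ln (1 / \<epsilon>) + (\<Sum>j=1..d. ln (r j))) ^ d / (fact d * (\<Prod>j=1..d. ln (r j)))"
    using simplex_indices_card[of d "\<lambda>j. ln (r j)" "ln (1 / \<epsilon>)", OF ln_gt_zero[OF r]] eps by simp_all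
  have inj: "inj_on ?e (Lambda r k \<epsilon>)"
  proof (rule inj_onI)
    fix \<nu> \<nu>' assume nu: "\<nu> \<in> Lambda r k \<epsilon>" "\<nu>' \<in> Lambda r k \<epsilon>" and eq: "?e \<nu> = ?e \<nu>'"
    have "\<nu> j = \<nu>' j" for j
    proof (cases "j \<in> {1..k}")
      case True
      then have "j \<in> {1..d}" "j \<le> k" using k by auto
      then show ?thesis using fun_cong[OF eq, of j] by simp
    next
      case False
      then show ?thesis using nu by (simp add: Lambda_iff PiE_iff extensional_def)
    qed
    then show "\<nu> = \<nu>'" ..
  qed
  have sub: "?e ` Lambda r k \<epsilon> \<subseteq> ?S"
  proof
    fix \<nu>' assume "\<nu>' \<in> ?e ` Lambda r k \<epsilon>"
    then obtain \<nu> where nu: "\<nu> \<in> Lambda r k \<epsilon>" "\<nu>' = ?e \<nu>" by blast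
    have "\<epsilon> \<le> (\<Prod>j=1..k. inverse (r j) ^ \<nu> j)"
      by (rule Lambda_weight[OF k(1) r nu(1)]) (use k in auto)
    also have "\<dots> = exp (- (\<Sum>j=1..k. real (\<nu> j) * ln (r j)))"
      by (rule prod_inverse_power_eq_exp) (use r k in \<open>force intro: less_trans[OF zero_less_one]\<close>)
    finally have "ln \<epsilon> \<le> ln (exp (- (\<Sum>j=1..k. real (\<nu> j) * ln (r j))))"
      using eps by (subst ln_le_cancel_iff) auto
    then have "ln \<epsilon> \<le> - (\<Sum>j=1..k. real (\<nu> j) * ln (r j))" by (simp only: ln_exp)
    moreover have "(\<Sum>j=1..d. real (\<nu>' j) * ln (r j)) = (\<Sum>j=1..k. real (\<nu> j) * ln (r j))"
      by (rule sum.mono_neutral_cong_right) (use k nu in auto)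
    ultimately have "(\<Sum>j=1..d. real (\<nu>' j) * ln (r j)) \<le> ln (1 / \<epsilon>)"
      using eps by (simp add: ln_div)
    then show "\<nu>' \<in> ?S" using nu(2) by (simp add: simplex_indices_def)
  qed
  show fin: "finite (Lambda r k \<epsilon>)"
    using finite_imageD[OF finite_subset[OF sub S(1)] inj] .
  have "card (Lambda r k \<epsilon>) \<le> card ?S" by (rule card_inj_on_le[OF inj sub S(1)])
  then show "real (card (Lambda r k \<epsilon>)) \<le>
      (ln (1 / \<epsilon>) + (\<Sum>j=1..d. ln (r j))) ^ d / (fact d * (\<Prod>j=1..d. ln (r j)))"
    using S(2) by linarith
qed

text \<open>With x = ln(1/\<epsilon>) plus the sum of the ln r_j, adding the d equal bounds gives N
  \<le> d x^d/(d! P) = (x/\<beta>)^d; this is the origin of (d-1)!. The factor exp(-\<theta> S),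
  where S is that sum, is the price of the enlarged simplex and does not depend on
  \<epsilon>.\<close>

lemma exp_card_lower_bound:
  assumes d: "1 \<le> d" and r: "\<And>j. j \<in> {1..d} \<Longrightarrow> 1 < r j" and eps: "0 < \<epsilon>" "\<epsilon> < 1"
    and beta: "\<beta> = (fact (d - 1) * (\<Prod>j=1..d. ln (r j))) powr (1 / real d)"
    and theta: "0 \<le> \<theta>" "\<beta>' \<le> \<theta> * \<beta>"
  shows "\<epsilon> powr \<theta> * exp (- \<theta> * (\<Sum>j=1..d. ln (r j))) \<le>
    exp (- \<beta>' * real (\<Sum>k=1..d. card (Lambda r k \<epsilon>)) powr (1 / real d))"
proof -
  define N where "N = real (\<Sum>k=1..d. card (Lambda r k \<epsilon>))"
  define P where "P = (\<Prod>j=1..d. ln (r j))"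
  define x where "x = ln (1 / \<epsilon>) + (\<Sum>j=1..d. ln (r j))"
  have P: "0 < P" unfolding P_def by (intro prod_pos ln_gt_zero r)
  have "0 < ln (1 / \<epsilon>)" using eps by simp
  moreover have "0 \<le> (\<Sum>j=1..d. ln (r j))" by (intro sum_nonneg less_imp_le ln_gt_zero r)
  ultimately have x: "0 < x" by (simp add: x_def)
  have b_eq: "\<beta> = (fact (d - 1) * P) powr (1 / real d)" by (simp only: beta P_def)
  then have b: "0 < \<beta>" using P by simp
  have bd: "\<beta> powr real d = fact (d - 1) * P"
    using d P unfolding b_eq by (simp add: powr_powr)
  have N0: "0 \<le> N" unfolding N_def by (rule of_nat_0_le_iff)
  have fact_d: "(fact d :: real) = real d * fact (d - 1)" using d by (simp add: fact_reduce)
  have "N = (\<Sum>k=1..d. real (card (Lambda r k \<epsilon>)))" by (simp add: N_def)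
  also have "\<dots> \<le> (\<Sum>k=1..d. x ^ d / (fact d * P))"
    unfolding x_def P_def by (intro sum_mono Lambda_card(2) r eps) auto
  also have "\<dots> = real d * (x ^ d / (fact d * P))" by simp
  also have "\<dots> = x ^ d / (fact (d - 1) * P)"
    unfolding fact_d using d P by (simp add: divide_simps)
  also have "\<dots> = (x / \<beta>) powr real d"
    using x b by (simp add: powr_divide bd powr_realpow)
  finally have "N powr (1 / real d) \<le> ((x / \<beta>) powr real d) powr (1 / real d)"
    by (intro powr_mono2) (use N0 in auto)
  also have "\<dots> = x / \<beta>" using d x b by (simp add: powr_powr)
  finally have "\<beta> * N powr (1 / real d) \<le> x" using b by (simp add: field_simps)
  then have "\<theta> * (\<beta> * N powr (1 / real d)) \<le> \<theta> * x" by (rule mult_left_mono[OF _ theta(1)])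
  moreover have "\<beta>' * N powr (1 / real d) \<le> \<theta> * \<beta> * N powr (1 / real d)"
    by (rule mult_right_mono[OF theta(2)]) simp
  ultimately have "- \<theta> * x \<le> - \<beta>' * N powr (1 / real d)" by (simp add: mult.assoc)
  moreover have "\<epsilon> powr \<theta> * exp (- \<theta> * (\<Sum>j=1..d. ln (r j))) = exp (- \<theta> * x)"
    using eps by (simp add: x_def powr_def ln_div algebra_simps flip: exp_add)
  ultimately show ?thesis by (simp add: N_def)
qed

section \<open>Summability over multi-indices\<close>

text \<open>Series over multi-indices are handled as ordinary series through one enumeration; k
  \<ge> 1 makes the index set infinite.\<close>

lemma multi_index_enumeration:
  assumes "1 \<le> k"
  obtains e :: "nat \<Rightarrow> nat \<Rightarrow> nat" where "bij_betw e UNIV (PiE {1..k} (\<lambda>_. UNIV))"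
proof
  let ?S = "PiE {1..k} (\<lambda>_. UNIV :: nat set)"
  have "infinite ?S"
  proof
    assume "finite ?S"
    moreover have "inj (\<lambda>n :: nat. \<lambda>j\<in>{1..k}. n)"
    proof (rule injI)
      fix m n assume "(\<lambda>j\<in>{1..k}. m) = (\<lambda>j\<in>{1..k}. n :: nat)"
      from fun_cong[OF this, of k] show "m = n" using assms by simp
    qed
    moreover have "range (\<lambda>n :: nat. \<lambda>j\<in>{1..k}. n) \<subseteq> ?S" by auto
    ultimately show False using finite_subset range_inj_infinite by blast
  qed
  moreover have "countable ?S" by (rule countable_PiE) auto
  ultimately show "bij_betw (from_nat_into ?S) UNIV ?S" by (rule bij_betw_from_nat_into[rotated])
qed

text \<open>Any partial sum is contained in a sum over a box, and there the sum of products
  factorizes into a product of sums.\<close>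

lemma summable_tensor:
  fixes h :: "nat \<Rightarrow> nat \<Rightarrow> real"
  assumes h: "\<And>j. j \<in> {1..k} \<Longrightarrow> summable (h j)" "\<And>j n. 0 \<le> h j n"
    and e: "inj e" "range e \<subseteq> PiE {1..k} (\<lambda>_. UNIV)"
  shows "summable (\<lambda>n. \<Prod>j=1..k. h j (e n j))"
proof (rule summableI_nonneg_bounded)
  show "0 \<le> (\<Prod>j=1..k. h j (e n j))" for n by (intro prod_nonneg h(2))
  fix N
  \<comment> \<open>The side of a box containing the first \<open>N\<close> multi-indices; inserting
    0 keeps the maximum defined for \<open>N = 0\<close>.\<close>
  define M where "M = Max (insert 0 ((\<lambda>(n, j). e n j) ` ({..<N} \<times> {1..k})))"
  have M: "e n j \<le> M" if "n < N" "j \<in> {1..k}" for n j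
    unfolding M_def by (rule Max_ge) (use that in \<open>auto intro!: image_eqI[of _ _ "(n, j)"]\<close>)
  have "(\<Sum>n<N. \<Prod>j=1..k. h j (e n j)) = (\<Sum>\<nu>\<in>e ` {..<N}. \<Prod>j=1..k. h j (\<nu> j))"
    by (subst sum.reindex) (use e in \<open>auto intro: inj_on_subset\<close>)
  also have "\<dots> \<le> (\<Sum>\<nu>\<in>PiE {1..k} (\<lambda>_. {..M}). \<Prod>j=1..k. h j (\<nu> j))"
  proof (rule sum_mono2)
    show "finite (PiE {1..k} (\<lambda>_. {..M}))" by (rule finite_PiE) auto
    show "e ` {..<N} \<subseteq> PiE {1..k} (\<lambda>_. {..M})"
    proof
      fix \<nu> assume "\<nu> \<in> e ` {..<N}"
      then obtain n where n: "n < N" "\<nu> = e n" by auto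
      then have "\<nu> \<in> PiE {1..k} (\<lambda>_. UNIV)" using e(2) by blast
      then show "\<nu> \<in> PiE {1..k} (\<lambda>_. {..M})" using M[OF n(1)] n(2) by (simp add: PiE_iff)
    qed
    show "0 \<le> (\<Prod>j=1..k. h j (\<nu> j))" for \<nu> by (intro prod_nonneg h(2))
  qed
  also have "\<dots> = (\<Prod>j=1..k. \<Sum>i\<le>M. h j i)" by (rule prod_sum_PiE[symmetric]) auto
  also have "\<dots> \<le> (\<Prod>j=1..k. suminf (h j))"
    by (intro prod_mono conjI sum_nonneg h(2) sum_le_suminf h(1)) auto
  finally show "(\<Sum>n<N. \<Prod>j=1..k. h j (e n j)) \<le> (\<Prod>j=1..k. suminf (h j))" .
qed

lemma summable_poly_geometric:
  fixes \<sigma> :: real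
  assumes "0 < \<sigma>" "\<sigma> < 1"
  shows "summable (\<lambda>n. (real n + 1) ^ p * \<sigma> ^ n)"
proof -
  define c where "c = (1 + \<sigma>) / 2"
  have c: "\<sigma> < c" "c < 1" using assms by (auto simp: c_def)
  have "(\<lambda>n. ((real n + 2) / (real n + 1)) ^ p * \<sigma>) \<longlonglongrightarrow> 1 ^ p * \<sigma>"
  proof (intro tendsto_intros)
    show "(\<lambda>n. (real n + 2) / (real n + 1)) \<longlonglongrightarrow> 1" by real_asymp
  qed
  then have "\<forall>\<^sub>F n in sequentially. ((real n + 2) / (real n + 1)) ^ p * \<sigma> < c"
    using c(1) by (intro order_tendstoD(2)) auto
  then obtain N where N: "\<And>n. n \<ge> N \<Longrightarrow> ((real n + 2) / (real n + 1)) ^ p * \<sigma> < c"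
    unfolding eventually_sequentially by blast
  show ?thesis
  proof (rule summable_ratio_test[OF c(2)])
    fix n assume "N \<le> n"
    have "(real (Suc n) + 1) ^ p * \<sigma> ^ Suc n = (((real n + 2) / (real n + 1)) ^ p * \<sigma>) * ((real n + 1) ^ p * \<sigma> ^ n)"
      by (simp add: power_divide add.commute)
    also have "\<dots> \<le> c * ((real n + 1) ^ p * \<sigma> ^ n)"
      using N[OF \<open>N \<le> n\<close>] assms by (intro mult_right_mono) auto
    finally show "norm ((real (Suc n) + 1) ^ p * \<sigma> ^ Suc n) \<le> c * norm ((real n + 1) ^ p * \<sigma> ^ n)"
      using assms by simp
  qed
qed

section \<open>Legendre coefficients\<close>

text \<open>Against a polynomial \<open>p\<close> one integrates by parts with an antiderivative of
  \<open>p\<close>, which has one degree more; hence orthogonality holds up to one degree less than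
  for the Legendre polynomial. For n = 0 and n = 1 the orthogonality claim is vacuous.\<close>

lemma legendre_antiderivative:
  obtains I where "pderiv I = legendre_normed n" "poly I 1 = 0"
    "\<forall>p. degree p < n - 1 \<longrightarrow> (\<integral>x. poly (I * p) x \<partial>mu1) = 0"
    "\<forall>x\<in>{-1..1}. \<bar>poly I x\<bar> \<le> 2 * (\<integral>t. \<bar>poly (legendre_normed n) t\<bar> \<partial>mu1)"
proof -
  obtain I where I: "pderiv I = legendre_normed n" "poly I 1 = 0" using poly_antiderivative by blast
  have "(\<integral>x. poly (I * p) x \<partial>mu1) = 0" if p: "degree p < n - 1" for p
  proof -
    \<comment> \<open>\<open>P\<close> is normalized at -1 and \<open>I\<close> at 1, so that the
      product vanishes at both ends.\<close>
    obtain P where P: "pderiv P = p" "poly P (-1) = 0" "degree P \<le> Suc (degree p)"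
      using poly_antiderivative by blast
    have "(\<integral>x. poly (I * p) x \<partial>mu1) = (\<integral>x. poly (pderiv P * I) x \<partial>mu1)" by (simp only: P(1) mult.commute[of I])
    also have "\<dots> = - (\<integral>x. poly (legendre_normed n * P) x \<partial>mu1)"
    proof -
      have "poly (P * I) 1 = 0" "poly (P * I) (-1) = 0" by (simp_all add: I(2) P(2))
      then show ?thesis
        unfolding integral_mu1_poly_parts I(1) mult.commute[of P "legendre_normed n"] by (simp del: poly_mult)
    qed
    also have "\<dots> = 0" using legendre_normed_orthogonal[of P n] P(3) p by simp
    finally show ?thesis .
  qed
  moreover have "\<bar>poly I x\<bar> \<le> 2 * (\<integral>t. \<bar>poly (legendre_normed n) t\<bar> \<partial>mu1)" if "x \<in> {-1..1}" for x
    using poly_diff_le_integral[OF that, of I] by (simp add: I)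
  ultimately show thesis using I by (intro that[of I]) auto
qed

lemma integral_abs_poly_le:
  fixes p :: "real poly"
  assumes "\<And>x. x \<in> {-1..1} \<Longrightarrow> \<bar>poly p x\<bar> \<le> c"
  shows "(\<integral>t. \<bar>poly p t\<bar> \<partial>mu1) \<le> c"
  by (rule mu1.integral_le_const) (use assms in \<open>auto intro!: integrable_mu1_continuous continuous_intros\<close>)

section \<open>A function recovered from its holomorphic derivative in the last variable\<close>

context
  fixes k :: nat and R :: "(nat \<Rightarrow> complex) \<Rightarrow> complex" and \<zeta> :: "nat \<Rightarrow> real" and B :: real
    and T :: "(nat \<Rightarrow> real) \<Rightarrow> real"
  assumes k: "1 \<le> k" and zeta: "\<And>j. j \<in> {1..k} \<Longrightarrow> 0 < \<zeta> j"
    and hol: "holomorphic_n k (poly_nbhd k \<zeta>) R"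
    and R_bound: "\<And>z. z \<in> poly_nbhd k \<zeta> \<Longrightarrow> norm (R z) \<le> B"
    and deriv: "\<And>x. x \<in> cube k \<Longrightarrow> ((\<lambda>t. T (x(k := t))) has_vector_derivative Re (R (cemb k x))) (at (x k) within {-1..1})"
    and left_end: "\<And>x. x \<in> cube k \<Longrightarrow> x k = -1 \<Longrightarrow> T x = -1"
begin

lemma k_mem: "k \<in> {1..k}"
  using k by simp

lemma cube_coord: "x \<in> cube k \<Longrightarrow> x k \<in> {-1..1}"
  using k unfolding cube_def by (auto simp: PiE_iff)

lemma ReR_continuous: "continuous_on (cube k) (\<lambda>x. Re (R (cemb k x)))"
  by (intro continuous_intros holomorphic_n_continuous[OF hol zeta])

lemma deriv_upd:
  assumes "x \<in> cube k" "v \<in> {-1..1}"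
  shows "((\<lambda>t. T (x(k := t))) has_vector_derivative Re (R (cemb k (x(k := v))))) (at v within {-1..1})"
  using deriv[OF cube_upd[OF assms(1) k_mem assms(2)]] by simp

text \<open>The fundamental theorem of calculus on the rescaled interval $[0,1]$, so that the domain of
  integration does not depend on \<open>x\<close>.\<close>

lemma T_integral:
  assumes x: "x \<in> cube k"
  shows "T x = -1 + integral (cbox 0 1) (\<lambda>s. (x k + 1) * Re (R (cemb k (x(k := -1 + s * (x k + 1))))))"
proof -
  define y where "y = x k + 1"
  have y: "0 \<le> y" "y \<le> 2" using cube_coord[OF x] by (auto simp: y_def)
  have range: "-1 + s * y \<in> {-1..1}" if "s \<in> {0..1}" for s
    using that y mult_mono[of s 1 y 2] by auto
  let ?H = "\<lambda>s. T (x(k := -1 + s * y))"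
  have "((\<lambda>s. y * Re (R (cemb k (x(k := -1 + s * y))))) has_integral ?H 1 - ?H 0) {0..1}"
  proof (rule fundamental_theorem_of_calculus)
    fix s :: real assume s: "s \<in> {0..1}"
    have 1: "((\<lambda>s. -1 + s * y) has_vector_derivative y) (at s within {0..1})"
      by (auto intro!: derivative_eq_intros simp: has_real_derivative_iff_has_vector_derivative[symmetric])
    have 2: "((\<lambda>t. T (x(k := t))) has_vector_derivative Re (R (cemb k (x(k := -1 + s * y))))) (at (-1 + s * y) within (\<lambda>s. -1 + s * y) ` {0..1})"
      by (rule has_vector_derivative_within_subset[OF deriv_upd[OF x range[OF s]]]) (use range in auto)
    show "(?H has_vector_derivative y * Re (R (cemb k (x(k := -1 + s * y))))) (at s within {0..1})"
      using vector_diff_chain_within[OF 1 2] by (simp add: o_def)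
  qed simp
  then have "integral {0..1} (\<lambda>s. y * Re (R (cemb k (x(k := -1 + s * y))))) = ?H 1 - ?H 0" by (rule integral_unique)
  moreover have "?H 1 = T x" by (simp add: y_def)
  moreover have "?H 0 = -1" using left_end[OF cube_upd[OF x k_mem, of "-1"]] by simp
  ultimately show ?thesis by (simp add: y_def)
qed

text \<open>The derivative controls \<open>T\<close> along the last coordinate only. Joint
  continuity comes from the representation by an integral over [0,1] with a jointly continuous
  integrand.\<close>

lemma T_continuous: "continuous_on (cube k) T"
proof -
  let ?m = "\<lambda>p :: (nat \<Rightarrow> real) \<times> real. (fst p)(k := -1 + snd p * (fst p k + 1))"
  have coord: "continuous_on S (\<lambda>p :: (nat \<Rightarrow> real) \<times> real. fst p j)" for S j
    by (rule continuous_on_compose2[OF continuous_on_product_coordinates continuous_on_fst[OF continuous_on_id]]) auto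
  have m_cont: "continuous_on S ?m" for S
  proof (rule continuous_on_coordinatewise_then_product)
    fix j show "continuous_on S (\<lambda>p. ?m p j)"
    proof (cases "j = k")
      case True
      then show ?thesis by (simp, intro continuous_intros coord)
    next
      case False
      then show ?thesis using coord by simp
    qed
  qed
  have m_range: "?m ` (cube k \<times> cbox 0 1) \<subseteq> cube k"
  proof
    fix z assume "z \<in> ?m ` (cube k \<times> cbox 0 1)"
    then obtain x s where xs: "x \<in> cube k" "s \<in> {0..1::real}" "z = x(k := -1 + s * (x k + 1))" by auto
    have "-1 + s * (x k + 1) \<in> {-1..1}"
      using xs(2) cube_coord[OF xs(1)] mult_mono[of s 1 "x k + 1" 2] by auto
    then show "z \<in> cube k" unfolding xs(3) by (rule cube_upd[OF xs(1) k_mem])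
  qed
  have "continuous_on (cube k \<times> cbox 0 1) (\<lambda>p. (fst p k + 1) * Re (R (cemb k (?m p))))"
    by (intro continuous_intros coord continuous_on_compose2[OF ReR_continuous m_cont m_range])
  then have "continuous_on (cube k) (\<lambda>x. integral (cbox 0 1) (\<lambda>s. (x k + 1) * Re (R (cemb k (x(k := -1 + s * (x k + 1)))))))"
    by (intro integral_continuous_on_param) (simp add: split_beta')
  then have "continuous_on (cube k) (\<lambda>x. -1 + integral (cbox 0 1) (\<lambda>s. (x k + 1) * Re (R (cemb k (x(k := -1 + s * (x k + 1)))))))"
    by (intro continuous_intros)
  then show ?thesis by (rule continuous_on_eq) (simp add: T_integral)
qed

text \<open>T + 1 vanishes at x_k = -1 and \<open>I\<close> vanishes at x_k = 1, so no boundary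
  terms remain. This is the reason for adding 1.\<close>

lemma T_parts:
  assumes I: "pderiv I = q k" "poly I 1 = 0"
  shows "(\<integral>x. (T x + 1) * (\<Prod>j=1..k. poly (q j) (x j)) \<partial>mu {1..k}) =
    - (\<integral>x. Re (R (cemb k x)) * (\<Prod>j=1..k. poly ((q(k := I)) j) (x j)) \<partial>mu {1..k})"
proof -
  let ?P = "\<lambda>q x. \<Prod>j=1..k. poly (q j :: real poly) (x j)"
  let ?g = "\<lambda>x. Re (R (cemb k x))"
  let ?q' = "q(k := I)"
  have int1: "integrable (mu {1..k}) (\<lambda>x. (T x + 1) * ?P q x)"
    by (intro integrable_continuous_on_cube continuous_intros T_continuous continuous_on_tensor)
  have int2: "integrable (mu {1..k}) (\<lambda>x. ?g x * ?P ?q' x)"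
    by (intro integrable_continuous_on_cube continuous_on_mult ReR_continuous continuous_on_tensor)
  have "(\<integral>x. (T x + 1) * ?P q x + ?g x * ?P ?q' x \<partial>mu {1..k}) = (\<integral>x. 0 \<partial>mu {1..k})"
  proof (rule integral_mu_eq_coord[OF _ k_mem])
    fix x assume "x \<in> PiE {1..k} (\<lambda>_. {-1..1::real})"
    then have x: "x \<in> cube k" by (simp add: cube_def)
    define K where "K = (\<Prod>j\<in>{1..k} - {k}. poly (q j) (x j))"
    have K': "(\<Prod>j\<in>{1..k} - {k}. poly (?q' j) (x j)) = K" unfolding K_def by (rule prod.cong) auto
    let ?F = "\<lambda>t. (T (x(k := t)) + 1) * poly I t * K"
    let ?F' = "\<lambda>t. ((T (x(k := t)) + 1) * poly (q k) t + ?g (x(k := t)) * poly I t) * K"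
    have "(\<integral>t. (T (x(k := t)) + 1) * ?P q (x(k := t)) + ?g (x(k := t)) * ?P ?q' (x(k := t)) \<partial>mu1) = (\<integral>t. ?F' t \<partial>mu1)"
      unfolding tensor_upd[OF finite_atLeastAtMost k_mem] K' K_def[symmetric] by (simp add: algebra_simps)
    also have "\<dots> = (?F 1 - ?F (-1)) / 2"
    proof (rule integral_mu1_FTC)
      fix t :: real assume t: "t \<in> {-1..1}"
      have d: "((\<lambda>t. T (x(k := t))) has_real_derivative ?g (x(k := t))) (at t within {-1..1})"
        unfolding has_real_derivative_iff_has_vector_derivative by (rule deriv_upd[OF x t])
      have "(poly I has_real_derivative poly (q k) t) (at t within {-1..1})"
        unfolding I(1)[symmetric] by (rule DERIV_subset[OF poly_DERIV]) simp
      then have "(?F has_real_derivative ?F' t) (at t within {-1..1})"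
        by (auto intro!: derivative_eq_intros d simp: algebra_simps I(1))
      then show "(?F has_vector_derivative ?F' t) (at t within {-1..1})"
        unfolding has_real_derivative_iff_has_vector_derivative .
    next
      show "continuous_on {-1..1} ?F'"
        by (intro continuous_intros continuous_on_compose2[OF T_continuous continuous_on_upd] continuous_on_compose2[OF ReR_continuous continuous_on_upd])
           (use cube_upd[OF x k_mem] in auto)
    qed
    also have "\<dots> = 0"
      using left_end[OF cube_upd[OF x k_mem, of "-1"]] I(2) by simp
    finally show "(\<integral>t. (T (x(k := t)) + 1) * ?P q (x(k := t)) + ?g (x(k := t)) * ?P ?q' (x(k := t)) \<partial>mu1) = (\<integral>t. 0 \<partial>mu1)"
      by simp
  qed (use int1 int2 in auto)
  then show ?thesis using Bochner_Integration.integral_add[OF int1 int2] by simp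
qed

text \<open>Write T = (T + 1) - 1. The first part is moved to the derivative by
  \<open>T_parts\<close> and estimated through the holomorphic extension; the constant has a nonzero
  coefficient only for \<nu> = 0.\<close>

lemma legendre_coeff_decay:
  assumes rho: "\<And>j. j \<in> {1..k} \<Longrightarrow> 1 < \<rho> j" "\<And>j. j \<in> {1..k} \<Longrightarrow> \<rho> j < 1 + \<zeta> j"
  shows "\<exists>K>0. \<exists>a. \<forall>\<nu>. \<bar>legendre_coeff k T \<nu>\<bar> \<le> K * (\<Prod>j=1..k. (real (\<nu> j) + 1) ^ a * inverse (\<rho> j) ^ \<nu> j)"
proof -
  obtain Cb a where Cb: "Cb > 0" "\<forall>n. \<forall>x\<in>{-1..1}. \<bar>poly (legendre_normed n) x\<bar> \<le> Cb * (real n + 1) ^ a"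
    using legendre_higher_bound[of 0] by auto
  obtain C where C: "C > 0" "\<forall>h B n q b.
    (\<forall>z\<in>poly_nbhd k \<zeta>. \<forall>j\<in>{1..k}. (\<lambda>s. h (z(j := s))) holomorphic_on nbhd (\<zeta> j) cinterval) \<longrightarrow>
    (\<forall>z\<in>poly_nbhd k \<zeta>. norm (h z) \<le> B) \<longrightarrow>
    (\<lambda>x. h (cemb k x)) \<in> borel_measurable (mu {1..k}) \<longrightarrow>
    (\<forall>j\<in>{1..k}. \<forall>p. degree p < n j \<longrightarrow> (\<integral>x. poly (q j * p) x \<partial>mu1) = 0) \<longrightarrow>
    (\<forall>j\<in>{1..k}. \<forall>x\<in>{-1..1}. \<bar>poly (q j) x\<bar> \<le> b j) \<longrightarrow>
    norm (\<integral>x. h (cemb k x) * of_real (\<Prod>j=1..k. poly (q j) (x j)) \<partial>mu {1..k}) \<le>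
      C * B * (\<Prod>j=1..k. b j / \<rho> j ^ n j)"
    by (rule exE[OF tensor_coefficient_bound[of k \<rho> \<zeta>]], erule rho(1), erule rho(2), elim conjE, rule that)
  have R_cont: "continuous_on (cube k) (\<lambda>x. R (cemb k x))" by (rule holomorphic_n_continuous[OF hol zeta])
  have R_meas: "(\<lambda>x. R (cemb k x)) \<in> borel_measurable (mu {1..k})" by (rule measurable_continuous_on_cube[OF R_cont])
  have rhok: "1 < \<rho> k" by (rule rho(1)[OF k_mem])
  have cube0: "(\<lambda>_\<in>{1..k}. 0) \<in> cube k" by (auto simp: cube_def)
  have B0: "0 \<le> B" by (rule order_trans[OF norm_ge_zero R_bound[OF cemb_in_poly_nbhd[OF cube0 zeta]]])
  \<comment> \<open>The 2 bounds the antiderivative, \<rho>_k pays for its lost degree,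
    \<open>Cb ^ k\<close> collects the Legendre bounds, and the final 1 covers the constant
    function.\<close>
  define K where "K = C * B * (2 * \<rho> k) * Cb ^ k + 1"
  define W where "W \<nu> = (\<Prod>j=1..k. (real (\<nu> j) + 1) ^ a * inverse (\<rho> j) ^ \<nu> j)" for \<nu> :: "nat \<Rightarrow> nat"
  have K: "0 < K" unfolding K_def using C(1) B0 rhok Cb(1) by (intro add_nonneg_pos mult_nonneg_nonneg zero_le_power) auto
  have W0: "0 \<le> W \<nu>" for \<nu>
    unfolding W_def by (intro prod_nonneg mult_nonneg_nonneg zero_le_power) (use rho(1) in \<open>auto intro: less_imp_le[OF less_trans[OF zero_less_one]]\<close>)
  have "\<bar>legendre_coeff k T \<nu>\<bar> \<le> K * W \<nu>" for \<nu>
  proof -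
    obtain I where I: "pderiv I = legendre_normed (\<nu> k)" "poly I 1 = 0"
      "\<forall>p. degree p < \<nu> k - 1 \<longrightarrow> (\<integral>x. poly (I * p) x \<partial>mu1) = 0"
      "\<forall>x\<in>{-1..1}. \<bar>poly I x\<bar> \<le> 2 * (\<integral>t. \<bar>poly (legendre_normed (\<nu> k)) t\<bar> \<partial>mu1)"
      by (rule legendre_antiderivative)
    define q where "q j = legendre_normed (\<nu> j)" for j
    \<comment> \<open>One degree less in the last variable, where the factor is the antiderivative;
      truncated subtraction gives 0 for \<nu>_k = 0.\<close>
    define n where "n j = (if j = k then \<nu> k - 1 else \<nu> j)" for j
    define b where "b j = (if j = k then 2 else 1) * (Cb * (real (\<nu> j) + 1) ^ a)" for j
    let ?q' = "q(k := I)"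
    have Lbound: "\<bar>poly (legendre_normed m) x\<bar> \<le> Cb * (real m + 1) ^ a" if "x \<in> {-1..1}" for m x
      using Cb(2) that by blast
    have b_bound: "\<bar>poly (?q' j) x\<bar> \<le> b j" if x: "x \<in> {-1..1}" for j x
    proof (cases "j = k")
      case True
      have "\<bar>poly I x\<bar> \<le> 2 * (\<integral>t. \<bar>poly (legendre_normed (\<nu> k)) t\<bar> \<partial>mu1)" using I(4) x by blast
      also have "\<dots> \<le> 2 * (Cb * (real (\<nu> k) + 1) ^ a)" by (intro mult_left_mono integral_abs_poly_le Lbound) auto
      finally show ?thesis using True by (simp add: b_def)
    qed (use Lbound x in \<open>simp add: q_def b_def\<close>)
    have orth: "(\<integral>x. poly (?q' j * p) x \<partial>mu1) = 0" if "degree p < n j" for j p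
    proof (cases "j = k")
      case True then show ?thesis using I(3) that by (simp add: n_def)
    next
      case False
      then show ?thesis using legendre_normed_orthogonal[of p "\<nu> j"] that by (simp add: n_def q_def)
    qed
    have "norm (\<integral>x. R (cemb k x) * of_real (\<Prod>j=1..k. poly (?q' j) (x j)) \<partial>mu {1..k}) \<le>
        C * B * (\<Prod>j=1..k. b j / \<rho> j ^ n j)"
    proof (rule C(2)[rule_format, where h = R and q = "?q'"])
    qed ((rule holomorphic_n_separately[OF hol] R_bound R_meas orth b_bound; assumption)+)
    also have "\<dots> \<le> C * B * (2 * \<rho> k * Cb ^ k * W \<nu>)"
    proof (intro mult_left_mono)
      have each: "b j / \<rho> j ^ n j \<le> (if j = k then 2 * \<rho> k else 1) * (Cb * ((real (\<nu> j) + 1) ^ a * inverse (\<rho> j) ^ \<nu> j))"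
        and pos: "0 \<le> b j / \<rho> j ^ n j" if j: "j \<in> {1..k}" for j
      proof -
        have r: "1 < \<rho> j" by (rule rho(1)[OF j])
        show "0 \<le> b j / \<rho> j ^ n j" using r Cb(1) by (simp add: b_def)
        show "b j / \<rho> j ^ n j \<le> (if j = k then 2 * \<rho> k else 1) * (Cb * ((real (\<nu> j) + 1) ^ a * inverse (\<rho> j) ^ \<nu> j))"
        proof (cases "j = k")
          case False
          then show ?thesis by (simp add: b_def n_def power_inverse divide_inverse)
        next
          case True
          \<comment> \<open>An equality for \<nu>_k \<ge> 1; for \<nu>_k = 0 it is 1 \<le>
            \<rho>_k.\<close>
          have "inverse (\<rho> k ^ (\<nu> k - 1)) \<le> \<rho> k * inverse (\<rho> k) ^ \<nu> k"
            using rhok by (cases "\<nu> k") (auto simp: power_inverse)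
          then have "2 * (Cb * (real (\<nu> k) + 1) ^ a) * inverse (\<rho> k ^ (\<nu> k - 1)) \<le>
              2 * (Cb * (real (\<nu> k) + 1) ^ a) * (\<rho> k * inverse (\<rho> k) ^ \<nu> k)"
            using Cb(1) by (intro mult_left_mono) auto
          then show ?thesis using True by (simp add: b_def n_def divide_inverse mult_ac)
        qed
      qed
      have "(\<Prod>j=1..k. b j / \<rho> j ^ n j) \<le> (\<Prod>j=1..k. (if j = k then 2 * \<rho> k else 1) * (Cb * ((real (\<nu> j) + 1) ^ a * inverse (\<rho> j) ^ \<nu> j)))"
        by (rule prod_mono) (use each pos in blast)
      also have "\<dots> = 2 * \<rho> k * Cb ^ k * W \<nu>"
        unfolding prod.distrib W_def using k_mem by simp
      finally show "(\<Prod>j=1..k. b j / \<rho> j ^ n j) \<le> 2 * \<rho> k * Cb ^ k * W \<nu>" .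
      show "0 \<le> C * B" using C(1) B0 by simp
    qed
    finally have main: "norm (\<integral>x. R (cemb k x) * of_real (\<Prod>j=1..k. poly (?q' j) (x j)) \<partial>mu {1..k}) \<le> (K - 1) * W \<nu>"
      by (simp add: K_def mult_ac)
    have Re_int: "(\<integral>x. Re (R (cemb k x)) * (\<Prod>j=1..k. poly (?q' j) (x j)) \<partial>mu {1..k}) =
        Re (\<integral>x. R (cemb k x) * of_real (\<Prod>j=1..k. poly (?q' j) (x j)) \<partial>mu {1..k})"
    proof -
      have c: "continuous_on (cube k) (\<lambda>x. R (cemb k x) * of_real (\<Prod>j=1..k. poly (?q' j) (x j)))"
        by (intro continuous_on_mult R_cont continuous_on_of_real continuous_on_tensor)
      obtain D where "\<forall>x\<in>cube k. norm (R (cemb k x) * of_real (\<Prod>j=1..k. poly (?q' j) (x j))) \<le> D"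
        by (rule bounded_on_cube[OF c])
      then have "integrable (mu {1..k}) (\<lambda>x. R (cemb k x) * of_real (\<Prod>j=1..k. poly (?q' j) (x j)))"
        by (intro integrable_mu_bounded[OF measurable_continuous_on_cube[OF c], of D]) (simp add: cube_def)
      then have "(\<integral>x. Re (R (cemb k x) * of_real (\<Prod>j=1..k. poly (?q' j) (x j))) \<partial>mu {1..k}) =
          Re (\<integral>x. R (cemb k x) * of_real (\<Prod>j=1..k. poly (?q' j) (x j)) \<partial>mu {1..k})"
        by (rule integral_Re)
      moreover have "Re (z * of_real y) = Re z * y" for z y by simp
      ultimately show ?thesis by (simp only:)
    qed
    have U: "\<bar>\<integral>x. (T x + 1) * (\<Prod>j=1..k. poly (q j) (x j)) \<partial>mu {1..k}\<bar> \<le> (K - 1) * W \<nu>"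
      using order_trans[OF abs_Re_le_cmod main] T_parts[of I q] I(1,2) unfolding q_def[symmetric] Re_int[symmetric] by simp
    \<comment> \<open>By orthogonality to the constants the product of the one-dimensional integrals
      is 1 or 0, in each factor at most the weight.\<close>
    have one: "\<bar>\<integral>x. (\<Prod>j=1..k. poly (q j) (x j)) \<partial>mu {1..k}\<bar> \<le> 1 * W \<nu>"
    proof -
      have "(\<integral>x. (\<Prod>j=1..k. poly (q j) (x j)) \<partial>mu {1..k}) = (\<Prod>j=1..k. \<integral>t. poly (q j) t \<partial>mu1)"
        by (rule integral_mu_prod) auto
      moreover have "(\<integral>t. poly (q j) t \<partial>mu1) = (if \<nu> j = 0 then 1 else 0)" for j
        using legendre_orthonormal[of "\<nu> j" 0] by (simp add: q_def legendre_eq_poly legendre_normed_0)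
      ultimately have "\<bar>\<integral>x. (\<Prod>j=1..k. poly (q j) (x j)) \<partial>mu {1..k}\<bar> = (\<Prod>j=1..k. if \<nu> j = 0 then 1 else 0)"
        by (simp add: abs_prod if_distrib cong: if_cong)
      also have "\<dots> \<le> W \<nu>"
        unfolding W_def
      proof (rule prod_mono)
        fix j assume "j \<in> {1..k}"
        then have "1 < \<rho> j" by (rule rho(1))
        then show "0 \<le> (if \<nu> j = 0 then 1 else (0::real)) \<and> (if \<nu> j = 0 then 1 else (0::real)) \<le> (real (\<nu> j) + 1) ^ a * inverse (\<rho> j) ^ \<nu> j"
          by auto
      qed
      finally show ?thesis by simp
    qed
    have "legendre_coeff k T \<nu> = (\<integral>x. (T x + 1) * (\<Prod>j=1..k. poly (q j) (x j)) - (\<Prod>j=1..k. poly (q j) (x j)) \<partial>mu {1..k})"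
      unfolding legendre_coeff_def legendre_prod_def legendre_eq_poly q_def by (simp add: algebra_simps)
    also have "\<dots> = (\<integral>x. (T x + 1) * (\<Prod>j=1..k. poly (q j) (x j)) \<partial>mu {1..k}) - (\<integral>x. (\<Prod>j=1..k. poly (q j) (x j)) \<partial>mu {1..k})"
      by (intro Bochner_Integration.integral_diff integrable_continuous_on_cube continuous_intros T_continuous continuous_on_tensor)
    finally have "\<bar>legendre_coeff k T \<nu>\<bar> \<le> (K - 1) * W \<nu> + 1 * W \<nu>" using U one by linarith
    then show ?thesis by (simp add: algebra_simps)
  qed
  then show ?thesis using K unfolding W_def by blast
qed

end

section \<open>Completeness of the Legendre products\<close>

text \<open>The algebra for the Stone-Weierstrass theorem, presented as sums of products so that
  orthogonality to products extends to it by induction.\<close>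

inductive tensor_sum :: "nat \<Rightarrow> ((nat \<Rightarrow> real) \<Rightarrow> real) \<Rightarrow> bool" for k where
  tensor: "tensor_sum k (\<lambda>x. \<Prod>j=1..k. poly (q j :: real poly) (x j))"
| add: "tensor_sum k f \<Longrightarrow> tensor_sum k g \<Longrightarrow> tensor_sum k (\<lambda>x. f x + g x)"

lemma tensor_sum_tensor_mult:
  assumes "tensor_sum k f"
  shows "tensor_sum k (\<lambda>x. (\<Prod>j=1..k. poly (q j :: real poly) (x j)) * f x)"
  using assms
proof induction
  case (tensor p)
  have "(\<lambda>x. (\<Prod>j=1..k. poly (q j) (x j)) * (\<Prod>j=1..k. poly (p j) (x j))) = (\<lambda>x. \<Prod>j=1..k. poly (q j * p j) (x j))"
    by (simp add: prod.distrib)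
  then show ?case using tensor_sum.tensor[of k "\<lambda>j. q j * p j"] by simp
next
  case (add f g)
  from tensor_sum.add[OF add.IH] show ?case by (simp add: distrib_left)
qed

lemma tensor_sum_mult:
  assumes "tensor_sum k f" "tensor_sum k g"
  shows "tensor_sum k (\<lambda>x. f x * g x)"
  using assms(1)
proof induction
  case (tensor p)
  show ?case by (rule tensor_sum_tensor_mult[OF assms(2)])
next
  case (add f1 f2)
  from tensor_sum.add[OF add.IH] show ?case by (simp add: distrib_right)
qed

lemma tensor_sum_continuous: "tensor_sum k f \<Longrightarrow> continuous_on S f"
  by (induction rule: tensor_sum.induct) (auto intro: continuous_on_tensor continuous_on_add)

lemma tensor_sum_single:
  assumes "i \<in> {1..k}"
  shows "tensor_sum k (\<lambda>x. poly p (x i))"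
proof -
  have "(\<lambda>x. \<Prod>j=1..k. poly (if j = i then p else 1) (x j)) = (\<lambda>x. poly p (x i))"
  proof
    fix x :: "nat \<Rightarrow> real"
    have "(\<Prod>j=1..k. poly (if j = i then p else 1) (x j)) = (\<Prod>j=1..k. if j = i then poly p (x i) else 1)"
      by (rule prod.cong) auto
    then show "(\<Prod>j=1..k. poly (if j = i then p else 1) (x j)) = poly p (x i)" using assms by simp
  qed
  then show ?thesis using tensor_sum.tensor[of k "\<lambda>j. if j = i then p else 1"] by simp
qed

lemma tensor_sum_approx:
  assumes k: "1 \<le> k" and f: "continuous_on (cube k) f" and e: "0 < e"
  shows "\<exists>g. tensor_sum k g \<and> (\<forall>x\<in>cube k. \<bar>f x - g x\<bar> < e)"
proof (rule Stone_Weierstrass_HOL[OF compact_cube _ _ _ _ _ f e])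
  show "tensor_sum k (\<lambda>x. c)" for c
    using tensor_sum_single[of 1 k "[:c:]"] k by simp
  show "\<exists>f. tensor_sum k f \<and> f x \<noteq> f y" if xy: "x \<in> cube k \<and> y \<in> cube k \<and> x \<noteq> y" for x y
  proof -
    \<comment> \<open>Points of the cube agree outside {1..k}, so a coordinate that separates them
      is available to the algebra.\<close>
    from xy obtain j where j: "x j \<noteq> y j" by blast
    have "j \<in> {1..k}"
    proof (rule ccontr)
      assume "j \<notin> {1..k}"
      then show False using xy j by (auto simp: cube_def PiE_iff extensional_def)
    qed
    then show ?thesis using tensor_sum_single[of j k "[:0, 1:]"] j by auto
  qed
qed (auto intro: tensor_sum_continuous tensor_sum.add tensor_sum_mult)

text \<open>The factors are expanded in the Legendre basis one at a time, until only products of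
  Legendre polynomials are left.\<close>

lemma orthogonal_to_tensors:
  assumes D: "continuous_on (cube k) D"
    and orth: "\<And>\<nu>. \<nu> \<in> PiE {1..k} (\<lambda>_. UNIV) \<Longrightarrow> (\<integral>x. D x * legendre_prod k \<nu> x \<partial>mu {1..k}) = 0"
  shows "(\<integral>x. D x * (\<Prod>j=1..k. poly (q j) (x j)) \<partial>mu {1..k}) = 0"
proof -
  \<comment> \<open>\<open>m\<close> counts the leading factors that are still arbitrary
    polynomials; the factors beyond \<open>m\<close> are already Legendre polynomials.\<close>
  have "(\<integral>x. D x * (\<Prod>j=1..k. poly (q j) (x j)) \<partial>mu {1..k}) = 0"
    if "m \<le> k" "\<forall>j\<in>{m<..k}. \<exists>n. q j = legendre_normed n" for m q
    using that
  proof (induction m arbitrary: q)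
    case 0
    then have "\<forall>j\<in>{1..k}. \<exists>n. q j = legendre_normed n" by auto
    then obtain \<nu> where nu: "\<forall>j\<in>{1..k}. q j = legendre_normed (\<nu> j)" by (rule bchoice[THEN exE])
    define \<nu>' where "\<nu>' = restrict \<nu> {1..k}"
    have "(\<Prod>j=1..k. poly (q j) (x j)) = legendre_prod k \<nu>' x" for x
      unfolding legendre_prod_def legendre_eq_poly by (rule prod.cong) (use nu in \<open>auto simp: \<nu>'_def\<close>)
    then show ?case using orth[of \<nu>'] by (simp add: \<nu>'_def)
  next
    case (Suc m)
    let ?j = "Suc m"
    have j: "?j \<in> {1..k}" using Suc.prems by simp
    from legendre_basis[OF order.refl] obtain c where c: "q ?j = (\<Sum>n\<le>degree (q ?j). smult (c n) (legendre_normed n))" by blast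
    let ?q = "\<lambda>n. q(?j := legendre_normed n)"
    have expand: "(\<Prod>j=1..k. poly (q j) (x j)) = (\<Sum>n\<le>degree (q ?j). c n * (\<Prod>j=1..k. poly (?q n j) (x j)))" for x
    proof -
      let ?r = "\<Prod>j\<in>{1..k} - {?j}. poly (q j) (x j)"
      have r: "(\<Prod>j=1..k. poly (?q n j) (x j)) = poly (legendre_normed n) (x ?j) * ?r" for n
      proof -
        have "(\<Prod>j=1..k. poly (?q n j) (x j)) = poly (?q n ?j) (x ?j) * (\<Prod>j\<in>{1..k} - {?j}. poly (?q n j) (x j))"
          by (rule prod.remove) (use j in auto)
        also have "(\<Prod>j\<in>{1..k} - {?j}. poly (?q n j) (x j)) = ?r" by (rule prod.cong) auto
        finally show ?thesis by simp
      qed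
      have "(\<Prod>j=1..k. poly (q j) (x j)) = poly (q ?j) (x ?j) * ?r"
        by (rule prod.remove) (use j in auto)
      also have "poly (q ?j) (x ?j) = (\<Sum>n\<le>degree (q ?j). c n * poly (legendre_normed n) (x ?j))"
        by (subst c) (simp add: poly_sum)
      finally show ?thesis unfolding r by (simp add: sum_distrib_right mult.assoc)
    qed
    have int: "integrable (mu {1..k}) (\<lambda>x. c n * (D x * (\<Prod>j=1..k. poly (?q n j) (x j))))" for n
      by (intro integrable_continuous_on_cube continuous_on_mult D continuous_on_tensor continuous_on_const)
    have "(\<integral>x. D x * (\<Prod>j=1..k. poly (q j) (x j)) \<partial>mu {1..k}) =
        (\<integral>x. (\<Sum>n\<le>degree (q ?j). c n * (D x * (\<Prod>j=1..k. poly (?q n j) (x j)))) \<partial>mu {1..k})"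
      by (rule Bochner_Integration.integral_cong) (simp_all only: expand sum_distrib_left mult.left_commute)
    also have "\<dots> = (\<Sum>n\<le>degree (q ?j). \<integral>x. c n * (D x * (\<Prod>j=1..k. poly (?q n j) (x j))) \<partial>mu {1..k})"
      by (rule Bochner_Integration.integral_sum) (rule int)
    also have "\<dots> = 0"
    proof (intro sum.neutral ballI)
      fix n
      have "\<forall>j\<in>{m<..k}. \<exists>n'. ?q n j = legendre_normed n'" using Suc.prems(2) by auto
      then have "(\<integral>x. D x * (\<Prod>j=1..k. poly (?q n j) (x j)) \<partial>mu {1..k}) = 0"
        by (intro Suc.IH) (use Suc.prems(1) in auto)
      then show "(\<integral>x. c n * (D x * (\<Prod>j=1..k. poly (?q n j) (x j))) \<partial>mu {1..k}) = 0" by simp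
    qed
    finally show ?case .
  qed
  from this[of k q] show ?thesis by simp
qed

text \<open>\<open>D\<close> is orthogonal to its own uniform approximation g, so the integral of
  D^2 equals that of D(D - g) and is arbitrarily small.\<close>

lemma legendre_complete:
  assumes k: "1 \<le> k" and D: "continuous_on (cube k) D"
    and orth: "\<And>\<nu>. \<nu> \<in> PiE {1..k} (\<lambda>_. UNIV) \<Longrightarrow> (\<integral>x. D x * legendre_prod k \<nu> x \<partial>mu {1..k}) = 0"
  shows "AE x in mu {1..k}. D x = 0"
proof -
  have int: "integrable (mu {1..k}) (\<lambda>x. D x * g x)" if "continuous_on (cube k) g" for g
    by (intro integrable_continuous_on_cube continuous_on_mult D that)
  have zero: "(\<integral>x. D x * g x \<partial>mu {1..k}) = 0" if "tensor_sum k g" for g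
    using that
  proof induction
    case (tensor q)
    show ?case by (rule orthogonal_to_tensors[OF D orth])
  next
    case (add f g)
    have "(\<integral>x. D x * f x + D x * g x \<partial>mu {1..k}) = (\<integral>x. D x * f x \<partial>mu {1..k}) + (\<integral>x. D x * g x \<partial>mu {1..k})"
      by (intro Bochner_Integration.integral_add int
          tensor_sum_continuous[OF add.hyps(1)] tensor_sum_continuous[OF add.hyps(2)])
    then show ?case using add.IH by (simp add: distrib_left)
  qed
  obtain B where "\<forall>x\<in>cube k. norm (D x) \<le> B" by (rule bounded_on_cube[OF D])
  then have B: "\<bar>D x\<bar> \<le> B" if "x \<in> cube k" for x using that by simp
  have cube0: "(\<lambda>_\<in>{1..k}. 0) \<in> cube k" by (auto simp: cube_def)
  have B0: "0 \<le> B" by (rule order_trans[OF abs_ge_zero B[OF cube0]])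
  have le: "(\<integral>x. D x * D x \<partial>mu {1..k}) \<le> e" if e: "0 < e" for e
  proof -
    \<comment> \<open>The shift by 1 avoids division by zero when \<open>B\<close> is 0.\<close>
    define e' where "e' = e / (B + 1)"
    have e': "0 < e'" "B * e' \<le> e" using e B0 by (auto simp: e'_def field_simps)
    obtain g where g: "tensor_sum k g" "\<forall>x\<in>cube k. \<bar>D x - g x\<bar> < e'"
      using tensor_sum_approx[OF k D e'(1)] by blast
    have gc: "continuous_on (cube k) g" by (rule tensor_sum_continuous[OF g(1)])
    have "(\<integral>x. D x * D x \<partial>mu {1..k}) = (\<integral>x. D x * D x \<partial>mu {1..k}) - (\<integral>x. D x * g x \<partial>mu {1..k})"
      using zero[OF g(1)] by simp
    also have "\<dots> = (\<integral>x. D x * (D x - g x) \<partial>mu {1..k})"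
      using Bochner_Integration.integral_diff[OF int[OF D] int[OF gc]] by (simp add: right_diff_distrib)
    also have "\<dots> \<le> norm (\<integral>x. D x * (D x - g x) \<partial>mu {1..k})" by simp
    also have "\<dots> \<le> B * e'"
    proof (rule norm_integral_mu_le)
      show "(\<lambda>x. D x * (D x - g x)) \<in> borel_measurable (mu {1..k})"
        by (intro measurable_continuous_on_cube continuous_intros D gc)
      fix x assume "x \<in> PiE {1..k} (\<lambda>_. {-1..1::real})"
      then have x: "x \<in> cube k" by (simp add: cube_def)
      show "norm (D x * (D x - g x)) \<le> B * e'"
        unfolding real_norm_def abs_mult by (intro mult_mono B x B0 less_imp_le[OF bspec[OF g(2) x]]) auto
    qed
    finally show ?thesis using e'(2) by linarith
  qed
  have "(\<integral>x. D x * D x \<partial>mu {1..k}) \<le> 0" by (rule field_le_epsilon) (use le in simp)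
  moreover have "0 \<le> (\<integral>x. D x * D x \<partial>mu {1..k})" by (rule Bochner_Integration.integral_nonneg) simp
  ultimately have "(\<integral>x. D x * D x \<partial>mu {1..k}) = 0" by (rule antisym)
  then have "AE x in mu {1..k}. D x * D x = 0"
    using integral_nonneg_eq_0_iff_AE[OF int[OF D]] by simp
  then show ?thesis by eventually_elim simp
qed

section \<open>Orthonormal expansion and identification of its limit\<close>

lemma legendre_prod_orthonormal:
  assumes "\<nu> \<in> PiE {1..k} (\<lambda>_. UNIV)" "\<nu>' \<in> PiE {1..k} (\<lambda>_. UNIV)"
  shows "(\<integral>x. legendre_prod k \<nu> x * legendre_prod k \<nu>' x \<partial>mu {1..k}) = (if \<nu> = \<nu>' then 1 else 0)"
proof -
  have "(\<integral>x. legendre_prod k \<nu> x * legendre_prod k \<nu>' x \<partial>mu {1..k}) =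
      (\<integral>x. (\<Prod>j=1..k. legendre (\<nu> j) (x j) * legendre (\<nu>' j) (x j)) \<partial>mu {1..k})"
    by (simp add: legendre_prod_def prod.distrib)
  also have "\<dots> = (\<Prod>j=1..k. \<integral>t. legendre (\<nu> j) t * legendre (\<nu>' j) t \<partial>mu1)"
    by (rule integral_mu_prod) (auto simp: legendre_eq_poly intro!: integrable_mu1_continuous continuous_intros)
  also have "\<dots> = (\<Prod>j=1..k. if \<nu> j = \<nu>' j then 1 else 0)" by (simp add: legendre_orthonormal)
  also have "\<dots> = (if \<nu> = \<nu>' then 1 else 0)"
  proof (cases "\<nu> = \<nu>'")
    case False
    then obtain j where "\<nu> j \<noteq> \<nu>' j" by blast
    then have "j \<in> {1..k}" using PiE_arb[OF assms(1)] PiE_arb[OF assms(2)] by metis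
    with \<open>\<nu> j \<noteq> \<nu>' j\<close> show ?thesis using False by (auto intro!: prod_zero)
  qed simp
  finally show ?thesis .
qed

text \<open>The series converges uniformly to a continuous \<open>S\<close> with the same Legendre
  coefficients as \<open>T\<close>, and completeness is applied to T - S.\<close>

lemma legendre_expansion:
  assumes k: "1 \<le> k" and T: "continuous_on (cube k) T"
    and e: "bij_betw e UNIV (PiE {1..k} (\<lambda>_. UNIV))"
    and a: "summable a" "\<And>n x. x \<in> cube k \<Longrightarrow> \<bar>legendre_coeff k T (e n) * legendre_prod k (e n) x\<bar> \<le> a n"
  shows "AE x in mu {1..k}. (\<lambda>n. legendre_coeff k T (e n) * legendre_prod k (e n) x) sums T x"
proof -
  define F where "F n x = legendre_coeff k T (e n) * legendre_prod k (e n) x" for n x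
  define S where "S x = (\<Sum>n. F n x)" for x
  have L_cont: "continuous_on X (legendre_prod k \<nu>)" for X \<nu>
    unfolding legendre_prod_def[abs_def] legendre_eq_poly by (rule continuous_on_tensor)
  have F_cont: "continuous_on X (F n)" for X n
    unfolding F_def[abs_def] by (intro continuous_on_mult continuous_on_const L_cont)
  have F_bound: "\<bar>F n x\<bar> \<le> a n" if "x \<in> cube k" for n x unfolding F_def by (rule a(2)[OF that])
  have F_summable: "summable (\<lambda>n. F n x)" if "x \<in> cube k" for x
    by (rule summable_comparison_test'[OF a(1)]) (use F_bound[OF that] in simp)
  have "uniform_limit (cube k) (\<lambda>N x. \<Sum>n<N. F n x) S sequentially"
    unfolding S_def[abs_def] by (rule Weierstrass_m_test[OF _ a(1)]) (use F_bound in simp)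
  then have S_cont: "continuous_on (cube k) S"
    by (rule uniform_limit_theorem[rotated]) (auto intro!: always_eventually continuous_on_sum F_cont)
  have "(\<integral>x. (T x - S x) * legendre_prod k \<nu> x \<partial>mu {1..k}) = 0" if nu: "\<nu> \<in> PiE {1..k} (\<lambda>_. UNIV)" for \<nu>
  proof -
    \<comment> \<open>The position of \<nu> in the enumeration; by orthonormality it is the only
      term that survives integration.\<close>
    from e nu obtain i where i: "e i = \<nu>" by (metis UNIV_I bij_betw_imp_surj_on imageE)
    have inj: "e n = \<nu> \<longleftrightarrow> n = i" for n using e i by (metis UNIV_I bij_betw_imp_inj_on inj_on_eq_iff)
    have mem: "e n \<in> PiE {1..k} (\<lambda>_. UNIV)" for n using e by (auto simp: bij_betw_def)
    obtain W where W: "\<forall>x\<in>cube k. norm (legendre_prod k \<nu> x) \<le> W" by (rule bounded_on_cube[OF L_cont])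
    have "(\<lambda>n. \<integral>x. F n x * legendre_prod k \<nu> x \<partial>mu {1..k}) sums (\<integral>x. (\<Sum>n. F n x) * legendre_prod k \<nu> x \<partial>mu {1..k})"
      by (rule integral_bounded_series[OF measurable_continuous_on_cube[OF F_cont] F_bound a(1) measurable_continuous_on_cube[OF L_cont]])
         (use W in auto)
    moreover have "(\<integral>x. F n x * legendre_prod k \<nu> x \<partial>mu {1..k}) = (if n = i then legendre_coeff k T (e n) else 0)" for n
      using legendre_prod_orthonormal[OF mem[of n] nu] inj[of n] by (simp add: F_def mult.assoc)
    ultimately have "(\<lambda>n. if n = i then legendre_coeff k T (e n) else 0) sums (\<integral>x. S x * legendre_prod k \<nu> x \<partial>mu {1..k})"
      by (simp add: S_def)
    then have "(\<integral>x. S x * legendre_prod k \<nu> x \<partial>mu {1..k}) = legendre_coeff k T \<nu>"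
      using sums_unique2[OF _ sums_single[of i "\<lambda>n. legendre_coeff k T (e n)"]] i by simp
    moreover have "(\<integral>x. (T x - S x) * legendre_prod k \<nu> x \<partial>mu {1..k}) =
        (\<integral>x. T x * legendre_prod k \<nu> x \<partial>mu {1..k}) - (\<integral>x. S x * legendre_prod k \<nu> x \<partial>mu {1..k})"
      unfolding left_diff_distrib
      by (intro Bochner_Integration.integral_diff integrable_continuous_on_cube continuous_on_mult T S_cont L_cont)
    ultimately show ?thesis by (simp add: legendre_coeff_def)
  qed
  then have "AE x in mu {1..k}. T x - S x = 0"
    by (intro legendre_complete[OF k] continuous_on_diff T S_cont)
  then show ?thesis
    using AE_space
  proof eventually_elim
    case (elim x)
    then have "x \<in> cube k" by (simp only: space_mu_cube)
    from summable_sums[OF F_summable[OF this]] elim show ?case by (simp add: S_def F_def)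
  qed
qed

section \<open>Truncation error\<close>

lemma legendre_uniform_bound:
  "\<exists>C\<ge>1. \<exists>p. \<forall>i\<le>m. \<forall>n. \<forall>x\<in>{-1..1}. \<bar>poly ((pderiv ^^ i) (legendre_normed n)) x\<bar> \<le> C * (real n + 1) ^ p"
proof (induction m)
  case 0
  obtain C a where C: "C > 0" "\<forall>n. \<forall>x\<in>{-1..1}. \<bar>poly ((pderiv ^^ 0) (legendre_normed n)) x\<bar> \<le> C * (real n + 1) ^ a"
    using legendre_higher_bound by blast
  have "\<bar>poly ((pderiv ^^ 0) (legendre_normed n)) x\<bar> \<le> max 1 C * (real n + 1) ^ a" if "x \<in> {-1..1}" for n x
  proof -
    have "C * (real n + 1) ^ a \<le> max 1 C * (real n + 1) ^ a" by (intro mult_right_mono) auto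
    then show ?thesis using C(2)[rule_format, OF that, of n] by linarith
  qed
  then show ?case by (intro exI[of _ "max 1 C"] conjI exI[of _ a]) auto
next
  case (Suc m)
  then obtain C p where C: "C \<ge> 1" "\<forall>i\<le>m. \<forall>n. \<forall>x\<in>{-1..1}. \<bar>poly ((pderiv ^^ i) (legendre_normed n)) x\<bar> \<le> C * (real n + 1) ^ p"
    by blast
  obtain D a where D: "D > 0" "\<forall>n. \<forall>x\<in>{-1..1}. \<bar>poly ((pderiv ^^ Suc m) (legendre_normed n)) x\<bar> \<le> D * (real n + 1) ^ a"
    using legendre_higher_bound by blast
  have "\<bar>poly ((pderiv ^^ i) (legendre_normed n)) x\<bar> \<le> (C + D) * (real n + 1) ^ (p + a)"
    if "i \<le> Suc m" and x: "x \<in> {-1..1}" for i n x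
  proof -
    have "C * (real n + 1) ^ p \<le> (C + D) * (real n + 1) ^ (p + a)"
      using C(1) D(1) by (intro mult_mono power_increasing) auto
    moreover have "D * (real n + 1) ^ a \<le> (C + D) * (real n + 1) ^ (p + a)"
      using C(1) D(1) by (intro mult_mono power_increasing) auto
    moreover have "i \<le> m \<or> i = Suc m" using that(1) by auto
    ultimately show ?thesis using C(2) D(2) x order_trans by blast
  qed
  then show ?case using C(1) D(1) by (intro exI[of _ "C + D"] conjI exI[of _ "p + a"]) auto
qed

lemma powr_power_split:
  fixes x :: real
  assumes "0 < x"
  shows "(x powr \<tau>) ^ n = (x ^ n) powr \<theta> * (x powr (\<tau> - \<theta>)) ^ n"
proof -
  have "(x powr \<tau>) ^ n = x powr (\<tau> * real n)" using assms by (simp add: powr_powr flip: powr_realpow)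
  also have "\<dots> = x powr (real n * \<theta>) * x powr ((\<tau> - \<theta>) * real n)"
    using assms by (simp add: algebra_simps flip: powr_add)
  also have "\<dots> = (x ^ n) powr \<theta> * (x powr (\<tau> - \<theta>)) ^ n"
    using assms by (simp add: powr_powr flip: powr_realpow)
  finally show ?thesis .
qed

text \<open>Of the weight $\prod_j\varrho_j^{-\tau\nu_j}$, the power $\theta<\tau$ is at most
  $(\varepsilon\varrho_k)^\theta$ outside $\Lambda_{k,\varepsilon}$, and the remaining power $\tau-\theta$ makes
  the series converge.\<close>

lemma component_error:
  fixes R :: "(nat \<Rightarrow> complex) \<Rightarrow> complex" and T :: "(nat \<Rightarrow> real) \<Rightarrow> real"
  assumes k: "1 \<le> k" "k \<le> d" and r: "\<And>j. j \<in> {1..d} \<Longrightarrow> 1 < r j"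
    and hol: "holomorphic_n k (poly_nbhd k (\<lambda>j. r j - 1)) R"
    and R_bound: "\<And>z. z \<in> poly_nbhd k (\<lambda>j. r j - 1) \<Longrightarrow> norm (R z) \<le> B"
    and deriv: "\<And>x. x \<in> cube k \<Longrightarrow> ((\<lambda>t. T (x(k := t))) has_vector_derivative Re (R (cemb k x))) (at (x k) within {-1..1})"
    and left_end: "\<And>x. x \<in> cube k \<Longrightarrow> x k = -1 \<Longrightarrow> T x = -1"
    and depends: "\<And>x. T (restrict x {1..k}) = T x"
    and theta: "0 < \<theta>" "\<theta> < 1"
  shows "\<exists>C\<ge>0. \<forall>\<epsilon>\<in>{0<..<1}. sobolev_norm d m (\<lambda>x. T x - legendre_trunc r k \<epsilon> T x) \<le> ennreal (C * \<epsilon> powr \<theta>)"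
proof -
  have rk: "\<And>j. j \<in> {1..k} \<Longrightarrow> 1 < r j" using r k by auto
  have zeta: "\<And>j. j \<in> {1..k} \<Longrightarrow> 0 < r j - 1" using rk by simp
  have T_cont: "continuous_on (cube k) T"
    by (rule T_continuous[where R = R and B = B and \<zeta> = "\<lambda>j. r j - 1"]) fact+
  \<comment> \<open>Any value strictly between \<theta> and 1 would do: \<tau> < 1 keeps \<rho>_j =
    r_j^\<tau> below 1 + (r_j - 1), and \<tau> - \<theta> > 0 leaves decay for summation.\<close>
  define \<tau> where "\<tau> = (1 + \<theta>) / 2"
  have tau: "\<theta> < \<tau>" "\<tau> < 1" "0 < \<tau>" using theta by (auto simp: \<tau>_def)
  define \<rho> where "\<rho> j = r j powr \<tau>" for j
  define \<sigma> where "\<sigma> j = inverse (r j) powr (\<tau> - \<theta>)" for j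
  have rho: "1 < \<rho> j" "\<rho> j < 1 + (r j - 1)" if "j \<in> {1..k}" for j
  proof -
    show "1 < \<rho> j" unfolding \<rho>_def using rk[OF that] tau by (intro gr_one_powr) auto
    have "r j powr \<tau> < r j powr 1" using rk[OF that] tau by (intro powr_less_mono) auto
    then show "\<rho> j < 1 + (r j - 1)" using rk[OF that] by (simp add: \<rho>_def)
  qed
  have sigma: "0 < \<sigma> j" "\<sigma> j < 1" if "j \<in> {1..k}" for j
  proof -
    have i: "0 < inverse (r j)" "inverse (r j) < 1" using rk[OF that] by (auto simp: inverse_less_1_iff)
    then show "0 < \<sigma> j" by (simp add: \<sigma>_def)
    show "\<sigma> j < 1" unfolding \<sigma>_def using powr_less_mono2[of "\<tau> - \<theta>" "inverse (r j)" 1] i tau by simp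
  qed
  obtain K a where K: "K > 0"
    "\<forall>\<nu>. \<bar>legendre_coeff k T \<nu>\<bar> \<le> K * (\<Prod>j=1..k. (real (\<nu> j) + 1) ^ a * inverse (\<rho> j) ^ \<nu> j)"
  proof -
    have "\<exists>K>0. \<exists>a. \<forall>\<nu>. \<bar>legendre_coeff k T \<nu>\<bar> \<le> K * (\<Prod>j=1..k. (real (\<nu> j) + 1) ^ a * inverse (\<rho> j) ^ \<nu> j)"
      by (rule legendre_coeff_decay[where R = R and B = B and \<zeta> = "\<lambda>j. r j - 1"]) fact+
    then show thesis using that by blast
  qed
  obtain C1 p where C1: "C1 \<ge> 1"
    "\<forall>i\<le>m. \<forall>n. \<forall>x\<in>{-1..1}. \<bar>poly ((pderiv ^^ i) (legendre_normed n)) x\<bar> \<le> C1 * (real n + 1) ^ p"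
    using legendre_uniform_bound by blast
  obtain e :: "nat \<Rightarrow> nat \<Rightarrow> nat" where e: "bij_betw e UNIV (PiE {1..k} (\<lambda>_. UNIV))"
    by (rule multi_index_enumeration[OF k(1)])
  have e_mem: "e n \<in> PiE {1..k} (\<lambda>_. UNIV)" for n using e by (auto simp: bij_betw_def)
  have e_inj: "inj e" and e_range: "range e \<subseteq> PiE {1..k} (\<lambda>_. UNIV)" using e by (auto simp: bij_betw_def)
  \<comment> \<open>The constant factor 1 in the coordinates beyond \<open>k\<close> turns a product
    on [-1,1]^k into one on [-1,1]^d.\<close>
  define q where "q n j = (if j \<le> k then legendre_normed (e n j) else 1)" for n j
  define P where "P \<nu> = (\<Prod>j=1..k. (real (\<nu> j) + 1) ^ p)" for \<nu> :: "nat \<Rightarrow> nat"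
  define A where "A \<nu> = (\<Prod>j=1..k. (real (\<nu> j) + 1) ^ a * inverse (\<rho> j) ^ \<nu> j)" for \<nu> :: "nat \<Rightarrow> nat"
  have P0: "0 \<le> P \<nu>" for \<nu> unfolding P_def by (intro prod_nonneg) simp
  have A0: "0 \<le> A \<nu>" for \<nu>
  proof -
    have "0 \<le> inverse (\<rho> j)" if "j \<in> {1..k}" for j using rho(1)[OF that] by simp
    then show ?thesis unfolding A_def by (intro prod_nonneg mult_nonneg_nonneg zero_le_power) auto
  qed
  have deriv_bound: "\<bar>\<Prod>j=1..d. poly ((pderiv ^^ count_list is j) (q n j)) (x j)\<bar> \<le> C1 ^ k * P (e n)"
    if "set is \<subseteq> {1..d}" "length is \<le> m" "x \<in> cube d" for "is" n x
  proof -
    have "\<bar>\<Prod>j=1..d. poly ((pderiv ^^ count_list is j) (q n j)) (x j)\<bar> \<le> (\<Prod>j=1..d. if j \<le> k then C1 * (real (e n j) + 1) ^ p else 1)"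
      unfolding abs_prod
    proof (rule prod_mono, intro conjI)
      fix j assume j: "j \<in> {1..d}"
      have xj: "x j \<in> {-1..1}" using that(3) j by (auto simp: cube_def)
      have cnt: "count_list is j \<le> m" using count_le_length[of "is" j] that(2) by linarith
      show "\<bar>poly ((pderiv ^^ count_list is j) (q n j)) (x j)\<bar> \<le> (if j \<le> k then C1 * (real (e n j) + 1) ^ p else 1)"
      proof (cases "j \<le> k")
        case True
        then show ?thesis using C1(2)[rule_format, OF cnt xj] by (simp add: q_def)
      next
        case False
        have "(pderiv ^^ i) 1 = (0 :: real poly)" if "i > 0" for i
          by (rule higher_pderiv_eq_0) (use that in simp)
        then show ?thesis using False by (cases "count_list is j") (simp_all add: q_def del: funpow.simps)
      qed
    qed simp
    also have "\<dots> = (\<Prod>j=1..k. C1 * (real (e n j) + 1) ^ p)"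
      by (rule prod.mono_neutral_cong_right) (use k in auto)
    also have "\<dots> = C1 ^ k * P (e n)" by (simp add: prod.distrib P_def)
    finally show ?thesis .
  qed
  have L_bound: "\<bar>legendre_prod k (e n) x\<bar> \<le> C1 ^ k * P (e n)" if "x \<in> cube k" for n x
  proof -
    have "\<bar>legendre_prod k (e n) x\<bar> \<le> (\<Prod>j=1..k. C1 * (real (e n j) + 1) ^ p)"
      unfolding legendre_prod_def legendre_eq_poly
    proof (rule tensor_bound)
      fix j and y :: real assume "y \<in> {-1..1}"
      from C1(2)[rule_format, OF le0 this, of "e n j"] show "\<bar>poly (legendre_normed (e n j)) y\<bar> \<le> C1 * (real (e n j) + 1) ^ p"
        by simp
    qed (use that in \<open>simp add: cube_def\<close>)
    then show ?thesis by (simp add: prod.distrib P_def)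
  qed
  have merge_powers: "A \<nu> * P \<nu> = (\<Prod>j=1..k. (real (\<nu> j) + 1) ^ (a + p) * inverse (\<rho> j) ^ \<nu> j)" for \<nu>
    unfolding A_def P_def prod.distrib[symmetric] by (rule prod.cong) (auto simp: power_add)
  define h where "h n = (\<Prod>j=1..k. (real (e n j) + 1) ^ (a + p) * \<sigma> j ^ e n j)" for n
  have h_sum: "summable h"
    unfolding h_def
  \<comment> \<open>The value 0 outside {1..k} provides the nonnegativity that
    \<open>summable_tensor\<close> asks for at every index \<open>j\<close>.\<close>
  proof (rule summable_tensor[where h = "\<lambda>j n. (real n + 1) ^ (a + p) * (if j \<in> {1..k} then \<sigma> j else 0) ^ n", simplified, THEN summable_cong[THEN iffD1, rotated]])
  qed (use sigma e_inj e_range in \<open>auto intro: summable_poly_geometric less_imp_le intro!: prod.cong\<close>)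
  have h_nonneg: "0 \<le> h n" for n
    unfolding h_def by (intro prod_nonneg mult_nonneg_nonneg zero_le_power) (use sigma in \<open>auto intro: less_imp_le\<close>)
  have A_split: "A \<nu> * P \<nu> = (\<Prod>j=1..k. inverse (r j) ^ \<nu> j) powr \<theta> * (\<Prod>j=1..k. (real (\<nu> j) + 1) ^ (a + p) * \<sigma> j ^ \<nu> j)" for \<nu>
  proof -
    have "A \<nu> * P \<nu> = (\<Prod>j=1..k. (inverse (r j) ^ \<nu> j) powr \<theta> * ((real (\<nu> j) + 1) ^ (a + p) * \<sigma> j ^ \<nu> j))"
      unfolding merge_powers
    proof (rule prod.cong[OF refl])
      fix j assume j: "j \<in> {1..k}"
      have i: "0 < inverse (r j)" using rk[OF j] by simp
      have "inverse (\<rho> j) = inverse (r j) powr \<tau>"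
        unfolding \<rho>_def using rk[OF j] by (simp add: inverse_powr)
      then show "(real (\<nu> j) + 1) ^ (a + p) * inverse (\<rho> j) ^ \<nu> j =
          (inverse (r j) ^ \<nu> j) powr \<theta> * ((real (\<nu> j) + 1) ^ (a + p) * \<sigma> j ^ \<nu> j)"
        using powr_power_split[OF i, of \<tau> "\<nu> j" \<theta>] by (simp add: \<sigma>_def mult_ac)
    qed
    also have "\<dots> = (\<Prod>j=1..k. (inverse (r j) ^ \<nu> j) powr \<theta>) * (\<Prod>j=1..k. (real (\<nu> j) + 1) ^ (a + p) * \<sigma> j ^ \<nu> j)"
      by (rule prod.distrib)
    also have "(\<Prod>j=1..k. (inverse (r j) ^ \<nu> j) powr \<theta>) = (\<Prod>j=1..k. inverse (r j) ^ \<nu> j) powr \<theta>"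
      by (rule prod_powr_distrib[symmetric])
    finally show ?thesis .
  qed
  have AP_sum: "summable (\<lambda>n. K * C1 ^ k * (A (e n) * P (e n)))"
    unfolding merge_powers
  proof (rule summable_mult)
    have "summable (\<lambda>n. \<Prod>j=1..k. (real (e n j) + 1) ^ (a + p) * (if j \<in> {1..k} then inverse (\<rho> j) else 0) ^ e n j)"
    proof (rule summable_tensor[OF _ _ e_inj e_range])
      fix j assume j: "j \<in> {1..k}"
      have "0 < inverse (\<rho> j)" "inverse (\<rho> j) < 1" using rho(1)[OF j] by (auto simp: inverse_less_1_iff)
      from summable_poly_geometric[OF this]
      show "summable (\<lambda>n. (real n + 1) ^ (a + p) * (if j \<in> {1..k} then inverse (\<rho> j) else 0) ^ n)" using j by simp
    next
      fix j n
      have "0 \<le> (if j \<in> {1..k} then inverse (\<rho> j) else 0)" using rho(1)[of j] by (auto intro: less_imp_le)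
      then show "0 \<le> (real n + 1) ^ (a + p) * (if j \<in> {1..k} then inverse (\<rho> j) else 0) ^ n" by simp
    qed
    then show "summable (\<lambda>n. \<Prod>j=1..k. (real (e n j) + 1) ^ (a + p) * inverse (\<rho> j) ^ e n j)" by simp
  qed
  have coeff: "\<bar>legendre_coeff k T \<nu>\<bar> \<le> K * A \<nu>" for \<nu> using K(2) unfolding A_def by blast
  have expansion: "AE x in mu {1..k}. (\<lambda>n. legendre_coeff k T (e n) * legendre_prod k (e n) x) sums T x"
  proof (rule legendre_expansion[OF k(1) T_cont e AP_sum])
    fix n x assume x: "x \<in> cube k"
    have "\<bar>legendre_coeff k T (e n)\<bar> * \<bar>legendre_prod k (e n) x\<bar> \<le> (K * A (e n)) * (C1 ^ k * P (e n))"
      by (intro mult_mono coeff L_bound[OF x]) (use K(1) A0 in auto)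
    then show "\<bar>legendre_coeff k T (e n) * legendre_prod k (e n) x\<bar> \<le> K * C1 ^ k * (A (e n) * P (e n))"
      by (simp add: abs_mult mult_ac)
  qed
  have sub: "{1..k} \<subseteq> {1..d}" using k by auto
  have L_restrict: "legendre_prod k \<nu> (restrict x {1..k}) = legendre_prod k \<nu> x" for \<nu> x
    unfolding legendre_prod_def by (rule prod.cong) auto
  have expansion_d: "AE x in mu {1..d}. (\<lambda>n. legendre_coeff k T (e n) * legendre_prod k (e n) x) sums T x"
    using AE_mu_restrict[OF sub _ expansion] unfolding L_restrict depends by simp
  have L_tensor: "legendre_prod k (e n) x = (\<Prod>j=1..d. poly (q n j) (x j))" for n x
    unfolding legendre_prod_def legendre_eq_poly
    by (rule prod.mono_neutral_cong_left) (use k in \<open>auto simp: q_def\<close>)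
  define C where "C = sobolev_const d m * (K * C1 ^ k * r k powr \<theta> * suminf h)"
  have rk0: "0 < r k" using rk[of k] k by simp
  have "0 \<le> C" unfolding C_def
    by (intro mult_nonneg_nonneg sobolev_const_nonneg suminf_nonneg h_sum h_nonneg zero_le_power) (use K(1) C1(1) in auto)
  moreover have "sobolev_norm d m (\<lambda>x. T x - legendre_trunc r k \<epsilon> T x) \<le> ennreal (C * \<epsilon> powr \<theta>)"
    if eps: "0 < \<epsilon>" "\<epsilon> < 1" for \<epsilon>
  proof -
    \<comment> \<open>The coefficients of the error series: exactly the terms kept by the truncation
      are deleted.\<close>
    define c where "c n = (if e n \<in> Lambda r k \<epsilon> then 0 else legendre_coeff k T (e n))" for n
    define b where "b n = K * C1 ^ k * r k powr \<theta> * \<epsilon> powr \<theta> * h n" for n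
    have fin: "finite (Lambda r k \<epsilon>)" by (rule Lambda_card(1)[OF k _ eps]) (rule r)
    have b_bound: "\<bar>c n\<bar> * (C1 ^ k * P (e n)) \<le> b n" for n
    proof (cases "e n \<in> Lambda r k \<epsilon>")
      case True
      then show ?thesis using K(1) C1(1) h_nonneg by (simp add: c_def b_def)
    next
      case False
      have "(\<Prod>j=1..k. inverse (r j) ^ e n j) \<le> \<epsilon> * r k"
        by (rule not_Lambda_weight[OF k(1) rk e_mem False])
      moreover have "0 \<le> (\<Prod>j=1..k. inverse (r j) ^ e n j)"
        by (intro prod_nonneg zero_le_power) (use rk in force)
      ultimately have "(\<Prod>j=1..k. inverse (r j) ^ e n j) powr \<theta> \<le> (\<epsilon> * r k) powr \<theta>"
        using theta by (intro powr_mono2) auto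
      also have "\<dots> = r k powr \<theta> * \<epsilon> powr \<theta>" using eps rk0 by (simp add: powr_mult)
      finally have "A (e n) * P (e n) \<le> r k powr \<theta> * \<epsilon> powr \<theta> * h n"
        unfolding A_split h_def[symmetric] by (rule mult_right_mono[OF _ h_nonneg])
      then have "K * C1 ^ k * (A (e n) * P (e n)) \<le> K * C1 ^ k * (r k powr \<theta> * \<epsilon> powr \<theta> * h n)"
        using K(1) C1(1) by (intro mult_left_mono) auto
      moreover have "\<bar>c n\<bar> * (C1 ^ k * P (e n)) \<le> K * A (e n) * (C1 ^ k * P (e n))"
        by (intro mult_right_mono) (use coeff False P0 C1(1) in \<open>auto simp: c_def\<close>)
      ultimately show ?thesis by (simp add: b_def mult_ac)
    qed
    have "sobolev_norm d m (\<lambda>x. T x - legendre_trunc r k \<epsilon> T x) \<le> ennreal (sobolev_const d m * suminf b)"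
    proof (rule sobolev_norm_series)
      show "summable b" unfolding b_def by (rule summable_mult[OF h_sum])
    next
      fix "is" :: "nat list" and n x assume is_x: "set is \<subseteq> {1..d}" "length is \<le> m" "x \<in> cube d"
      have "\<bar>c n\<bar> * \<bar>\<Prod>j=1..d. poly ((pderiv ^^ count_list is j) (q n j)) (x j)\<bar> \<le> \<bar>c n\<bar> * (C1 ^ k * P (e n))"
        by (rule mult_left_mono[OF deriv_bound[OF is_x]]) simp
      then show "\<bar>c n * (\<Prod>j=1..d. poly ((pderiv ^^ count_list is j) (q n j)) (x j))\<bar> \<le> b n"
        unfolding abs_mult using b_bound[of n] by linarith
    next
      have "(\<lambda>x. T (restrict x {1..k})) \<in> borel_measurable (mu {1..d})"
        by (rule measurable_compose[OF mu_restrict_measurable[OF sub] measurable_continuous_on_cube[OF T_cont]])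
      then have "T \<in> borel_measurable (mu {1..d})" by (simp only: depends)
      moreover have "legendre_trunc r k \<epsilon> T \<in> borel_measurable (mu {1..d})"
        unfolding legendre_trunc_def[abs_def] legendre_prod_def legendre_eq_poly
        by (intro borel_measurable_sum borel_measurable_times measurable_mu_tensor) simp
      ultimately show "(\<lambda>x. T x - legendre_trunc r k \<epsilon> T x) \<in> borel_measurable (mu {1..d})"
        by (rule borel_measurable_diff)
    next
      show "AE x in mu {1..d}. (\<lambda>n. c n * (\<Prod>j=1..d. poly (q n j) (x j))) sums (T x - legendre_trunc r k \<epsilon> T x)"
        using expansion_d
      proof eventually_elim
        case (elim x)
        \<comment> \<open>The positions of the retained indices. They are finitely many, so the
          truncation is itself a finite subseries and can be subtracted termwise.\<close>
        define S where "S = {n. e n \<in> Lambda r k \<epsilon>}"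
        let ?F = "\<lambda>\<nu>. legendre_coeff k T \<nu> * legendre_prod k \<nu> x"
        have "range e = PiE {1..k} (\<lambda>_. UNIV)" using e by (simp only: bij_betw_def)
        then have "Lambda r k \<epsilon> \<subseteq> range e" by (auto simp only: Lambda_iff)
        then have img: "e ` S = Lambda r k \<epsilon>" unfolding S_def by blast
        then have bij: "bij_betw e S (Lambda r k \<epsilon>)"
          using e_inj by (auto simp: bij_betw_def intro: inj_on_subset)
        have finS: "finite S" using bij fin bij_betw_finite by blast
        have "(\<lambda>n. if n \<in> S then ?F (e n) else 0) sums (\<Sum>n\<in>S. ?F (e n))"
          by (rule sums_If_finite_set[OF finS])
        moreover have "(\<Sum>n\<in>S. ?F (e n)) = legendre_trunc r k \<epsilon> T x"
          unfolding legendre_trunc_def by (rule sum.reindex_bij_betw[OF bij])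
        ultimately have "(\<lambda>n. ?F (e n) - (if n \<in> S then ?F (e n) else 0)) sums (T x - legendre_trunc r k \<epsilon> T x)"
          using sums_diff[OF elim] by simp
        moreover have "?F (e n) - (if n \<in> S then ?F (e n) else 0) = c n * (\<Prod>j=1..d. poly (q n j) (x j))" for n
          by (simp add: c_def S_def L_tensor)
        ultimately show ?case by simp
      qed
    qed
    also have "sobolev_const d m * suminf b = C * \<epsilon> powr \<theta>"
      unfolding b_def C_def using suminf_mult[OF h_sum] by simp
    finally show ?thesis .
  qed
  ultimately show ?thesis by (intro exI[of _ C]) auto
qed

section \<open>From the parameter \<epsilon> to the number of retained coefficients\<close>

theorem theorem4p3:
  fixes d m :: nat
    and M L C\<^sub>6 C\<^sub>7 C\<^sub>8 \<beta> :: real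
    and \<delta> r :: "nat \<Rightarrow> real"
    and f\<^sub>\<rho> f\<^sub>\<pi> :: "(nat \<Rightarrow> real) \<Rightarrow> real"
    and \<rho> \<pi> :: "(nat \<Rightarrow> real) measure"
  assumes "1 \<le> d"
    and "0 < M" "M \<le> L"
    and "\<And>j. j \<in> {1..d} \<Longrightarrow> 0 < \<delta> j"
    and "regularity_constants M L C\<^sub>6 C\<^sub>7 C\<^sub>8"
    and "\<rho> = density (mu {1..d}) (\<lambda>x. ennreal (f\<^sub>\<rho> x))"
    and "\<pi> = density (mu {1..d}) (\<lambda>x. ennreal (f\<^sub>\<pi> x))"
    and "assumption_A d M L \<delta> C\<^sub>6 f\<^sub>\<rho>"
    and "assumption_A d M L \<delta> C\<^sub>6 f\<^sub>\<pi>"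
    and "\<And>j. j \<in> {1..d} \<Longrightarrow> r j = 1 + C\<^sub>7 * \<delta> j"
    and "\<beta> = (fact (d - 1) * (\<Prod>j=1..d. ln (r j))) powr (1 / real d)"
  shows "\<forall>\<beta>'<\<beta>. \<exists>C>0. \<forall>\<epsilon>\<in>{0<..<1}.
    (\<Sum>k=1..d. sobolev_norm d m
       (\<lambda>x. KR d f\<^sub>\<rho> f\<^sub>\<pi> k x - legendre_trunc r k \<epsilon> (KR d f\<^sub>\<rho> f\<^sub>\<pi> k) x))
    \<le> ennreal (C * exp (- \<beta>' * real (\<Sum>k=1..d. card (Lambda r k \<epsilon>)) powr (1 / real d)))"
proof (intro allI impI)
  fix \<beta>' assume b': "\<beta>' < \<beta>"
  let ?T = "KR d f\<^sub>\<rho> f\<^sub>\<pi>"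
  have C7: "0 < C\<^sub>7" using assms(5) by (simp add: regularity_constants_def)
  have r: "1 < r j" if "j \<in> {1..d}" for j using assms(10)[OF that] C7 assms(4)[OF that] by simp
  have dens: "density_between d M L f\<^sub>\<rho>" "density_between d M L f\<^sub>\<pi>"
    by (rule assumption_A_density_between[OF assms(8,2,4)], assumption,
        rule assumption_A_density_between[OF assms(9,2,4)], assumption)
  have "0 < (\<Prod>j=1..d. ln (r j))" by (intro prod_pos ln_gt_zero r)
  then have "0 < fact (d - 1) * (\<Prod>j=1..d. ln (r j))" by (intro mult_pos_pos) auto
  then have b: "0 < \<beta>" unfolding assms(11) by (simp only: powr_gt_zero)
  \<comment> \<open>The quotient is below 1 because \<beta>' < \<beta>; the lower value 1/2 keeps
    \<theta> positive when \<beta>' is not.\<close>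
  define \<theta> where "\<theta> = max (\<beta>' / \<beta>) (1 / 2)"
  have theta: "0 < \<theta>" "\<theta> < 1" "\<beta>' \<le> \<theta> * \<beta>"
    using b b' by (auto simp: \<theta>_def field_simps max_def)
  have "\<forall>k\<in>{1..d}. \<exists>C\<ge>0. \<forall>\<epsilon>\<in>{0<..<1}. sobolev_norm d m (\<lambda>x. ?T k x - legendre_trunc r k \<epsilon> (?T k) x) \<le> ennreal (C * \<epsilon> powr \<theta>)"
  proof
    fix k assume k: "k \<in> {1..d}"
    have nbhd_eq: "poly_nbhd k (\<lambda>j. C\<^sub>7 * \<delta> j) = poly_nbhd k (\<lambda>j. r j - 1)"
      unfolding poly_nbhd_def by (rule PiE_cong) (use assms(10) k in auto)
    show "\<exists>C\<ge>0. \<forall>\<epsilon>\<in>{0<..<1}. sobolev_norm d m (\<lambda>x. ?T k x - legendre_trunc r k \<epsilon> (?T k) x) \<le> ennreal (C * \<epsilon> powr \<theta>)"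
    proof (rule KR_extension[OF assms(5,1) _ assms(8,9) k])
      show "\<And>j. j \<in> {1..d} \<Longrightarrow> 0 < \<delta> j" by (rule assms(4))
      fix R
      assume R: "holomorphic_n k (poly_nbhd k (\<lambda>j. C\<^sub>7 * \<delta> j)) R"
        "\<And>z. z \<in> poly_nbhd k (\<lambda>j. C\<^sub>7 * \<delta> j) \<Longrightarrow> norm (R z) \<le> 1 + C\<^sub>8"
        "\<And>x. x \<in> cube k \<Longrightarrow> ((\<lambda>t. ?T k (x(k := t))) has_vector_derivative Re (R (cemb k x))) (at (x k) within {-1..1})"
      show ?thesis
      proof (rule component_error[OF _ _ r R(1)[unfolded nbhd_eq]])
        show "\<And>z. z \<in> poly_nbhd k (\<lambda>j. r j - 1) \<Longrightarrow> norm (R z) \<le> 1 + C\<^sub>8"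
          by (rule R(2)[unfolded nbhd_eq])
        show "\<And>x. x \<in> cube k \<Longrightarrow> ((\<lambda>t. ?T k (x(k := t))) has_vector_derivative Re (R (cemb k x))) (at (x k) within {-1..1})"
          by (rule R(3))
        show "?T k x = -1" if "x \<in> cube k" "x k = -1" for x
          by (rule KR_left_end[OF dens]) (use k that in \<open>auto simp: interval_upto_def cube_def PiE_iff\<close>)
        show "?T k (restrict x {1..k}) = ?T k x" for x
          by (rule KR_depends[OF dens]) simp
      qed (use k theta in auto)
    qed
  qed
  then obtain C where C: "\<forall>k\<in>{1..d}. C k \<ge> 0 \<and> (\<forall>\<epsilon>\<in>{0<..<1}. sobolev_norm d m (\<lambda>x. ?T k x - legendre_trunc r k \<epsilon> (?T k) x) \<le> ennreal (C k * \<epsilon> powr \<theta>))"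
    by (rule bchoice[THEN exE])
  define S where "S = (\<Sum>j=1..d. ln (r j))"
  \<comment> \<open>The exponential compensates the factor exp(-\<theta> S) of the lattice count,
    and the summand 1 makes the constant positive.\<close>
  define C' where "C' = (\<Sum>k=1..d. C k) * exp (\<theta> * S) + 1"
  have C0: "0 \<le> (\<Sum>k=1..d. C k)" by (rule sum_nonneg) (use C in blast)
  have "(\<Sum>k=1..d. sobolev_norm d m (\<lambda>x. ?T k x - legendre_trunc r k \<epsilon> (?T k) x))
      \<le> ennreal (C' * exp (- \<beta>' * real (\<Sum>k=1..d. card (Lambda r k \<epsilon>)) powr (1 / real d)))"
    if eps: "\<epsilon> \<in> {0<..<1}" for \<epsilon>
  proof -
    let ?E = "exp (- \<beta>' * real (\<Sum>k=1..d. card (Lambda r k \<epsilon>)) powr (1 / real d))"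
    have "\<epsilon> powr \<theta> * exp (- \<theta> * S) \<le> ?E"
      unfolding S_def by (rule exp_card_lower_bound[OF assms(1) r _ _ assms(11)]) (use eps theta in auto)
    then have "\<epsilon> powr \<theta> * exp (- \<theta> * S) * exp (\<theta> * S) \<le> ?E * exp (\<theta> * S)" by (rule mult_right_mono) simp
    then have "\<epsilon> powr \<theta> \<le> ?E * exp (\<theta> * S)" by (simp add: mult.assoc flip: exp_add)
    then have "(\<Sum>k=1..d. C k) * \<epsilon> powr \<theta> \<le> (\<Sum>k=1..d. C k) * (?E * exp (\<theta> * S))"
      by (rule mult_left_mono[OF _ C0])
    also have "\<dots> \<le> C' * ?E" unfolding C'_def distrib_right by (simp add: mult_ac)
    finally have le: "(\<Sum>k=1..d. C k * \<epsilon> powr \<theta>) \<le> C' * ?E" by (simp only: sum_distrib_right)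
    have "(\<Sum>k=1..d. sobolev_norm d m (\<lambda>x. ?T k x - legendre_trunc r k \<epsilon> (?T k) x)) \<le> (\<Sum>k=1..d. ennreal (C k * \<epsilon> powr \<theta>))"
      by (rule sum_mono) (use C eps in blast)
    also have "\<dots> = ennreal (\<Sum>k=1..d. C k * \<epsilon> powr \<theta>)"
      by (rule sum_ennreal) (use C in auto)
    also have "\<dots> \<le> ennreal (C' * ?E)" by (rule ennreal_leI[OF le])
    finally show ?thesis .
  qed
  moreover have "0 < C'" unfolding C'_def using C0 by (intro add_nonneg_pos mult_nonneg_nonneg) auto
  ultimately show "\<exists>C>0. \<forall>\<epsilon>\<in>{0<..<1}. (\<Sum>k=1..d. sobolev_norm d m
       (\<lambda>x. KR d f\<^sub>\<rho> f\<^sub>\<pi> k x - legendre_trunc r k \<epsilon> (KR d f\<^sub>\<rho> f\<^sub>\<pi> k) x))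
    \<le> ennreal (C * exp (- \<beta>' * real (\<Sum>k=1..d. card (Lambda r k \<epsilon>)) powr (1 / real d)))"
    by (intro exI[of _ C'] conjI ballI)
qed

end
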